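(* Let $m$ be an integer with $1<m<\infty$ and let $f:\mathbb{S}^1\to\mathbb{S}^1$ be a uniformly asymptotically affine (UAA) circle endomorphism of degree $m$ with $f(1)=1$. Then there exists a uniformly asymptotically conformal (UAC) system $\tilde f$ acting in a neighborhood of the circle $\mathbb{S}^1$ such that the restriction of $\tilde f$ to $\mathbb{S}^1$ is equal to $f$.
   Context: $\mathbb{S}^1=\{z\in\mathbb{C}:|z|=1\}$ and $\pi:\mathbb{R}\to\mathbb{S}^1$, $\pi(x)=e^{2\pi i x}$. Circle endomorphism: an orientation preserving covering $f$ of degree $m$, $1<m<\infty$, from $\mathbb{S}^1$ onto itself, normalized so that $f(1)=1$. Its lift $F$ is the unique homeomorphism of $\mathbb{R}$ with $\pi\circ F=f\circ\pi$ and $F(0)=0$; it satisfies $F(x+1)=F(x)+m$. $f^n$ and $F^n$ denote $n$-fold compositions, and $F^{-n}$ is the inverse of the homeomorphism $F^n$. Vanishing function: a bounded positive function $\epsilon(y)$ defined for $y>0$ such that $\epsilon(y)\to 0^+$ as $y\to 0^+$. UAA: $f$ is uniformly asymptotically affine if there is a vanishing function $\epsilon(y)$ such that for all positive integers $n$, all real $x$ and all $y>0$, $$\frac{1}{1+\epsilon(y)}\le \frac{F^{-n}(x+y)-F^{-n}(x)}{F^{-n}(x)-F^{-n}(x-y)}\le 1+\epsilon(y).$$ Dilatation: for an orientation preserving (locally) quasiconformal map $g$ with Beltrami coefficient $\mu_g=g_{\bar z}/g_z$, the dilatation at $z$ is $K_z(g)=\frac{1+|\mu_g(z)|}{1-|\mu_g(z)|}$,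 defined for almost every $z$. UAC: an extension $\tilde f$ of a degree $m$ circle endomorphism $f$ is called a uniformly asymptotically conformal (UAC) system if $\tilde f$ is an orientation preserving, locally quasiconformal local homeomorphism defined in an annulus $A=\{r<|z|<1/r\}$, $0<r<1$, with $\tilde f|_{\mathbb{S}^1}=f$, it is reflection invariant, i.e. $\tilde f(1/\bar z)=1/\overline{\tilde f(z)}$ on $A$, and for every $\epsilon>0$ there is a possibly smaller annulus $U=\{r'<|z|<1/r'\}$ such that $$K_z(\tilde f^{-n})<1+\epsilon$$ for almost every $z\in U$ and for all positive integers $n$. Here $\tilde f^{-n}$ stands for the inverse branches of the $n$-fold iterate $\tilde f^n$ (on the set where this iterate is defined): it is understood that, for each $n$, every local inverse branch of $f^n$ at a point of $\mathbb{S}^1$ extends along every path in $U$ starting at that point as a local inverse branch of $\tilde f^n$, and the inequality is required for all the branches so obtained, with $\epsilon$ and $U$ not depending on $n$. *)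

theory Defs
  imports "HOL-Complex_Analysis.Complex_Analysis"
begin

definition circle_proj :: "real \<Rightarrow> complex" where
  "circle_proj x = exp (2 * of_real pi * \<i> * of_real x)"

text \<open>
  The winding number of the image of the circle is the signed degree of the covering: its
  absolute value is the number of sheets and it is positive exactly when orientation is preserved.
  Only the values of \<open>f\<close> on the unit circle matter.
\<close>
definition circle_endomorphism :: "nat \<Rightarrow> (complex \<Rightarrow> complex) \<Rightarrow> bool" where
  "circle_endomorphism m f \<longleftrightarrow>
     1 < m \<and>
     covering_space (sphere 0 1) f (sphere 0 1) \<and>
     winding_number (f \<circ> circlepath 0 1) 0 = of_nat m \<and>
     f 1 = 1"

definition is_lift :: "(complex \<Rightarrow> complex) \<Rightarrow> (real \<Rightarrow> real) \<Rightarrow> bool" where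
  "is_lift f F \<longleftrightarrow>
     (\<exists>G. homeomorphism UNIV UNIV F G) \<and>
     circle_proj \<circ> F = f \<circ> circle_proj \<and>
     F 0 = 0"

text \<open>Only the values at positive arguments matter.\<close>
definition vanishing :: "(real \<Rightarrow> real) \<Rightarrow> bool" where
  "vanishing \<epsilon> \<longleftrightarrow>
     (\<forall>y>0. 0 < \<epsilon> y) \<and> bounded (\<epsilon> ` {0<..}) \<and> filterlim \<epsilon> (at_right 0) (at_right 0)"

text \<open>The lift of a circle endomorphism exists and is unique.\<close>
definition uniformly_asymptotically_affine :: "(complex \<Rightarrow> complex) \<Rightarrow> bool" where
  "uniformly_asymptotically_affine f \<longleftrightarrow>
     (\<exists>F. is_lift f F \<and>
        (\<exists>\<epsilon>. vanishing \<epsilon> \<and>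
           (\<forall>n>0. \<forall>x. \<forall>y>0.
              let Fn = inv (F ^^ n);
                  q = (Fn (x + y) - Fn x) / (Fn x - Fn (x - y))
              in 1 / (1 + \<epsilon> y) \<le> q \<and> q \<le> 1 + \<epsilon> y)))"

definition abs_continuous_on :: "real \<Rightarrow> real \<Rightarrow> (real \<Rightarrow> 'a::metric_space) \<Rightarrow> bool" where
  "abs_continuous_on a b h \<longleftrightarrow>
     (\<forall>e>0. \<exists>d>0. \<forall>(n::nat) u v.
        (\<forall>i<n. a \<le> u i \<and> u i \<le> v i \<and> v i \<le> b) \<and>
        (\<forall>i<n. \<forall>j<n. i \<noteq> j \<longrightarrow> {u i<..<v i} \<inter> {u j<..<v j} = {}) \<and>
        (\<Sum>i<n. v i - u i) < d
        \<longrightarrow> (\<Sum>i<n. dist (h (u i)) (h (v i))) < e)"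

text \<open>Absolute continuity on lines: in every closed rectangle, on almost every horizontal and on
  almost every vertical segment.\<close>
definition ACL_on :: "complex set \<Rightarrow> (complex \<Rightarrow> complex) \<Rightarrow> bool" where
  "ACL_on V g \<longleftrightarrow>
     (\<forall>a b c d. cbox (Complex a c) (Complex b d) \<subseteq> V \<longrightarrow>
        (AE y in lebesgue. y \<in> {c..d} \<longrightarrow> abs_continuous_on a b (\<lambda>x. g (Complex x y))) \<and>
        (AE x in lebesgue. x \<in> {a..b} \<longrightarrow> abs_continuous_on c d (\<lambda>y. g (Complex x y))))"

definition partial_x :: "(complex \<Rightarrow> complex) \<Rightarrow> complex \<Rightarrow> complex" where
  "partial_x g z = vector_derivative (\<lambda>t. g (z + of_real t)) (at 0)"

definition partial_y :: "(complex \<Rightarrow> complex) \<Rightarrow> complex \<Rightarrow> complex" where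
  "partial_y g z = vector_derivative (\<lambda>t. g (z + \<i> * of_real t)) (at 0)"

definition d_z :: "(complex \<Rightarrow> complex) \<Rightarrow> complex \<Rightarrow> complex" where
  "d_z g z = (partial_x g z - \<i> * partial_y g z) / 2"

definition d_zbar :: "(complex \<Rightarrow> complex) \<Rightarrow> complex \<Rightarrow> complex" where
  "d_zbar g z = (partial_x g z + \<i> * partial_y g z) / 2"

text \<open>
  For a quasiconformal map the partial derivatives exist, \<open>d_z g \<noteq> 0\<close> and
  \<open>cmod (beltrami g z) < 1\<close> at almost every point, so the conventions for undefined derivatives
  and for division by zero concern a null set only.
\<close>
definition beltrami :: "(complex \<Rightarrow> complex) \<Rightarrow> complex \<Rightarrow> complex" where
  "beltrami g z = d_zbar g z / d_z g z"

definition dilatation :: "(complex \<Rightarrow> complex) \<Rightarrow> complex \<Rightarrow> real" where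
  "dilatation g z = (1 + cmod (beltrami g z)) / (1 - cmod (beltrami g z))"

text \<open>The analytic definition (Ahlfors): an ACL homeomorphism whose complex dilatation is bounded
  away from 1 almost everywhere.\<close>
definition quasiconformal_on :: "complex set \<Rightarrow> (complex \<Rightarrow> complex) \<Rightarrow> bool" where
  "quasiconformal_on V g \<longleftrightarrow>
     open V \<and> open (g ` V) \<and> (\<exists>h. homeomorphism V (g ` V) g h) \<and>
     ACL_on V g \<and>
     (\<exists>k. 0 \<le> k \<and> k < 1 \<and>
        (AE z in lebesgue. z \<in> V \<longrightarrow> cmod (d_zbar g z) \<le> k * cmod (d_z g z)))"

text \<open>In particular such a map is a local homeomorphism. The bound may depend on \<open>V\<close>.\<close>
definition locally_quasiconformal_on :: "complex set \<Rightarrow> (complex \<Rightarrow> complex) \<Rightarrow> bool" where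
  "locally_quasiconformal_on A g \<longleftrightarrow>
     (\<forall>z\<in>A. \<exists>V. z \<in> V \<and> V \<subseteq> A \<and> quasiconformal_on V g)"

text \<open>For local homeomorphisms: the local degree, which is 1 or -1, is 1 at every point.\<close>
definition orientation_preserving_on :: "complex set \<Rightarrow> (complex \<Rightarrow> complex) \<Rightarrow> bool" where
  "orientation_preserving_on A g \<longleftrightarrow>
     (\<forall>z\<in>A. \<forall>\<^sub>F \<rho> in at_right 0. winding_number (g \<circ> circlepath z \<rho>) (g z) = 1)"

definition iterate_domain :: "complex set \<Rightarrow> (complex \<Rightarrow> complex) \<Rightarrow> nat \<Rightarrow> complex set" where
  "iterate_domain A g n = {z. \<forall>k<n. (g ^^ k) z \<in> A}"

definition inverse_branch_at ::
  "complex set \<Rightarrow> (complex \<Rightarrow> complex) \<Rightarrow> nat \<Rightarrow> complex \<Rightarrow> (complex \<Rightarrow> complex) \<Rightarrow> bool" where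
  "inverse_branch_at A g n p h \<longleftrightarrow>
     (\<exists>V. open V \<and> p \<in> V \<and> continuous_on V h \<and> h ` V \<subseteq> iterate_domain A g n \<and>
        (\<forall>w\<in>V. (g ^^ n) (h w) = w))"

definition circle_inverse_branch_at ::
  "(complex \<Rightarrow> complex) \<Rightarrow> nat \<Rightarrow> complex \<Rightarrow> (complex \<Rightarrow> complex) \<Rightarrow> bool" where
  "circle_inverse_branch_at f n p b \<longleftrightarrow>
     (\<exists>I. openin (top_of_set (sphere 0 1)) I \<and> p \<in> I \<and> continuous_on I b \<and> b ` I \<subseteq> sphere 0 1 \<and>
        (\<forall>w\<in>I. (f ^^ n) (b w) = w))"

text \<open>
  As for analytic continuation of function elements: \<open>H t\<close> is an inverse branch near
  \<open>\<gamma> t\<close>, its germs at nearby points of the path are those of the neighbouring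
  branches, and \<open>H 0\<close> extends the branch \<open>b\<close> given on the circle.
\<close>
definition continues_branch_along ::
  "complex set \<Rightarrow> (complex \<Rightarrow> complex) \<Rightarrow> nat \<Rightarrow> (complex \<Rightarrow> complex) \<Rightarrow> (real \<Rightarrow> complex)
     \<Rightarrow> (real \<Rightarrow> complex \<Rightarrow> complex) \<Rightarrow> bool" where
  "continues_branch_along A g n b \<gamma> H \<longleftrightarrow>
     (\<forall>t\<in>{0..1}. inverse_branch_at A g n (\<gamma> t) (H t)) \<and>
     (\<forall>t\<in>{0..1}. \<forall>\<^sub>F s in at t within {0..1}. \<forall>\<^sub>F w in nhds (\<gamma> s). H s w = H t w) \<and>
     (\<forall>\<^sub>F w in nhds (\<gamma> 0). w \<in> sphere 0 1 \<longrightarrow> H 0 w = b w)"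

definition annulus :: "real \<Rightarrow> complex set" where
  "annulus r = {z. r < cmod z \<and> cmod z < 1 / r}"

text \<open>
  Since \<open>1 / cnj 0 = 0\<close> in HOL, reflection invariance of a map with finite values is expressed
  together with \<open>g z \<noteq> 0\<close>.
\<close>
definition reflection_invariant_on :: "complex set \<Rightarrow> (complex \<Rightarrow> complex) \<Rightarrow> bool" where
  "reflection_invariant_on A g \<longleftrightarrow>
     (\<forall>z\<in>A. g z \<noteq> 0 \<and> g (1 / cnj z) = 1 / cnj (g z))"

text \<open>Inside the quantifiers, \<open>b\<close> ranges over all local inverse branches of \<open>f ^^ n\<close> at points of
  the circle, and \<open>H 1\<close> is the branch obtained by continuing \<open>b\<close> along \<open>\<gamma>\<close>.\<close>
definition UAC_system ::
  "real \<Rightarrow> (complex \<Rightarrow> complex) \<Rightarrow> (complex \<Rightarrow> complex) \<Rightarrow> bool" where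
  "UAC_system r f g \<longleftrightarrow>
     0 < r \<and> r < 1 \<and>
     orientation_preserving_on (annulus r) g \<and>
     locally_quasiconformal_on (annulus r) g \<and>
     (\<forall>z\<in>sphere 0 1. g z = f z) \<and>
     reflection_invariant_on (annulus r) g \<and>
     (\<forall>\<epsilon>>0. \<exists>r'. r \<le> r' \<and> r' < 1 \<and>
        (\<forall>n>0.
           (\<forall>\<gamma> b. path \<gamma> \<and> path_image \<gamma> \<subseteq> annulus r' \<and> pathstart \<gamma> \<in> sphere 0 1 \<and>
                  circle_inverse_branch_at f n (pathstart \<gamma>) b \<longrightarrow>
              (\<exists>H. continues_branch_along (annulus r) g n b \<gamma> H)) \<and>
           (AE z in lebesgue. z \<in> annulus r' \<longrightarrow>
              (\<forall>\<gamma> b H. path \<gamma> \<and> path_image \<gamma> \<subseteq> annulus r' \<and> pathstart \<gamma> \<in> sphere 0 1 \<and>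
                  circle_inverse_branch_at f n (pathstart \<gamma>) b \<and>
                  continues_branch_along (annulus r) g n b \<gamma> H \<and> pathfinish \<gamma> = z \<longrightarrow>
                dilatation (H 1) z < 1 + \<epsilon>))))"

end

theory Submission
  imports Defs
begin

text \<open>
  Let \<open>F\<close> be the lift and \<open>\<Phi> n\<close> the inverse of \<open>F ^^ n\<close>. Because UAA makes all \<open>\<Phi> n\<close> uniformly
  quasisymmetric, \<open>F\<close> is conjugate to \<open>x \<mapsto> m x\<close> by a quasisymmetric \<open>h\<close>, so that
  \<open>h (x / m ^ n) = \<Phi> n (h x)\<close>. Extend \<open>h\<close> to the plane by the Beurling-Ahlfors formula, \<open>H = ba h\<close>,
  and let the extended lift be \<open>H \<circ> (m *) \<circ> inv H\<close>. The Beurling-Ahlfors formula commutes with real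
  scalings, so the inverse of the \<open>n\<close>-th iterate of the extended lift is \<open>ba (\<Phi> n \<circ> h) \<circ> inv H\<close>.
  Near the real line the formula only sees \<open>\<Phi> n\<close> on short intervals, where by UAA it is affine up to a
  small relative error uniformly in \<open>n\<close>. As the formula also commutes with real affine maps, the
  derivative of \<open>ba (\<Phi> n \<circ> h)\<close> is close to a real multiple of that of \<open>H\<close>, and the inverse iterates
  are nearly conformal. Since the extended lift is defined on all of the plane, inverse branches
  continue along all paths.

  Absolute continuity across the circle comes from the case \<open>n = 1\<close> of UAA, which makes \<open>F\<close> Hoelder
  continuous with exponent \<open>1/2\<close>; the derivative of the extended lift is then
  \<open>O (1 / sqrt \<bar>Im z\<bar>)\<close>, hence integrable along lines that are not tangent to the circle.
\<close>

section \<open>Dynamics of the lift\<close>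

text \<open>The obstacle is that the Beurling-Ahlfors formula does not respect composition: if
  \<open>F\<close> were extended directly and then iterated, the dilatations of \<open>n\<close>
  maps would multiply, and UAA says nothing about that product. Scalings are the exception. The
  conjugacy \<open>h\<close> therefore turns the whole inverse iterate into a single extension
  \<open>ba (\<Phi> n \<circ> h)\<close> preceded by \<open>inv H\<close>, and one error is made for
  each \<open>n\<close> instead of \<open>n\<close> errors. The two properties of a vanishing
  function do different work. Boundedness of \<epsilon> gives one quasisymmetry constant for all
  \<open>\<Phi> n\<close>, hence for \<open>h\<close>, and so makes \<open>H\<close> quasiconformal
  with a possibly large dilatation. The limit \<epsilon> \<rightarrow> 0 gives the affine
  approximation. The dilatation of \<open>H\<close> does no harm near the circle because
  \<open>ba (\<Phi> n \<circ> h)\<close> has almost the same Beltrami coefficient there and the two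
  cancel in the composition with \<open>inv H\<close>.\<close>

definition quasisymmetric :: "real \<Rightarrow> (real \<Rightarrow> real) \<Rightarrow> bool" where
  "quasisymmetric M h \<longleftrightarrow> 1 \<le> M \<and> (\<forall>x y. y > 0 \<longrightarrow>
     h (x + y) - h x \<le> M * (h x - h (x - y)) \<and> h x - h (x - y) \<le> M * (h (x + y) - h x))"

lemma quasisymmetric_scale:
  assumes "quasisymmetric M h" "c > 0" shows "quasisymmetric M (\<lambda>x. h (c * x))"
  using assms unfolding quasisymmetric_def by (simp add: distrib_left right_diff_distrib)

lemma quasisymmetric_double_le:
  assumes "quasisymmetric M h" "y > 0"
  shows "h (x + 2 * y) - h x \<le> (1 + M) * (h (x + y) - h x)"
    and "h (x + 2 * y) - h x \<le> (1 + M) * (h (x + 2 * y) - h (x + y))"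
proof -
  have "h (x + y + y) - h (x + y) \<le> M * (h (x + y) - h (x + y - y))"
    "h (x + y) - h (x + y - y) \<le> M * (h (x + y + y) - h (x + y))"
    using assms unfolding quasisymmetric_def by blast+
  then show "h (x + 2 * y) - h x \<le> (1 + M) * (h (x + y) - h x)"
    "h (x + 2 * y) - h x \<le> (1 + M) * (h (x + 2 * y) - h (x + y))"
    by (simp_all add: algebra_simps)
qed

text \<open>Doubling an interval adds a second half whose image has at least 1 / M times the length
  of the image of the first.\<close>

lemma quasisymmetric_growth:
  assumes "quasisymmetric M h" "y > 0"
  shows "(1 + 1 / M) ^ k * (h (x + y) - h x) \<le> h (x + 2 ^ k * y) - h x"
proof (induction k)
  case (Suc k)
  let ?y = "2 ^ k * y"
  have M: "M \<ge> 1" using assms by (simp add: quasisymmetric_def)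
  have "?y > 0" using assms by simp
  then have *: "h (x + ?y) - h (x + ?y - ?y) \<le> M * (h (x + ?y + ?y) - h (x + ?y))"
    using assms unfolding quasisymmetric_def by blast
  have e: "x + ?y - ?y = x" "x + ?y + ?y = x + 2 ^ Suc k * y" by simp_all
  have "h (x + ?y) - h x \<le> M * (h (x + 2 ^ Suc k * y) - h (x + ?y))"
    using * unfolding e .
  then have "(h (x + ?y) - h x) / M \<le> h (x + 2 ^ Suc k * y) - h (x + ?y)"
    using M by (simp add: field_simps)
  then have **: "(1 + 1 / M) * (h (x + ?y) - h x) \<le> h (x + 2 ^ Suc k * y) - h x"
    by (simp only: distrib_right) simp
  have "(1 + 1 / M) ^ Suc k * (h (x + y) - h x) = (1 + 1 / M) * ((1 + 1 / M) ^ k * (h (x + y) - h x))"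
    by simp
  also have "\<dots> \<le> (1 + 1 / M) * (h (x + ?y) - h x)"
    using M Suc by (intro mult_left_mono) auto
  finally show ?case using ** by linarith
qed simp

text \<open>Neighbouring increments over the grid of step \<open>y\<close> differ by a factor at
  most \<open>c\<close>, so any two of the \<open>N\<close> increments differ by at most
  \<open>c ^ N\<close>, and each is close to their mean. Summing bounds the error at grid points by
  the term \<open>c ^ N - 1\<close>; between grid points monotonicity costs one more mean increment,
  the term \<open>1 / real N\<close>.\<close>

lemma almost_affine_of_equal_steps:
  fixes \<phi> :: "real \<Rightarrow> real"
  assumes mono: "mono \<phi>" and N: "N > 0" and ab: "a < b" and c: "c \<ge> 1" and y: "y = (b - a) / real N"
    and step: "\<And>x. \<phi> (x + y) - \<phi> x \<le> c * (\<phi> x - \<phi> (x - y)) \<and> \<phi> x - \<phi> (x - y) \<le> c * (\<phi> (x + y) - \<phi> x)"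
    and t: "t \<in> {a..b}"
  shows "\<bar>\<phi> t - \<phi> a - (\<phi> b - \<phi> a) / (b - a) * (t - a)\<bar> \<le> (1 / real N + (c ^ N - 1)) * (\<phi> b - \<phi> a)"
proof -
  define d where "d k = \<phi> (a + real (Suc k) * y) - \<phi> (a + real k * y)" for k
  define S where "S = \<phi> b - \<phi> a"
  define R where "R = c ^ N"
  have R: "R \<ge> 1" unfolding R_def using c by simp
  have yp: "y > 0" using y N ab by simp
  have d0: "d k \<ge> 0" for k unfolding d_def using yp by (auto intro!: monoD[OF mono] mult_right_mono)
  have S0: "S \<ge> 0" unfolding S_def using ab by (auto intro: monoD[OF mono])
  have st: "d (Suc k) \<le> c * d k" "d k \<le> c * d (Suc k)" for k
  proof -
    have e: "a + real (Suc k) * y + y = a + real (Suc (Suc k)) * y"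
      "a + real (Suc k) * y - y = a + real k * y" by (auto simp: algebra_simps)
    show "d (Suc k) \<le> c * d k" "d k \<le> c * d (Suc k)"
      using step[of "a + real (Suc k) * y"] unfolding d_def e by auto
  qed
  have st2: "d (k + i) \<le> c ^ i * d k \<and> d k \<le> c ^ i * d (k + i)" for k i
  proof (induction i)
    case (Suc i)
    have "d (k + Suc i) \<le> c * d (k + i)" "d (k + i) \<le> c * d (k + Suc i)" using st by auto
    moreover have "c * d (k + i) \<le> c * (c ^ i * d k)" using Suc c by (intro mult_left_mono) auto
    moreover have "c ^ i * d (k + i) \<le> c ^ i * (c * d (k + Suc i))"
      using st c by (intro mult_left_mono) auto
    ultimately show ?case using Suc by (auto simp: algebra_simps)
  qed simp
  have dd: "d j \<le> R * d k" if "j < N" "k < N" for j k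
  proof -
    define i where "i = (if j \<le> k then k - j else j - k)"
    have "d j \<le> c ^ i * d k" using st2[of j i] st2[of k i] unfolding i_def by (auto split: if_splits)
    also have "\<dots> \<le> R * d k" unfolding R_def
      using c that d0 by (intro mult_right_mono power_increasing) (auto simp: i_def)
    finally show ?thesis .
  qed
  have tel: "(\<Sum>j<k. d j) = \<phi> (a + real k * y) - \<phi> a" for k
    by (induction k) (auto simp: d_def)
  have SN: "(\<Sum>j<N. d j) = S" unfolding tel S_def using y N by simp
  have dj: "\<bar>d j - S / N\<bar> \<le> (R - 1) * S / N" if "j < N" for j
  proof -
    have "(\<Sum>i<N. d j) \<le> (\<Sum>i<N. R * d i)" using dd that by (intro sum_mono) auto
    then have 1: "N * d j \<le> R * S" by (simp add: sum_distrib_left[symmetric] SN)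
    have "(\<Sum>i<N. d i) \<le> (\<Sum>i<N. R * d j)" using dd that by (intro sum_mono) auto
    then have 2: "S \<le> R * (N * d j)" by (simp add: SN algebra_simps)
    have "R * S - S \<ge> S - N * d j"
    proof -
      have "S - N * d j \<le> (R - 1) * (N * d j)" using 2 by (simp add: algebra_simps)
      moreover have "(R - 1) * (N * d j) \<le> (R - 1) * S" if "N * d j \<le> S"
        using that R by (intro mult_left_mono) auto
      moreover have "0 \<le> (R - 1) * S" using R S0 by simp
      ultimately show ?thesis by (cases "N * d j \<le> S") (auto simp: algebra_simps)
    qed
    then have "\<bar>N * d j - S\<bar> \<le> (R - 1) * S" using 1 by (simp add: algebra_simps abs_le_iff)
    then have "\<bar>N * d j - S\<bar> / N \<le> (R - 1) * S / N" by (intro divide_right_mono) auto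
    moreover have "\<bar>N * d j - S\<bar> / N = \<bar>d j - S / N\<bar>"
      using N by (simp add: abs_if field_simps)
    ultimately show ?thesis by simp
  qed
  have grid: "\<bar>\<phi> (a + real k * y) - \<phi> a - k * (S / N)\<bar> \<le> (R - 1) * S" if "k \<le> N" for k
  proof -
    have "\<phi> (a + real k * y) - \<phi> a - k * (S / N) = (\<Sum>j<k. d j - S / N)"
      by (simp add: sum_subtractf tel)
    also have "\<bar>\<dots>\<bar> \<le> (\<Sum>j<k. \<bar>d j - S / N\<bar>)" by (rule sum_abs)
    also have "\<dots> \<le> (\<Sum>j<k. (R - 1) * S / N)" using dj that by (intro sum_mono) auto
    also have "\<dots> \<le> (\<Sum>j<N. (R - 1) * S / N)" using that R S0 by (intro sum_mono2) auto
    also have "\<dots> = (R - 1) * S" using N by simp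
    finally show ?thesis .
  qed
  show ?thesis
  proof (cases "t = b")
    case True
    have "0 \<le> (1 / real N + (R - 1)) * S" using R S0 by auto
    then show ?thesis using True ab by (simp add: R_def S_def)
  next
    case False
    \<comment> \<open>Since \<open>t < b\<close>, this gives \<open>k < N\<close>, so the right
      neighbour \<open>Suc k\<close> is still a grid point; for \<open>t = b\<close> it would not
      be.\<close>
    define k where "k = nat \<lfloor>(t - a) / y\<rfloor>"
    have q: "0 \<le> (t - a) / y" "(t - a) / y < N"
      using t False yp ab N by (auto simp: y field_simps)
    then have k: "real k \<le> (t - a) / y" "(t - a) / y < real k + 1" "k < N"
      unfolding k_def by linarith+
    have lo: "\<phi> (a + real k * y) \<le> \<phi> t" and hi: "\<phi> t \<le> \<phi> (a + real (Suc k) * y)"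
      using k yp by (auto intro!: monoD[OF mono] simp: field_simps)
    have e: "(\<phi> b - \<phi> a) / (b - a) * (t - a) = (t - a) / y * (S / N)"
      using N ab by (simp add: y S_def)
    have sn: "S / N \<ge> 0" using S0 by simp
    have "real k * (S / N) \<le> (t - a) / y * (S / N)" "(t - a) / y * (S / N) \<le> (real k + 1) * (S / N)"
      using k sn by (auto intro!: mult_right_mono simp del: times_divide_eq_right times_divide_eq_left)
    then have "\<bar>\<phi> t - \<phi> a - (t - a) / y * (S / N)\<bar> \<le> S / N + (R - 1) * S"
      using lo hi grid[of k] grid[of "Suc k"] k(3)
      by (simp add: abs_le_iff distrib_right del: times_divide_eq_right times_divide_eq_left)
    moreover have "S / N + (R - 1) * S = (1 / real N + (c ^ N - 1)) * (\<phi> b - \<phi> a)"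
      unfolding R_def S_def by (simp add: distrib_right)
    ultimately show ?thesis unfolding e by simp
  qed
qed

section \<open>The lift, its iterates and their inverses\<close>

locale uaa_lift =
  fixes F :: "real \<Rightarrow> real" and m :: nat and \<epsilon> :: "real \<Rightarrow> real"
  assumes m: "1 < m"
    and cont: "continuous_on UNIV F"
    and mono: "strict_mono F"
    and shift: "F (x + 1) = F x + m"
    and F0: "F 0 = 0"
    and vanish: "vanishing \<epsilon>"
    and uaa: "n > 0 \<Longrightarrow> y > 0 \<Longrightarrow>
      1 / (1 + \<epsilon> y) \<le> (inv (F ^^ n) (x + y) - inv (F ^^ n) x) / (inv (F ^^ n) x - inv (F ^^ n) (x - y)) \<and>
      (inv (F ^^ n) (x + y) - inv (F ^^ n) x) / (inv (F ^^ n) x - inv (F ^^ n) (x - y)) \<le> 1 + \<epsilon> y"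
begin

abbreviation \<Phi> :: "nat \<Rightarrow> real \<Rightarrow> real" where "\<Phi> n \<equiv> inv (F ^^ n)"

lemma shift_nat: "F (x + real k) = F x + m * real k"
proof (induction k)
  case (Suc k)
  have "F (x + real (Suc k)) = F ((x + real k) + 1)" by (simp add: algebra_simps)
  then show ?case using Suc shift[of "x + real k"] by (simp add: algebra_simps)
qed simp

lemma shift_int: "F (x + of_int k) = F x + m * of_int k"
proof (cases "k \<ge> 0")
  case True
  then show ?thesis using shift_nat[of x "nat k"] by simp
next
  case False
  then show ?thesis using shift_nat[of "x + of_int k" "nat (- k)"] by (simp add: algebra_simps)
qed

lemma shift_funpow: "(F ^^ n) (x + of_int k) = (F ^^ n) x + real m ^ n * of_int k"
proof (induction n)
  case (Suc n)
  have "(F ^^ Suc n) (x + of_int k) = F ((F ^^ n) x + of_int (int m ^ n * k))"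
    using Suc by simp
  also have "\<dots> = F ((F ^^ n) x) + m * (real m ^ n * of_int k)"
    by (subst shift_int) simp
  finally show ?case by simp
qed simp

lemma mono_funpow: "strict_mono (F ^^ n)"
  by (induction n) (use mono in \<open>auto simp: strict_mono_def\<close>)

lemma surj_F: "surj F"
proof -
  have "\<exists>x. F x = y" for y
  proof -
    define k where "k = \<lceil>\<bar>y\<bar>\<rceil>"
    have k: "real_of_int k \<ge> \<bar>y\<bar>" unfolding k_def by linarith
    have k0: "real_of_int k \<ge> 0" using k by linarith
    have mk: "real m * real_of_int k \<ge> real_of_int k" using m k0
      by (simp add: mult_le_cancel_right1)
    have "F (of_int k) = real m * of_int k" "F (- of_int k) = - (real m * of_int k)"
      using shift_int[of 0 k] shift_int[of 0 "-k"] F0 by auto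
    then have "F (- of_int k) \<le> y" "y \<le> F (of_int k)" using k mk by linarith+
    then show ?thesis
      using IVT'[of F "- of_int k" y "of_int k"] k0 continuous_on_subset[OF cont] by auto
  qed
  then show ?thesis by (metis surjI)
qed

lemma bij_funpow: "bij (F ^^ n)"
proof -
  have "bij F" using surj_F strict_mono_imp_inj_on[OF mono] by (simp add: bij_def)
  then show ?thesis by (simp add: bij_betw_funpow)
qed

lemma funpow_\<Phi> [simp]: "(F ^^ n) (\<Phi> n x) = x" and \<Phi>_funpow [simp]: "\<Phi> n ((F ^^ n) x) = x"
  using bij_funpow[of n] by (auto simp: bij_def surj_f_inv_f inv_f_f)

lemma mono_\<Phi>: "strict_mono (\<Phi> n)"
proof (rule strict_monoI)
  fix x y :: real assume "x < y"
  then show "\<Phi> n x < \<Phi> n y"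
    by (metis funpow_\<Phi> mono_funpow not_less_iff_gr_or_eq strict_mono_less)
qed

lemma \<Phi>_shift: "\<Phi> n (x + real m ^ n * of_int k) = \<Phi> n x + of_int k"
  by (metis \<Phi>_funpow funpow_\<Phi> shift_funpow)

lemma cont_funpow: "continuous_on UNIV (F ^^ n)"
proof (induction n)
  case 0 then show ?case by (simp add: id_def)
next
  case (Suc n)
  have "continuous_on UNIV (F \<circ> (F ^^ n))"
    by (rule continuous_on_compose[OF Suc]) (rule continuous_on_subset[OF cont], simp)
  then show ?case by simp
qed

lemma uaa_le:
  assumes "n > 0" "y > 0" "\<epsilon> y \<le> c"
  shows "\<Phi> n (x + y) - \<Phi> n x \<le> (1 + c) * (\<Phi> n x - \<Phi> n (x - y))"
    and "\<Phi> n x - \<Phi> n (x - y) \<le> (1 + c) * (\<Phi> n (x + y) - \<Phi> n x)"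
proof -
  have e: "\<epsilon> y > 0" using vanish assms by (simp add: vanishing_def)
  have pos: "\<Phi> n x - \<Phi> n (x - y) > 0" "\<Phi> n (x + y) - \<Phi> n x > 0"
    using mono_\<Phi>[of n] assms by (auto simp: strict_mono_def)
  then have "\<Phi> n (x + y) - \<Phi> n x \<le> (1 + \<epsilon> y) * (\<Phi> n x - \<Phi> n (x - y))"
    "\<Phi> n x - \<Phi> n (x - y) \<le> (1 + \<epsilon> y) * (\<Phi> n (x + y) - \<Phi> n x)"
    using uaa[OF assms(1,2), of x] e by (auto simp: field_simps)
  moreover have "(1 + \<epsilon> y) * (\<Phi> n x - \<Phi> n (x - y)) \<le> (1 + c) * (\<Phi> n x - \<Phi> n (x - y))"
    "(1 + \<epsilon> y) * (\<Phi> n (x + y) - \<Phi> n x) \<le> (1 + c) * (\<Phi> n (x + y) - \<Phi> n x)"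
    using pos assms(3) by (auto intro: mult_right_mono)
  ultimately show "\<Phi> n (x + y) - \<Phi> n x \<le> (1 + c) * (\<Phi> n x - \<Phi> n (x - y))"
    "\<Phi> n x - \<Phi> n (x - y) \<le> (1 + c) * (\<Phi> n (x + y) - \<Phi> n x)" by linarith+
qed

text \<open>Choice fixes one constant for the whole locale, common to all \<open>n\<close>. It
  exists because a bound \<open>B\<close> of \<epsilon> makes every \<open>\<Phi> n\<close>
  quasisymmetric with constant \<open>1 + B\<close>.\<close>

definition M\<^sub>0 :: real where "M\<^sub>0 = (SOME M. M \<ge> 1 \<and> (\<forall>n>0. quasisymmetric M (\<Phi> n)))"

lemma M\<^sub>0: "M\<^sub>0 \<ge> 1" "n > 0 \<Longrightarrow> quasisymmetric M\<^sub>0 (\<Phi> n)"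
proof -
  obtain B where B: "\<And>y. y > 0 \<Longrightarrow> \<bar>\<epsilon> y\<bar> \<le> B"
    using vanish unfolding vanishing_def bounded_iff by auto
  have B0: "B \<ge> 0" using B[of 1] by linarith
  have "quasisymmetric (1 + B) (\<Phi> n)" if "n > 0" for n
    unfolding quasisymmetric_def
  proof (intro conjI allI impI)
    fix x y :: real assume y: "y > 0"
    have "\<epsilon> y \<le> B" using B[OF y] by linarith
    from uaa_le[OF that y this] show "\<Phi> n (x + y) - \<Phi> n x \<le> (1 + B) * (\<Phi> n x - \<Phi> n (x - y))"
      "\<Phi> n x - \<Phi> n (x - y) \<le> (1 + B) * (\<Phi> n (x + y) - \<Phi> n x)" by auto
  qed (use B0 in simp)
  then have "\<exists>M. M \<ge> 1 \<and> (\<forall>n>0. quasisymmetric M (\<Phi> n))" using B0 by (intro exI[of _ "1+B"]) auto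
  from someI_ex[OF this] show "M\<^sub>0 \<ge> 1" "n > 0 \<Longrightarrow> quasisymmetric M\<^sub>0 (\<Phi> n)"
    unfolding M\<^sub>0_def by auto
qed

section \<open>The conjugacy with multiplication by \<open>m\<close>\<close>

definition \<psi> :: "real \<Rightarrow> real" where "\<psi> x = F x - real m * x"

lemma \<psi>_bounded: "\<bar>\<psi> x\<bar> \<le> m"
proof -
  define k where "k = \<lfloor>x\<rfloor>"
  have x: "of_int k \<le> x" "x < of_int k + 1" unfolding k_def by linarith+
  have "F (of_int k) = real m * of_int k" using shift_int[of 0 k] F0 by simp
  moreover have "F (of_int k + 1) = real m * of_int k + real m" using calculation shift by simp
  ultimately have F: "real m * of_int k \<le> F x" "F x \<le> real m * of_int k + real m"
    using x strict_mono_less_eq[OF mono, of "of_int k" x]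
      strict_mono_less_eq[OF mono, of x "of_int k + 1"] by auto
  have "real m * of_int k \<le> real m * x" "real m * x \<le> real m * of_int k + real m"
    using x m mult_left_mono[of "of_int k" x "real m"] mult_left_mono[of x "of_int k + 1" "real m"]
    by (auto simp: algebra_simps)
  then show ?thesis using F unfolding \<psi>_def by linarith
qed

lemma \<psi>_term_bound: "norm (\<psi> ((F ^^ n) x) / real m ^ Suc n) \<le> (1 / real m) ^ n"
proof -
  have "\<bar>\<psi> ((F ^^ n) x)\<bar> / real m ^ Suc n \<le> m / real m ^ Suc n"
    by (intro divide_right_mono \<psi>_bounded) auto
  also have "\<dots> = (1 / real m) ^ n" using m by (simp add: power_one_over field_simps)
  finally show ?thesis by simp
qed

lemma summable_geo: "summable (\<lambda>n. (1 / real m) ^ n)"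
  using m by (intro summable_geometric) auto

text \<open>The partial sums telescope, so this is the limit of
  \<open>(F ^^ n) x / real m ^ n\<close>. As a series with bounded numerators it converges
  uniformly, which gives continuity.\<close>

definition \<theta> :: "real \<Rightarrow> real" where "\<theta> x = x + (\<Sum>n. \<psi> ((F ^^ n) x) / real m ^ Suc n)"

lemma summable_\<psi>: "summable (\<lambda>n. \<psi> ((F ^^ n) x) / real m ^ Suc n)"
  by (rule summable_comparison_test'[OF summable_geo \<psi>_term_bound])

lemma \<theta>_F: "\<theta> (F x) = real m * \<theta> x"
proof -
  have "(\<Sum>n. \<psi> ((F ^^ n) x) / real m ^ Suc n) =
      (\<Sum>n. \<psi> ((F ^^ Suc n) x) / real m ^ Suc (Suc n)) + \<psi> x / m"
    using suminf_split_head[OF summable_\<psi>, of x] by simp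
  also have "(\<Sum>n. \<psi> ((F ^^ Suc n) x) / real m ^ Suc (Suc n)) =
      (\<Sum>n. (\<psi> ((F ^^ n) (F x)) / real m ^ Suc n) / m)"
    by (simp add: funpow_swap1 mult.commute del: funpow.simps) (simp add: funpow_swap1 mult.commute)
  also have "\<dots> = (\<Sum>n. \<psi> ((F ^^ n) (F x)) / real m ^ Suc n) / m"
    by (rule suminf_divide[OF summable_\<psi>])
  finally have *: "(\<Sum>n. \<psi> ((F ^^ n) x) / real m ^ Suc n) =
      (\<Sum>n. \<psi> ((F ^^ n) (F x)) / real m ^ Suc n) / m + \<psi> x / m" .
  show ?thesis using m unfolding \<theta>_def * by (simp add: distrib_left \<psi>_def)
qed

lemma \<theta>_funpow: "\<theta> ((F ^^ n) x) = real m ^ n * \<theta> x"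
  by (induction n) (auto simp: \<theta>_F)

lemma \<theta>_near: "\<exists>B. \<forall>x. \<bar>\<theta> x - x\<bar> \<le> B"
proof -
  have "\<bar>\<theta> x - x\<bar> \<le> (\<Sum>n. (1 / real m) ^ n)" for x
  proof -
    have "norm (\<Sum>n. \<psi> ((F ^^ n) x) / real m ^ Suc n) \<le> (\<Sum>n. (1 / real m) ^ n)"
      by (rule norm_suminf_le[OF \<psi>_term_bound summable_geo])
    then show ?thesis by (simp add: \<theta>_def)
  qed
  then show ?thesis by blast
qed

lemma \<theta>_shift: "\<theta> (x + 1) = \<theta> x + 1"
proof -
  have "\<psi> ((F ^^ n) (x + 1)) = \<psi> ((F ^^ n) x)" for n
    using shift_funpow[of n x 1] shift_int[of "(F ^^ n) x" "int m ^ n"]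
    by (simp add: \<psi>_def algebra_simps)
  then show ?thesis by (simp add: \<theta>_def)
qed

lemma cont_\<theta>: "continuous_on UNIV \<theta>"
proof -
  have "uniform_limit UNIV (\<lambda>n x. \<Sum>i<n. \<psi> ((F ^^ i) x) / real m ^ Suc i)
      (\<lambda>x. \<Sum>i. \<psi> ((F ^^ i) x) / real m ^ Suc i) sequentially"
    by (rule Weierstrass_m_test[OF \<psi>_term_bound summable_geo])
  moreover have "continuous_on UNIV (\<lambda>x. \<psi> ((F ^^ i) x) / real m ^ Suc i)" for i
    using cont_funpow[of "Suc i"] cont_funpow[of i] m unfolding \<psi>_def
    by (auto intro!: continuous_intros)
  then have "continuous_on UNIV (\<lambda>x. \<Sum>i<n. \<psi> ((F ^^ i) x) / real m ^ Suc i)" for n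
    by (intro continuous_on_sum) auto
  ultimately have "continuous_on UNIV (\<lambda>x. \<Sum>i. \<psi> ((F ^^ i) x) / real m ^ Suc i)"
    by (intro uniform_limit_theorem[where F=sequentially]) auto
  then show ?thesis unfolding \<theta>_def[abs_def] by (intro continuous_intros)
qed

lemma power_large: obtains n where "n > 0" "real m ^ n > y"
proof -
  obtain n where "y < real m ^ n" using real_arch_pow[of "real m" y] m by auto
  also have "real m ^ n \<le> real m ^ Suc n" using m by (intro power_increasing) auto
  finally show ?thesis using that[of "Suc n"] by blast
qed

text \<open>\<open>F ^^ n\<close> is increasing and \<theta> is within \<open>B\<close> of the
  identity, so a drop of \<theta> from \<open>x\<close> to \<open>y\<close>, multiplied by
  \<open>m ^ n\<close>, would stay below \<open>2 * B\<close> for every \<open>n\<close>.\<close>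

lemma \<theta>_mono: assumes "x \<le> y" shows "\<theta> x \<le> \<theta> y"
proof -
  obtain B where B: "\<And>x. \<bar>\<theta> x - x\<bar> \<le> B" using \<theta>_near by auto
  have *: "\<theta> x - \<theta> y \<le> 2 * B * (1 / real m) ^ n" for n
  proof -
    have "(F ^^ n) x \<le> (F ^^ n) y" using strict_mono_less_eq[OF mono_funpow] assms by blast
    then have "\<theta> ((F ^^ n) x) - \<theta> ((F ^^ n) y) \<le> 2 * B"
      using B[of "(F ^^ n) x"] B[of "(F ^^ n) y"] by linarith
    then have "real m ^ n * (\<theta> x - \<theta> y) \<le> 2 * B" by (simp add: \<theta>_funpow algebra_simps)
    then show ?thesis using m by (simp add: field_simps power_one_over)
  qed
  have "(\<lambda>n. 2 * B * (1 / real m) ^ n) \<longlonglongrightarrow> 2 * B * 0"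
    using m by (intro tendsto_intros LIMSEQ_power_zero) auto
  then have "\<theta> x - \<theta> y \<le> 0" using LIMSEQ_le_const[of "\<lambda>n. 2 * B * (1 / real m) ^ n" 0 "\<theta> x - \<theta> y"] * by auto
  then show ?thesis by simp
qed

text \<open>If \<open>\<theta>\<close> identified \<open>x < y\<close>, then \<open>F ^^ n\<close> would map \<open>[x, y]\<close> into intervals of bounded length
  \<open>N\<close>; but by quasisymmetry \<open>\<Phi> n\<close> shrinks such intervals, being at most \<open>1\<close> on length \<open>m ^ n\<close>.\<close>
lemma \<theta>_strict_mono: "strict_mono \<theta>"
proof (rule strict_monoI, rule ccontr)
  fix x y :: real assume xy: "x < y" and "\<not> \<theta> x < \<theta> y"
  then have eq: "\<theta> x = \<theta> y" using \<theta>_mono[of x y] by simp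
  obtain B where B: "\<And>x. \<bar>\<theta> x - x\<bar> \<le> B" using \<theta>_near by auto
  have "1 < 1 + 1 / M\<^sub>0" using M\<^sub>0(1) by simp
  then obtain k where k: "(1 + 1 / M\<^sub>0) ^ k > 1 / (y - x)" using real_arch_pow by blast
  define N where "N = max 1 (2 * B)"
  obtain n where n: "n > 0" "real m ^ n > 2 ^ k * N" using power_large .
  let ?X = "(F ^^ n) x" and ?Y = "(F ^^ n) y"
  have "\<theta> ?X = \<theta> ?Y" using eq by (simp add: \<theta>_funpow)
  then have "?Y \<le> ?X + N" using B[of ?X] B[of ?Y] unfolding N_def by linarith
  then have "\<Phi> n ?Y \<le> \<Phi> n (?X + N)" using strict_mono_less_eq[OF mono_\<Phi>] by blast
  then have "y - x \<le> \<Phi> n (?X + N) - \<Phi> n ?X" by simp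
  then have "(1 + 1 / M\<^sub>0) ^ k * (y - x) \<le> (1 + 1 / M\<^sub>0) ^ k * (\<Phi> n (?X + N) - \<Phi> n ?X)"
    using M\<^sub>0 by (intro mult_left_mono) auto
  also have "\<dots> \<le> \<Phi> n (?X + 2 ^ k * N) - \<Phi> n ?X"
    by (rule quasisymmetric_growth) (use M\<^sub>0 n N_def in auto)
  also have "\<dots> \<le> \<Phi> n (?X + real m ^ n * of_int 1) - \<Phi> n ?X"
    using n strict_mono_less_eq[OF mono_\<Phi>, of n "?X + 2 ^ k * N" "?X + real m ^ n * of_int 1"] by simp
  also have "\<dots> = 1" by (subst \<Phi>_shift) simp
  finally have "(1 + 1 / M\<^sub>0) ^ k * (y - x) \<le> 1" .
  moreover have "(1 + 1 / M\<^sub>0) ^ k * (y - x) > 1" using k xy by (simp add: field_simps)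
  ultimately show False by linarith
qed

lemma \<theta>_surj: "surj \<theta>"
proof -
  obtain B where B: "\<And>x. \<bar>\<theta> x - x\<bar> \<le> B" using \<theta>_near by auto
  have "\<exists>x. \<theta> x = y" for y
  proof -
    have "\<theta> (y - B) \<le> y" "y \<le> \<theta> (y + B)" "y - B \<le> y + B"
      using B[of "y - B"] B[of "y + B"] by linarith+
    then show ?thesis
      using IVT'[of \<theta> "y - B" y "y + B"] continuous_on_subset[OF cont_\<theta>] by auto
  qed
  then show ?thesis by (metis surjI)
qed

definition h :: "real \<Rightarrow> real" where "h = inv \<theta>"

lemma \<theta>_h [simp]: "\<theta> (h x) = x" and h_\<theta> [simp]: "h (\<theta> x) = x"
  using \<theta>_surj strict_mono_imp_inj_on[OF \<theta>_strict_mono] unfolding h_def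
  by (auto simp: surj_f_inv_f inv_f_f)

lemma h_strict_mono: "strict_mono h"
  by (rule strict_monoI) (metis \<theta>_h \<theta>_strict_mono not_less_iff_gr_or_eq strict_mono_less)

lemma h_shift: "h (x + 1) = h x + 1"
  by (metis \<theta>_h \<theta>_shift h_\<theta>)

lemma h_shift_int: "h (x + of_int j) = h x + of_int j"
proof -
  have n: "h (y + real k) = h y + real k" for y k
  proof (induction k)
    case (Suc k)
    then show ?case using h_shift[of "y + real k"] by (simp add: algebra_simps)
  qed simp
  from n[of x "nat j"] n[of "x + of_int j" "nat (- j)"] show ?thesis by (cases "j \<ge> 0") auto
qed

lemma h_cont: "continuous_on UNIV h"
proof -
  obtain g where "homeomorphism UNIV (\<theta> ` UNIV) \<theta> g"
    using invariance_of_domain_homeomorphism[of UNIV \<theta>] cont_\<theta>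
      strict_mono_imp_inj_on[OF \<theta>_strict_mono] by auto
  then have g: "homeomorphism UNIV UNIV \<theta> g" using \<theta>_surj by simp
  then have "g = h" by (intro ext) (metis UNIV_I \<theta>_h homeomorphism_apply1)
  with g show ?thesis by (simp add: homeomorphism_def)
qed

lemma h_0: "h 0 = 0"
proof -
  have "\<theta> 0 = m * \<theta> 0" using \<theta>_F[of 0] F0 by simp
  then have "\<theta> 0 = 0" using m by simp
  then show ?thesis by (metis h_\<theta>)
qed

lemma h_mult: "h (real m * x) = F (h x)"
  by (metis \<theta>_F \<theta>_h h_\<theta>)

lemma h_power: "h (real m ^ n * x) = (F ^^ n) (h x)"
  by (metis \<theta>_funpow \<theta>_h h_\<theta>)

lemma h_div: "h (x / real m ^ n) = \<Phi> n (h x)"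
  using h_power[of n "x / real m ^ n"] m by simp

section \<open>Consequences of UAA at small scales\<close>

lemma eps_small: assumes "e > 0" obtains y1 where "y1 > 0" "\<And>y. 0 < y \<Longrightarrow> y \<le> y1 \<Longrightarrow> \<epsilon> y \<le> e"
proof -
  have "filterlim \<epsilon> (at_right 0) (at_right 0)" using vanish by (simp add: vanishing_def)
  then have "(\<epsilon> \<longlongrightarrow> 0) (at_right 0)" by (simp add: filterlim_at)
  then have "\<forall>\<^sub>F y in at_right 0. \<epsilon> y < e" using assms by (rule order_tendstoD)
  then obtain b where "b > 0" "\<And>y. y > 0 \<Longrightarrow> y < b \<Longrightarrow> \<epsilon> y < e"
    by (auto simp: eventually_at_right_field)
  then show ?thesis using that[of "b / 2"] by force
qed

text \<open>First \<open>N\<close> makes \<open>1 / real N\<close> small, and only then is the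
  tolerance \<open>e\<close> chosen so that \<open>(1 + e) ^ N\<close> is close to 1. The resulting
  length \<open>y0\<close> is uniform in \<open>n\<close> because \<epsilon> is.\<close>

lemma near_affine:
  assumes \<delta>: "\<delta> > 0"
  obtains y0 where "y0 > 0" "\<And>n a b t. n > 0 \<Longrightarrow> a < b \<Longrightarrow> b - a \<le> y0 \<Longrightarrow> t \<in> {a..b} \<Longrightarrow>
    \<bar>\<Phi> n t - \<Phi> n a - (\<Phi> n b - \<Phi> n a) / (b - a) * (t - a)\<bar> \<le> \<delta> * (\<Phi> n b - \<Phi> n a)"
proof -
  obtain N :: nat where N: "N > 0" "1 / real N < \<delta> / 2"
    using \<delta> by (metis half_gt_zero nat_approx_posE zero_less_Suc)
  have "((\<lambda>e. (1 + e) ^ N - 1) \<longlongrightarrow> (1 + 0) ^ N - 1) (at_right (0::real))" by (intro tendsto_intros)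
  then have "\<forall>\<^sub>F e in at_right (0::real). (1 + e) ^ N - 1 < \<delta> / 2"
    using \<delta> by (intro order_tendstoD(2)) auto
  then obtain b :: real where "b > 0" "\<And>e. e > 0 \<Longrightarrow> e < b \<Longrightarrow> (1 + e) ^ N - 1 < \<delta> / 2"
    unfolding eventually_at_right_field by blast
  then obtain e where e: "e > 0" "(1 + e) ^ N - 1 < \<delta> / 2" using field_lbound_gt_zero by blast
  obtain y1 where y1: "y1 > 0" "\<And>y. 0 < y \<Longrightarrow> y \<le> y1 \<Longrightarrow> \<epsilon> y \<le> e" using eps_small[OF e(1)] by blast
  show ?thesis
  proof (rule that[OF y1(1)])
    fix n a b t assume *: "(n::nat) > 0" "a < b" "b - a \<le> y1" "t \<in> {a..b}"
    define y where "y = (b - a) / real N"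
    have y: "y > 0" "y \<le> y1"
    proof -
      show "y > 0" using * N by (simp add: y_def)
      have "y \<le> (b - a) / 1" unfolding y_def using * N by (intro divide_left_mono) auto
      then show "y \<le> y1" using * by simp
    qed
    have "\<bar>\<Phi> n t - \<Phi> n a - (\<Phi> n b - \<Phi> n a) / (b - a) * (t - a)\<bar> \<le> (1 / real N + ((1 + e) ^ N - 1)) * (\<Phi> n b - \<Phi> n a)"
    proof (rule almost_affine_of_equal_steps[OF strict_mono_mono[OF mono_\<Phi>] N(1) *(2) _ y_def _ *(4)])
      fix x
      show "\<Phi> n (x + y) - \<Phi> n x \<le> (1 + e) * (\<Phi> n x - \<Phi> n (x - y)) \<and>
          \<Phi> n x - \<Phi> n (x - y) \<le> (1 + e) * (\<Phi> n (x + y) - \<Phi> n x)"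
        using uaa_le[OF *(1) y(1) y1(2)[OF y], of x] by blast
    qed (use e in simp)
    also have "\<dots> \<le> \<delta> * (\<Phi> n b - \<Phi> n a)"
      using N e * strict_mono_less_eq[OF mono_\<Phi>, of n a b] by (intro mult_right_mono) auto
    finally show "\<bar>\<Phi> n t - \<Phi> n a - (\<Phi> n b - \<Phi> n a) / (b - a) * (t - a)\<bar> \<le> \<delta> * (\<Phi> n b - \<Phi> n a)" .
  qed
qed

text \<open>In \<open>h_quasisymmetric\<close> the two rescaled sides agree up to a factor 4: two
  doublings cost \<open>(1 + M\<^sub>0) ^ 2\<close>, and the comparison of the two sides of a point
  under \<open>\<Phi> n\<close> costs \<open>M\<^sub>0\<close>.\<close>

definition M\<^sub>h :: real where "M\<^sub>h = M\<^sub>0 * (1 + M\<^sub>0) ^ 2"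

text \<open>Integer translations commute with \<open>h\<close>, so the increment lies between k and
  k + 1, where k is the integer part of \<open>Y\<close>. As \<open>Y \<ge> 1\<close> gives k \<ge>
  1, both are comparable to \<open>Y\<close>.\<close>

lemma h_increment_bounds:
  assumes "Y \<ge> 1"
  shows "Y / 2 \<le> h (X + Y) - h X" "h (X + Y) - h X \<le> 2 * Y"
proof -
  have int: "h (X + real k) = h X + real k" for k using h_shift_int[of X "int k"] by simp
  define k where "k = nat \<lfloor>Y\<rfloor>"
  have k: "real k \<le> Y" "Y \<le> real (Suc k)" "1 \<le> real k"
  proof -
    have "\<lfloor>Y\<rfloor> \<ge> 1" using assms by simp
    then show "real k \<le> Y" "Y \<le> real (Suc k)" "1 \<le> real k" unfolding k_def by linarith+
  qed
  have "h (X + real k) \<le> h (X + Y)" "h (X + Y) \<le> h (X + real (Suc k))"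
    using k strict_mono_less_eq[OF h_strict_mono] by auto
  then show "Y / 2 \<le> h (X + Y) - h X" "h (X + Y) - h X \<le> 2 * Y" using k unfolding int by linarith+
qed

text \<open>Rescaling by a power of \<open>m\<close> turns an interval into one of length at least \<open>1\<close>, where \<open>h\<close> is
  close to the identity, and \<open>h\<close> itself is recovered by applying \<open>\<Phi> n\<close>.\<close>
lemma h_quasisymmetric: "quasisymmetric M\<^sub>h h"
  unfolding quasisymmetric_def
proof (intro conjI allI impI)
  have "1 * 1 \<le> M\<^sub>0 * (1 + M\<^sub>0) ^ 2" using M\<^sub>0(1) by (intro mult_mono) auto
  then show "1 \<le> M\<^sub>h" by (simp add: M\<^sub>h_def)
  fix x y :: real assume y: "y > 0"
  obtain n where "n > 0" "real m ^ n > 1 / y" using power_large .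
  then have n: "n > 0" "real m ^ n * y \<ge> 1" using y by (auto simp: field_simps)
  define Y where "Y = real m ^ n * y"
  define X where "X = h (real m ^ n * x)"
  define a b where "a = h (real m ^ n * x + Y) - X" and "b = X - h (real m ^ n * x - Y)"
  have Yb: "Y / 2 \<le> a" "a \<le> 2 * Y" "Y / 2 \<le> b" "b \<le> 2 * Y"
    using h_increment_bounds[of Y "real m ^ n * x"] h_increment_bounds[of Y "real m ^ n * x - Y"] n
    by (auto simp: a_def b_def X_def Y_def)
  have Y0: "Y \<ge> 1" using n Y_def by simp
  have hx: "h x = \<Phi> n X" "h (x + y) = \<Phi> n (X + a)" "h (x - y) = \<Phi> n (X - b)"
    using h_div[of "real m ^ n * x" n] h_div[of "real m ^ n * x + Y" n] h_div[of "real m ^ n * x - Y" n] m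
    by (auto simp: X_def Y_def a_def b_def add_divide_distrib diff_divide_distrib)
  note Q = M\<^sub>0(2)[OF n(1)]
  have le: "\<Phi> n s \<le> \<Phi> n t" if "s \<le> t" for s t using strict_mono_less_eq[OF mono_\<Phi>] that by blast
  have M2: "(1 + M\<^sub>0) \<ge> 0" "M\<^sub>0 \<ge> 0" using M\<^sub>0(1) by auto
  have "\<Phi> n (X + a) - \<Phi> n X \<le> \<Phi> n (X + 4 * b) - \<Phi> n X" using le Yb by simp
  also have "\<dots> = \<Phi> n (X + 2 * (2 * b)) - \<Phi> n X" by simp
  also have "\<dots> \<le> (1 + M\<^sub>0) * (\<Phi> n (X + 2 * b) - \<Phi> n X)"
    using quasisymmetric_double_le(1)[OF Q, of "2 * b" X] Yb Y0 by simp
  also have "\<dots> \<le> (1 + M\<^sub>0) * ((1 + M\<^sub>0) * (\<Phi> n (X + b) - \<Phi> n X))"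
    using quasisymmetric_double_le(1)[OF Q, of b X] Yb Y0 M2 by (intro mult_left_mono) auto
  also have "\<dots> \<le> (1 + M\<^sub>0) * ((1 + M\<^sub>0) * (M\<^sub>0 * (\<Phi> n X - \<Phi> n (X - b))))"
    using Q Yb Y0 M2 unfolding quasisymmetric_def by (intro mult_left_mono) auto
  finally show "h (x + y) - h x \<le> M\<^sub>h * (h x - h (x - y))"
    by (simp add: hx M\<^sub>h_def power2_eq_square mult_ac)
  have "\<Phi> n X - \<Phi> n (X - b) \<le> \<Phi> n X - \<Phi> n (X - 4 * a)" using le[of "X - 4 * a" "X - b"] Yb by simp
  also have "\<dots> \<le> (1 + M\<^sub>0) * (\<Phi> n X - \<Phi> n (X - 2 * a))"
    using quasisymmetric_double_le(2)[OF Q, of "2 * a" "X - 4 * a"] Yb Y0 by simp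
  also have "\<dots> \<le> (1 + M\<^sub>0) * ((1 + M\<^sub>0) * (\<Phi> n X - \<Phi> n (X - a)))"
    using quasisymmetric_double_le(2)[OF Q, of a "X - 2 * a"] Yb Y0 M2 by (intro mult_left_mono) auto
  also have "\<dots> \<le> (1 + M\<^sub>0) * ((1 + M\<^sub>0) * (M\<^sub>0 * (\<Phi> n (X + a) - \<Phi> n X)))"
    using Q Yb Y0 M2 unfolding quasisymmetric_def by (intro mult_left_mono) auto
  finally show "h x - h (x - y) \<le> M\<^sub>h * (h (x + y) - h x)"
    by (simp add: hx M\<^sub>h_def power2_eq_square mult_ac)
qed

text \<open>With \<open>\<epsilon> \<le> 2\<close> at small scales, halving an interval divides its image under \<open>\<Phi> 1\<close> by at most \<open>4\<close>.\<close>
lemma \<Phi>1_lower: obtains c y0 where "c > 0" "y0 > 0" "\<And>x y. 0 < y \<Longrightarrow> y \<le> y0 \<Longrightarrow> c * y\<^sup>2 \<le> \<Phi> 1 (x + y) - \<Phi> 1 x"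
proof -
  obtain y1 where y1: "y1 > 0" "\<And>y. 0 < y \<Longrightarrow> y \<le> y1 \<Longrightarrow> \<epsilon> y \<le> 2" using eps_small[of 2] by auto
  define z where "z = y1 / 2"
  have z: "z > 0" using y1 z_def by simp
  obtain k where k: "real m < 2 ^ k * z"
  proof -
    obtain k where "m / z < 2 ^ k" using real_arch_pow[of 2 "m/z"] by auto
    then show ?thesis using that[of k] z by (simp add: field_simps)
  qed
  define c0 where "c0 = 1 / (1 + M\<^sub>0) ^ k"
  have c0: "c0 > 0" using M\<^sub>0(1) by (simp add: c0_def)
  have le: "\<Phi> 1 s \<le> \<Phi> 1 t" if "s \<le> t" for s t using strict_mono_less_eq[OF mono_\<Phi>] that by blast
  have up: "\<Phi> 1 (x + 2 ^ i * z) - \<Phi> 1 x \<le> (1 + M\<^sub>0) ^ i * (\<Phi> 1 (x + z) - \<Phi> 1 x)" for i x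
  proof (induction i)
    case (Suc i)
    have "\<Phi> 1 (x + 2 * (2 ^ i * z)) - \<Phi> 1 x \<le> (1 + M\<^sub>0) * (\<Phi> 1 (x + 2 ^ i * z) - \<Phi> 1 x)"
      using quasisymmetric_double_le(1)[OF M\<^sub>0(2), of 1 "2 ^ i * z" x] z by simp
    also have "\<dots> \<le> (1 + M\<^sub>0) * ((1 + M\<^sub>0) ^ i * (\<Phi> 1 (x + z) - \<Phi> 1 x))"
      using Suc M\<^sub>0(1) by (intro mult_left_mono) auto
    finally show ?case by (simp add: mult_ac)
  qed simp
  \<comment> \<open>An interval of length \<open>m\<close> has image of length exactly 1, and
    \<open>2 ^ k * z\<close> exceeds \<open>m\<close>; undoing the \<open>k\<close> doublings leaves
    a uniform lower bound at length \<open>z\<close>.\<close>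
  have base: "c0 \<le> \<Phi> 1 (x + z) - \<Phi> 1 x" for x
  proof -
    have "1 = \<Phi> 1 (x + real m ^ 1 * of_int 1) - \<Phi> 1 x" by (subst \<Phi>_shift) simp
    also have "\<dots> \<le> \<Phi> 1 (x + 2 ^ k * z) - \<Phi> 1 x" using le[of "x + real m" "x + 2 ^ k * z"] k by simp
    also note up
    finally show ?thesis using M\<^sub>0(1) by (simp add: c0_def field_simps)
  qed
  show ?thesis
  proof (rule that[of "c0 / y1\<^sup>2" y1])
    fix x y :: real assume y: "0 < y" "y \<le> y1"
    have dbl: "\<Phi> 1 (x + 2 * u) - \<Phi> 1 x \<le> 4 * (\<Phi> 1 (x + u) - \<Phi> 1 x)" if "0 < u" "u \<le> y1" for u
    proof -
      have "\<Phi> 1 (x + u + u) - \<Phi> 1 (x + u) \<le> (1 + 2) * (\<Phi> 1 (x + u) - \<Phi> 1 (x + u - u))"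
        by (rule uaa_le) (use that y1(2) in auto)
      then show ?thesis by (simp add: algebra_simps)
    qed
    obtain n where "y1 / y < 2 ^ n" using real_arch_pow[of 2 "y1 / y"] by auto
    then have "y1 < 2 ^ n * y" using y by (simp add: field_simps)
    \<comment> \<open>\<open>i\<close> is the last doubling that stays within \<open>y1\<close>.
      Then \<open>2 ^ i * y\<close> exceeds \<open>y1 / 2\<close>, which is \<open>z\<close>, so
      \<open>base\<close> applies; the loss \<open>4 ^ i\<close> is at most
      \<open>(y1 / y)\<^sup>2\<close>, whence the exponent 2.\<close>
    then obtain i where i: "\<And>j. j \<le> i \<Longrightarrow> 2 ^ j * y \<le> y1" "y1 < 2 ^ Suc i * y"
      using ex_least_nat_less[of "\<lambda>j. y1 < 2 ^ j * y" n] y by (auto simp: not_less)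
    have "\<Phi> 1 (x + 2 ^ j * y) - \<Phi> 1 x \<le> 4 ^ j * (\<Phi> 1 (x + y) - \<Phi> 1 x)" if "j \<le> i" for j
      using that
    proof (induction j)
      case (Suc j)
      have "\<Phi> 1 (x + 2 ^ Suc j * y) - \<Phi> 1 x \<le> 4 * (\<Phi> 1 (x + 2 ^ j * y) - \<Phi> 1 x)"
        using dbl[of "2 ^ j * y"] i(1)[of j] Suc.prems y by (simp add: mult_ac)
      then show ?case using Suc by simp
    qed simp
    then have "\<Phi> 1 (x + 2 ^ i * y) - \<Phi> 1 x \<le> 4 ^ i * (\<Phi> 1 (x + y) - \<Phi> 1 x)" by simp
    moreover have "c0 \<le> \<Phi> 1 (x + 2 ^ i * y) - \<Phi> 1 x"
      using base[of x] le[of "x + z" "x + 2 ^ i * y"] i(2) unfolding z_def by simp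
    ultimately have A: "c0 \<le> 4 ^ i * (\<Phi> 1 (x + y) - \<Phi> 1 x)" by simp
    have "(2 ^ i * y)\<^sup>2 \<le> y1\<^sup>2" using i(1)[of i] y by (intro power_mono) auto
    moreover have "(2 ^ i * y)\<^sup>2 = 4 ^ i * y\<^sup>2"
    proof -
      have "((2::real) ^ i)\<^sup>2 = (2\<^sup>2) ^ i" unfolding power_mult[symmetric] by (simp add: mult.commute)
      then show ?thesis by (simp add: power_mult_distrib)
    qed
    ultimately have "4 ^ i * (c0 * y\<^sup>2) \<le> c0 * y1\<^sup>2" using c0 by (simp add: mult.left_commute)
    also have "\<dots> \<le> 4 ^ i * (\<Phi> 1 (x + y) - \<Phi> 1 x) * y1\<^sup>2" using A by (intro mult_right_mono) auto
    finally have "c0 * y\<^sup>2 \<le> (\<Phi> 1 (x + y) - \<Phi> 1 x) * y1\<^sup>2" by (simp add: mult.assoc)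
    then show "c0 / y1\<^sup>2 * y\<^sup>2 \<le> \<Phi> 1 (x + y) - \<Phi> 1 x" using y1 by (simp add: field_simps)
  qed (use c0 y1 in auto)
qed

text \<open>If the increment \<open>s\<close> of \<open>F\<close> is at most \<open>y0\<close>,
  inverting \<open>c * s\<^sup>2 \<le> t\<close> gives the square root. If not, \<open>t\<close> is
  at least \<open>c * y0\<^sup>2\<close>, and the crude estimate \<open>m * (t + 1)\<close> coming
  from the shift relation is at most a multiple of \<open>t\<close>.\<close>

lemma F_holder: obtains C where "C > 0" "\<And>x t. 0 < t \<Longrightarrow> F (x + t) - F x \<le> C * (sqrt t + t)"
proof -
  obtain c y0 where c: "c > 0" "y0 > 0" and lo: "\<And>x y. 0 < y \<Longrightarrow> y \<le> y0 \<Longrightarrow> c * y\<^sup>2 \<le> \<Phi> 1 (x + y) - \<Phi> 1 x"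
    using \<Phi>1_lower by blast
  define C where "C = 1 / sqrt c + m * (1 + 1 / (c * y0\<^sup>2))"
  have Fi: "\<Phi> 1 (F x) = x" for x using \<Phi>_funpow[of 1 x] by simp
  show ?thesis
  proof (rule that[of C])
    show "C > 0" using c m by (auto simp: C_def intro!: add_pos_pos mult_pos_pos)
    fix x t :: real assume t: "0 < t"
    define s where "s = F (x + t) - F x"
    have s: "s > 0" using t mono by (auto simp: s_def strict_mono_def)
    have ts: "t = \<Phi> 1 (F x + s) - \<Phi> 1 (F x)"
      using Fi[of x] Fi[of "x + t"] unfolding s_def by (metis add.commute add_diff_cancel_left' diff_add_cancel)
    have nn: "sqrt t / sqrt c \<ge> 0" "m * (1 + 1 / (c * y0\<^sup>2)) * t \<ge> 0" "t / sqrt c \<ge> 0"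
      "m * (1 + 1 / (c * y0\<^sup>2)) * sqrt t \<ge> 0"
      using c t by auto
    have ex: "C * (sqrt t + t) = sqrt t / sqrt c + m * (1 + 1 / (c * y0\<^sup>2)) * t + t / sqrt c
       + m * (1 + 1 / (c * y0\<^sup>2)) * sqrt t" unfolding C_def by (simp add: algebra_simps add_divide_distrib)
    show "F (x + t) - F x \<le> C * (sqrt t + t)"
    proof (cases "s \<le> y0")
      case True
      have "c * s\<^sup>2 \<le> t" using lo[OF s True] ts by metis
      then have "sqrt (c * s\<^sup>2) \<le> sqrt t" by simp
      then have "s \<le> sqrt t / sqrt c" using c s by (simp add: real_sqrt_mult field_simps)
      then show ?thesis using nn unfolding ex s_def by linarith
    next
      case False
      have "c * y0\<^sup>2 \<le> \<Phi> 1 (F x + y0) - \<Phi> 1 (F x)" using lo[of y0] c by auto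
      also have "\<dots> \<le> \<Phi> 1 (F x + s) - \<Phi> 1 (F x)"
        using False strict_mono_less_eq[OF mono_\<Phi>, of 1 "F x + y0" "F x + s"] by auto
      finally have "c * y0\<^sup>2 \<le> t" using ts by metis
      then have 1: "1 \<le> t / (c * y0\<^sup>2)" using c by simp
      have "F (x + t) \<le> F (x + of_int \<lceil>t\<rceil>)" using strict_mono_less_eq[OF mono] by simp
      then have "s \<le> real m * of_int \<lceil>t\<rceil>" unfolding s_def by (simp add: shift_int)
      also have "\<dots> \<le> real m * (t + 1)" using m by (intro mult_left_mono) linarith+
      also have "\<dots> \<le> m * (t + t / (c * y0\<^sup>2))" using 1 m by (intro mult_left_mono) linarith+
      also have "\<dots> = m * (1 + 1 / (c * y0\<^sup>2)) * t" by (simp add: algebra_simps)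
      finally show ?thesis using nn unfolding ex s_def by linarith
    qed
  qed
qed

end

section \<open>The Beurling-Ahlfors extension\<close>

text \<open>The mean of \<open>k\<close> between \<open>x\<close> and \<open>x + y\<close>,
  normalized to the unit interval so that \<open>y = 0\<close> and \<open>y < 0\<close> need no
  separate treatment.\<close>

definition avg :: "(real \<Rightarrow> real) \<Rightarrow> real \<Rightarrow> real \<Rightarrow> real" where
  "avg k x y = integral {0..1} (\<lambda>t. k (x + t * y))"

text \<open>The Beurling-Ahlfors extension. The averages are taken over \<open>[x, x + y]\<close> and \<open>[x - y, x]\<close>,
  so the same formula, for \<open>y < 0\<close>, gives the reflected map on the lower half-plane.\<close>
definition ba :: "(real \<Rightarrow> real) \<Rightarrow> complex \<Rightarrow> complex" where
  "ba k z = Complex ((avg k (Re z) (Im z) + avg k (Re z) (- Im z)) / 2)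
                    ((avg k (Re z) (Im z) - avg k (Re z) (- Im z)) / 2)"

lemma avg_integrable:
  fixes k :: "real \<Rightarrow> real"
  assumes "continuous_on UNIV k"
  shows "(\<lambda>t. k (x + t * y)) integrable_on {a..b::real}"
  by (intro integrable_continuous_real continuous_on_compose2[OF assms] continuous_intros) auto

lemma continuous_avg:
  assumes "continuous_on UNIV k"
  shows "continuous_on UNIV (\<lambda>p. avg k (fst p) (snd p))"
proof -
  have "continuous_on (UNIV \<times> cbox 0 1) (\<lambda>(p, t). k (fst p + t * snd p))"
    unfolding case_prod_unfold
    by (intro continuous_on_compose2[OF assms] continuous_intros) auto
  then have "continuous_on UNIV (\<lambda>p. integral (cbox 0 1) (\<lambda>t. k (fst p + t * snd p)))"
    by (rule integral_continuous_on_param)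
  then show ?thesis by (simp add: avg_def)
qed

lemma avg_0 [simp]: "avg k x 0 = k x" by (simp add: avg_def)

text \<open>Each sample point is a convex combination of the end points \<open>x\<close> and
  \<open>x + y\<close>, so moving one of them to the right and the other not to the left moves every
  interior sample point to the right.\<close>

lemma avg_less:
  assumes k: "continuous_on UNIV k" "strict_mono k"
    and "x \<le> x'" "x + y \<le> x' + y'" "x < x' \<or> x + y < x' + y'"
  shows "avg k x y < avg k x' y'"
proof -
  have lt: "x + t * y < x' + t * y'" if "0 < t" "t < 1" for t
  proof -
    have 1: "x + t * y = (1 - t) * x + t * (x + y)" "x' + t * y' = (1 - t) * x' + t * (x' + y')"
      by (auto simp: algebra_simps)
    have "(1 - t) * x \<le> (1 - t) * x'" "t * (x + y) \<le> t * (x' + y')"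
      using that assms by (auto intro!: mult_left_mono)
    moreover have "(1 - t) * x < (1 - t) * x' \<or> t * (x + y) < t * (x' + y')"
      using that assms by (auto)
    ultimately show ?thesis unfolding 1 by linarith
  qed
  have le: "x + t * y \<le> x' + t * y'" if "t \<in> {0..1}" for t
  proof (cases "t = 0 \<or> t = 1")
    case True then show ?thesis using assms by auto
  next
    case False then show ?thesis using lt[of t] that by auto
  qed
  let ?d = "\<lambda>t. k (x' + t * y') - k (x + t * y)"
  have c: "continuous_on (cbox 0 1) ?d"
    by (intro continuous_intros continuous_on_compose2[OF k(1)]) auto
  have nn: "?d t \<ge> 0" if "t \<in> {0..1}" for t
    using le[OF that] strict_mono_less_eq[OF k(2)] by simp
  have e: "avg k x' y' - avg k x y = integral {0..1} ?d"
    unfolding avg_def by (intro integral_diff[symmetric] avg_integrable k)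
  have "integral {0..1} ?d \<noteq> 0"
  proof
    assume "integral {0..1} ?d = 0"
    then have "(?d has_integral 0) (cbox 0 1)"
      using integrable_integral[OF integrable_continuous[OF c]] by simp
    then have "?d (1/2) = 0"
      using has_integral_0_cbox_imp_0[OF c _ _ , of "1/2"] nn by auto
    moreover have "k (x + 1/2 * y) < k (x' + 1/2 * y')" using lt[of "1/2"] by (intro strict_monoD[OF k(2)]) simp
    ultimately show False by simp
  qed
  moreover have "integral {0..1} ?d \<ge> 0"
    by (intro integral_nonneg integrable_continuous_real nn) (use c in auto)
  ultimately show ?thesis using e by linarith
qed

text \<open>Equal values force equal means over both intervals \<open>[x, x + y]\<close> and
  \<open>[x - y, x]\<close>. For two distinct points ordered by \<open>Im\<close>, the order of the
  real parts decides which of the two intervals has moved in the sense of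
  \<open>avg_less\<close>.\<close>

lemma ba_inj:
  assumes "continuous_on UNIV k" "strict_mono k"
  shows "inj (ba k)"
proof (rule injI, rule ccontr)
  have *: False if "ba k z = ba k w" "z \<noteq> w" and le: "Im z \<le> Im w" for z w
  proof -
    have e: "avg k (Re z) (Im z) = avg k (Re w) (Im w)" "avg k (Re z) (- Im z) = avg k (Re w) (- Im w)"
      using that(1) unfolding ba_def complex.inject by (auto simp: field_simps)
    show False
    proof (cases "Re z \<le> Re w")
      case True
      then have "avg k (Re z) (Im z) < avg k (Re w) (Im w)"
        using le that(2) by (intro avg_less assms) (auto simp: complex_eq_iff)
      with e show False by simp
    next
      case False
      then have "avg k (Re w) (- Im w) < avg k (Re z) (- Im z)"
        using le by (intro avg_less assms) auto
      with e show False by simp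
    qed
  qed
  fix z w assume "ba k z = ba k w" "z \<noteq> w"
  then show False using *[of z w] *[of w z] by (metis linear)
qed

lemma continuous_ba:
  assumes "continuous_on UNIV k"
  shows "continuous_on UNIV (ba k)"
proof -
  have "continuous_on UNIV (\<lambda>z. avg k (fst (Re z, Im z)) (snd (Re z, Im z)))"
    "continuous_on UNIV (\<lambda>z. avg k (fst (Re z, - Im z)) (snd (Re z, - Im z)))"
    by (rule continuous_on_compose2[OF continuous_avg[OF assms]], intro continuous_intros, simp)+
  then show ?thesis unfolding ba_def[abs_def]
    by (auto simp: Complex_eq intro!: continuous_intros)
qed

lemma ba_cnj: "ba k (cnj z) = cnj (ba k z)"
  by (simp add: ba_def complex_eq_iff minus_divide_left)

lemma ba_of_real [simp]: "ba k (of_real x) = of_real (k x)"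
  by (simp add: ba_def complex_eq_iff)

lemma Im_ba_pos:
  assumes "continuous_on UNIV k" "strict_mono k" "Im z > 0"
  shows "Im (ba k z) > 0"
  using avg_less[OF assms(1,2), of "Re z" "Re z" "- Im z" "Im z"] assms(3) by (simp add: ba_def)

lemma Im_ba_pos_iff:
  assumes "continuous_on UNIV k" "strict_mono k"
  shows "Im (ba k z) > 0 \<longleftrightarrow> Im z > 0" "Im (ba k z) < 0 \<longleftrightarrow> Im z < 0" "Im (ba k z) = 0 \<longleftrightarrow> Im z = 0"
proof -
  have n: "Im (ba k z) < 0" if "Im z < 0" for z
    using Im_ba_pos[OF assms, of "cnj z"] that by (simp add: ba_cnj)
  have 0: "Im (ba k z) = 0" if "Im z = 0" for z using that by (simp add: ba_def)
  show "Im (ba k z) > 0 \<longleftrightarrow> Im z > 0" "Im (ba k z) < 0 \<longleftrightarrow> Im z < 0" "Im (ba k z) = 0 \<longleftrightarrow> Im z = 0"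
    using Im_ba_pos[OF assms, of z] n[of z] 0[of z] by linarith+
qed

lemma ba_scale:
  assumes "c \<noteq> 0"
  shows "ba k (of_real c * z) = ba (\<lambda>t. k (c * t)) z"
  using assms by (simp add: ba_def avg_def algebra_simps)

section \<open>Derivatives of the Beurling-Ahlfors extension\<close>

lemma avg_has_derivative:
  assumes k: "continuous_on UNIV k" and y: "Im z \<noteq> 0"
  shows "((\<lambda>z. avg k (Re z) (Im z)) has_derivative
    (\<lambda>v. (k (Re z + Im z) - k (Re z)) / Im z * Re v + (k (Re z + Im z) - avg k (Re z) (Im z)) / Im z * Im v)) (at z)"
proof -
  \<comment> \<open>Off the real line \<open>avg\<close> is a difference quotient of the primitive
    \<open>P\<close>, so continuity of \<open>k\<close> suffices for differentiability.
    \<open>R\<close> is large enough for \<open>Re z\<close> and \<open>Re z + Im z\<close> to lie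
    inside \<open>{- R..R}\<close>, and this persists on the neighbourhood \<open>W\<close>.\<close>
  define R where "R = \<bar>Re z\<bar> + \<bar>Im z\<bar> + 1"
  define P where "P u = integral {- R..u} k" for u
  have P: "(P has_real_derivative k u) (at u)" if "- R < u" "u < R" for u
  proof -
    have "(P has_vector_derivative k u) (at u within {- R..R})"
      unfolding P_def by (rule integral_has_vector_derivative) (use that k continuous_on_subset in auto)
    then show ?thesis using that at_within_interior[of u "{- R..R}"]
      by (simp add: has_real_derivative_iff_has_vector_derivative)
  qed
  define W where "W = {w. - R < Re w \<and> Re w < R \<and> - R < Re w + Im w \<and> Re w + Im w < R \<and> Im w \<noteq> 0}"
  have W: "open W" unfolding W_def
    by (intro open_Collect_conj open_Collect_less open_Collect_neq continuous_intros)
  have zW: "z \<in> W" using y unfolding W_def R_def by auto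
  have eq: "avg k (Re w) (Im w) = (P (Re w + Im w) - P (Re w)) / Im w" if "w \<in> W" for w
  proof -
    have "((\<lambda>t. k (Re w + t * Im w) * Im w) has_integral P (Re w + 1 * Im w) - P (Re w + 0 * Im w)) {0..1}"
    proof (rule fundamental_theorem_of_calculus)
      fix t :: real assume t: "t \<in> {0..1}"
      have e: "Re w + t * Im w = (1 - t) * Re w + t * (Re w + Im w)" by (simp add: algebra_simps)
      have "- R < Re w + t * Im w" "Re w + t * Im w < R"
      proof -
        show "Re w + t * Im w < R" unfolding e
          by (rule convex_bound_lt) (use t that W_def in auto)
        have "(1 - t) * (- Re w) + t * (- (Re w + Im w)) < R"
          by (rule convex_bound_lt) (use t that W_def in auto)
        then show "- R < Re w + t * Im w" unfolding e by (simp add: algebra_simps)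
      qed
      then have "((\<lambda>t. P (Re w + t * Im w)) has_real_derivative k (Re w + t * Im w) * Im w) (at t within {0..1})"
        by (intro DERIV_chain'[where f="\<lambda>t. Re w + t * Im w", unfolded o_def] has_field_derivative_at_within[OF P]) (auto intro!: derivative_eq_intros)
      then show "((\<lambda>t. P (Re w + t * Im w)) has_vector_derivative k (Re w + t * Im w) * Im w) (at t within {0..1})"
        by (simp add: has_real_derivative_iff_has_vector_derivative)
    qed simp
    then have "integral {0..1} (\<lambda>t. k (Re w + t * Im w) * Im w) = P (Re w + Im w) - P (Re w)"
      by (subst integral_unique) auto
    then show ?thesis using that unfolding avg_def W_def by (simp add: field_simps)
  qed
  have "((\<lambda>w. (P (Re w + Im w) - P (Re w)) / Im w) has_derivative
    (\<lambda>v. (k (Re z + Im z) - k (Re z)) / Im z * Re v + (k (Re z + Im z) - avg k (Re z) (Im z)) / Im z * Im v)) (at z)"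
  proof -
    have d1: "((\<lambda>w. P (Re w + Im w)) has_derivative (\<lambda>v. (Re v + Im v) * k (Re z + Im z))) (at z)"
      by (rule has_derivative_compose[OF _ P[unfolded has_field_derivative_def], THEN has_derivative_eq_rhs])
        (use zW in \<open>auto simp: W_def fun_eq_iff intro!: derivative_eq_intros\<close>)
    have d2: "((\<lambda>w. P (Re w)) has_derivative (\<lambda>v. Re v * k (Re z))) (at z)"
      by (rule has_derivative_compose[OF _ P[unfolded has_field_derivative_def], THEN has_derivative_eq_rhs])
        (use zW in \<open>auto simp: W_def fun_eq_iff intro!: derivative_eq_intros\<close>)
    show ?thesis
      by (rule has_derivative_eq_rhs, rule has_derivative_divide'[OF has_derivative_diff[OF d1 d2]], rule derivative_intros, rule derivative_intros)
        (use y in \<open>auto simp: fun_eq_iff eq[OF zW] field_simps\<close>)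
  qed
  then show ?thesis
    by (rule has_derivative_transform_within_open[OF _ W zW]) (simp add: eq)
qed

text \<open>\<open>ba_x\<close> and \<open>ba_y\<close> are the partial derivatives of
  \<open>ba k\<close> off the real line, with \<open>a\<close> and \<open>b\<close> those of the
  means over \<open>[x, x + y]\<close> and \<open>[x - y, x]\<close>.\<close>

definition ba_x :: "(real \<Rightarrow> real) \<Rightarrow> complex \<Rightarrow> complex" where
  "ba_x k z = (let x = Re z; y = Im z; a = (k (x + y) - k x) / y; b = (k x - k (x - y)) / y
    in Complex ((a + b) / 2) ((a - b) / 2))"

definition ba_y :: "(real \<Rightarrow> real) \<Rightarrow> complex \<Rightarrow> complex" where
  "ba_y k z = (let x = Re z; y = Im z; a = (k (x + y) - avg k x y) / y; b = (k (x - y) - avg k x (- y)) / y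
    in Complex ((a + b) / 2) ((a - b) / 2))"

text \<open>\<open>ba_p\<close> and \<open>ba_q\<close> are the Wirtinger derivatives of
  \<open>ba k\<close> with respect to z and its conjugate.\<close>

definition ba_p :: "(real \<Rightarrow> real) \<Rightarrow> complex \<Rightarrow> complex" where
  "ba_p k z = (ba_x k z - \<i> * ba_y k z) / 2"

definition ba_q :: "(real \<Rightarrow> real) \<Rightarrow> complex \<Rightarrow> complex" where
  "ba_q k z = (ba_x k z + \<i> * ba_y k z) / 2"

lemma ba_has_derivative:
  assumes k: "continuous_on UNIV k" and y: "Im z \<noteq> 0"
  shows "(ba k has_derivative (\<lambda>v. ba_p k z * v + ba_q k z * cnj v)) (at z)"
proof -
  note dA = avg_has_derivative[OF k y]
  have "((\<lambda>z. avg k (Re (cnj z)) (Im (cnj z))) has_derivative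
     (\<lambda>v. (k (Re (cnj z) + Im (cnj z)) - k (Re (cnj z))) / Im (cnj z) * Re (cnj v)
        + (k (Re (cnj z) + Im (cnj z)) - avg k (Re (cnj z)) (Im (cnj z))) / Im (cnj z) * Im (cnj v))) (at z)"
    by (rule has_derivative_compose[where f=cnj, OF _ avg_has_derivative[OF k]])
      (use y in \<open>auto intro!: bounded_linear_imp_has_derivative bounded_linear_cnj\<close>)
  moreover have "(\<lambda>v. (k (Re (cnj z) + Im (cnj z)) - k (Re (cnj z))) / Im (cnj z) * Re (cnj v)
        + (k (Re (cnj z) + Im (cnj z)) - avg k (Re (cnj z)) (Im (cnj z))) / Im (cnj z) * Im (cnj v)) =
     (\<lambda>v. (k (Re z) - k (Re z - Im z)) / Im z * Re v + (k (Re z - Im z) - avg k (Re z) (- Im z)) / Im z * Im v)"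
    using y by (auto simp: fun_eq_iff divide_simps) (simp add: algebra_simps)
  ultimately have dB: "((\<lambda>z. avg k (Re z) (- Im z)) has_derivative
     (\<lambda>v. (k (Re z) - k (Re z - Im z)) / Im z * Re v + (k (Re z - Im z) - avg k (Re z) (- Im z)) / Im z * Im v)) (at z)"
    by simp
  have "(ba k has_derivative (\<lambda>v. ba_x k z * of_real (Re v) + ba_y k z * of_real (Im v))) (at z)"
  proof -
    let ?A = "\<lambda>v. (k (Re z + Im z) - k (Re z)) / Im z * Re v + (k (Re z + Im z) - avg k (Re z) (Im z)) / Im z * Im v"
    let ?B = "\<lambda>v. (k (Re z) - k (Re z - Im z)) / Im z * Re v + (k (Re z - Im z) - avg k (Re z) (- Im z)) / Im z * Im v"
    have 1: "((\<lambda>z. (avg k (Re z) (Im z) + avg k (Re z) (- Im z)) * (1 / 2)) has_derivative (\<lambda>v. (?A v + ?B v) * (1 / 2))) (at z)"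
      by (rule has_derivative_mult_left[OF has_derivative_add[OF dA dB]])
    have 2: "((\<lambda>z. (avg k (Re z) (Im z) - avg k (Re z) (- Im z)) * (1 / 2)) has_derivative (\<lambda>v. (?A v - ?B v) * (1 / 2))) (at z)"
      by (rule has_derivative_mult_left[OF has_derivative_diff[OF dA dB]])
    have "((\<lambda>z. of_real ((avg k (Re z) (Im z) + avg k (Re z) (- Im z)) * (1 / 2)) +
         \<i> * of_real ((avg k (Re z) (Im z) - avg k (Re z) (- Im z)) * (1 / 2))) has_derivative
        (\<lambda>v. of_real ((?A v + ?B v) * (1 / 2)) + \<i> * of_real ((?A v - ?B v) * (1 / 2)))) (at z)"
      by (rule has_derivative_add[OF has_derivative_of_real[OF 1] has_derivative_mult_right[OF has_derivative_of_real[OF 2]]])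
    moreover have "(\<lambda>v. of_real ((?A v + ?B v) * (1 / 2)) + \<i> * of_real ((?A v - ?B v) * (1 / 2))) =
        (\<lambda>v. ba_x k z * of_real (Re v) + ba_y k z * of_real (Im v))"
      by (auto simp: fun_eq_iff complex_eq_iff ba_x_def ba_y_def Let_def algebra_simps add_divide_distrib diff_divide_distrib)
    moreover have "ba k = (\<lambda>z. of_real ((avg k (Re z) (Im z) + avg k (Re z) (- Im z)) * (1 / 2)) +
         \<i> * of_real ((avg k (Re z) (Im z) - avg k (Re z) (- Im z)) * (1 / 2)))"
      by (auto simp: fun_eq_iff ba_def complex_eq_iff)
    ultimately show ?thesis by metis
  qed
  moreover have "(\<lambda>v. ba_x k z * of_real (Re v) + ba_y k z * of_real (Im v)) = (\<lambda>v. ba_p k z * v + ba_q k z * cnj v)"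
    by (auto simp: fun_eq_iff complex_eq_iff ba_p_def ba_q_def field_simps)
  ultimately show ?thesis by simp
qed

lemma ba_shift:
  assumes "\<And>x. k (x + 1) = k x + 1" "continuous_on UNIV k"
  shows "ba k (z + 1) = ba k z + 1"
proof -
  have "avg k (x + 1) y = avg k x y + 1" for x y
  proof -
    have "avg k (x + 1) y = integral {0..1} (\<lambda>t. k (x + t * y) + 1)"
      unfolding avg_def using assms(1) by (intro integral_cong) (metis add.commute add.left_commute)
    also have "\<dots> = avg k x y + 1"
      unfolding avg_def by (subst integral_add) (auto intro!: avg_integrable assms)
    finally show ?thesis .
  qed
  then show ?thesis by (simp add: ba_def complex_eq_iff)
qed

lemma avg_linear:
  assumes "continuous_on UNIV k" "continuous_on UNIV e"
  shows "avg (\<lambda>t. s * k t + c + e t) x y = s * avg k x y + c + avg e x y"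
proof -
  have "((\<lambda>t. s * k (x + t * y) + c * 1 + e (x + t * y)) has_integral s * avg k x y + c * 1 + avg e x y) {0..1}"
    unfolding avg_def
    by (intro has_integral_add has_integral_mult_right integrable_integral avg_integrable assms)
      (use has_integral_const_real[of "1::real" 0 1] in simp)
  then show ?thesis unfolding avg_def[of "\<lambda>t. s * k t + c + e t"] by (subst integral_unique) auto
qed

text \<open>Serves to split \<open>\<Phi> n \<circ> h\<close> into an affine function of
  \<open>h\<close> and a small error \<open>e\<close>; the constant disappears on
  differentiation.\<close>

lemma ba_pq_linear:
  assumes "continuous_on UNIV k" "continuous_on UNIV e" "Im z \<noteq> 0"
  shows "ba_p (\<lambda>t. s * k t + c + e t) z = s * ba_p k z + ba_p e z"
    and "ba_q (\<lambda>t. s * k t + c + e t) z = s * ba_q k z + ba_q e z"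
proof -
  have q: "(s * a + c + b - (s * a' + c + b')) / Im z = s * ((a - a') / Im z) + (b - b') / Im z" for a a' b b'
    using assms(3) by (simp add: field_simps)
  have "ba_x (\<lambda>t. s * k t + c + e t) z = s * ba_x k z + ba_x e z"
    unfolding ba_x_def Let_def q by (simp add: complex_eq_iff algebra_simps add_divide_distrib diff_divide_distrib)
  moreover have "ba_y (\<lambda>t. s * k t + c + e t) z = s * ba_y k z + ba_y e z"
    unfolding ba_y_def Let_def avg_linear[OF assms(1,2)] q
    by (simp add: complex_eq_iff algebra_simps add_divide_distrib diff_divide_distrib)
  ultimately show "ba_p (\<lambda>t. s * k t + c + e t) z = s * ba_p k z + ba_p e z"
    and "ba_q (\<lambda>t. s * k t + c + e t) z = s * ba_q k z + ba_q e z"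
    by (simp_all add: ba_p_def ba_q_def field_simps)
qed

lemma avg_bounds:
  assumes "continuous_on UNIV k" "\<And>t. t \<in> {0..1} \<Longrightarrow> l \<le> k (x + t * y) \<and> k (x + t * y) \<le> u"
  shows "l \<le> avg k x y" "avg k x y \<le> u"
proof -
  have "integral {0..1} (\<lambda>t::real. l) \<le> avg k x y" "avg k x y \<le> integral {0..1} (\<lambda>t::real. u)"
    unfolding avg_def by (rule integral_le; use assms avg_integrable in auto)+
  then show "l \<le> avg k x y" "avg k x y \<le> u" by auto
qed

lemma cmod_Complex_half: "cmod (Complex ((a + b) / 2) ((a - b) / 2)) \<le> \<bar>a\<bar> + \<bar>b\<bar>"
proof -
  have "cmod (Complex ((a + b) / 2) ((a - b) / 2)) \<le> \<bar>(a + b) / 2\<bar> + \<bar>(a - b) / 2\<bar>"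
    using cmod_le[of "Complex ((a + b) / 2) ((a - b) / 2)"] by simp
  also have "\<dots> \<le> \<bar>a\<bar> + \<bar>b\<bar>" by (simp add: abs_if field_simps)
  finally show ?thesis .
qed

text \<open>Every difference quotient in \<open>ba_x\<close> and \<open>ba_y\<close> compares values
  or means of \<open>k\<close> on the interval of radius \<open>\<bar>Im z\<bar>\<close> about
  \<open>Re z\<close>, so the oscillation \<open>D\<close> there controls everything. Monotonicity
  is not assumed, since the estimate is also meant for the error terms in
  \<open>D_beltrami\<close>.\<close>

lemma ba_pq_bound:
  assumes k: "continuous_on UNIV k" and y: "Im z \<noteq> 0"
    and D: "\<And>s t. s \<in> {Re z - \<bar>Im z\<bar>..Re z + \<bar>Im z\<bar>} \<Longrightarrow> t \<in> {Re z - \<bar>Im z\<bar>..Re z + \<bar>Im z\<bar>} \<Longrightarrow> k s - k t \<le> D"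
  shows "cmod (ba_p k z) \<le> 2 * D / \<bar>Im z\<bar>" "cmod (ba_q k z) \<le> 2 * D / \<bar>Im z\<bar>"
proof -
  define x y where "x = Re z" and "y = Im z"
  have D': "\<bar>k s - k t\<bar> \<le> D" if "\<bar>s - x\<bar> \<le> \<bar>y\<bar>" "\<bar>t - x\<bar> \<le> \<bar>y\<bar>" for s t
  proof -
    have "k s - k t \<le> D" "k t - k s \<le> D"
      using that by (intro D; auto simp: x_def y_def abs_le_iff)+
    then show ?thesis by linarith
  qed
  have Q: "\<bar>r / y\<bar> \<le> D / \<bar>y\<bar>" if "\<bar>r\<bar> \<le> D" for r using that by (simp add: divide_right_mono)
  have av: "\<bar>k s - avg k x w\<bar> \<le> D" if "\<bar>s - x\<bar> \<le> \<bar>y\<bar>" "\<bar>w\<bar> = \<bar>y\<bar>" for s w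
  proof -
    have "k s - D \<le> k (x + t * w) \<and> k (x + t * w) \<le> k s + D" if t: "t \<in> {0..1}" for t
    proof -
      have "\<bar>t * w\<bar> \<le> \<bar>y\<bar>" using t \<open>\<bar>w\<bar> = \<bar>y\<bar>\<close> by (simp add: abs_mult mult_left_le_one_le)
      then have "\<bar>k s - k (x + t * w)\<bar> \<le> D" using D' \<open>\<bar>s - x\<bar> \<le> \<bar>y\<bar>\<close> by simp
      then show ?thesis by linarith
    qed
    then show ?thesis using avg_bounds[OF k, of "k s - D" x w "k s + D"] by (auto simp: abs_le_iff)
  qed
  have 1: "cmod (ba_x k z) \<le> D / \<bar>y\<bar> + D / \<bar>y\<bar>" unfolding ba_x_def Let_def x_def[symmetric] y_def[symmetric]
    by (rule order_trans[OF cmod_Complex_half]) (intro add_mono Q D'; simp)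
  have 2: "cmod (ba_y k z) \<le> D / \<bar>y\<bar> + D / \<bar>y\<bar>" unfolding ba_y_def Let_def x_def[symmetric] y_def[symmetric]
    by (rule order_trans[OF cmod_Complex_half]) (intro add_mono Q av; simp)
  have "cmod (ba_p k z) \<le> (cmod (ba_x k z) + cmod (ba_y k z)) / 2"
    "cmod (ba_q k z) \<le> (cmod (ba_x k z) + cmod (ba_y k z)) / 2"
    unfolding ba_p_def ba_q_def
    using norm_triangle_ineq4[of "ba_x k z" "\<i> * ba_y k z"] norm_triangle_ineq[of "ba_x k z" "\<i> * ba_y k z"]
    by (auto simp: norm_divide norm_mult)
  then show "cmod (ba_p k z) \<le> 2 * D / \<bar>Im z\<bar>" "cmod (ba_q k z) \<le> 2 * D / \<bar>Im z\<bar>"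
    using 1 2 unfolding y_def[symmetric] by (auto simp: field_simps)
qed


section \<open>Jacobian and Beltrami coefficient of the Beurling-Ahlfors extension\<close>

lemma avg_le_halves:
  assumes k: "continuous_on UNIV k"
    and u: "\<And>t. t \<in> {0..1/2} \<Longrightarrow> k (x + t * y) \<le> u" "\<And>t. t \<in> {1/2..1} \<Longrightarrow> k (x + t * y) \<le> u'"
  shows "avg k x y \<le> (u + u') / 2"
proof -
  have "avg k x y = integral {0..1/2} (\<lambda>t. k (x + t * y)) + integral {1/2..1} (\<lambda>t. k (x + t * y))"
    unfolding avg_def
    by (intro Henstock_Kurzweil_Integration.integral_combine[symmetric] avg_integrable k) auto
  moreover have "integral {0..1/2} (\<lambda>t. k (x + t * y)) \<le> integral {0..1/2::real} (\<lambda>t. u)"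
    by (rule integral_le; use u avg_integrable[OF k] in auto)
  moreover have "integral {1/2..1} (\<lambda>t. k (x + t * y)) \<le> integral {1/2..1::real} (\<lambda>t. u')"
    by (rule integral_le; use u avg_integrable[OF k] in auto)
  ultimately show ?thesis by simp
qed

lemma avg_uminus: "avg (\<lambda>t. - k t) x y = - avg k x y"
  by (simp add: avg_def)

text \<open>The order of magnitude of the derivative: up to constants it bounds \<open>ba_p\<close>
  and \<open>ba_q\<close> from above, and for quasisymmetric \<open>k\<close> its square bounds the
  Jacobian from below.\<close>

definition ba_size :: "(real \<Rightarrow> real) \<Rightarrow> complex \<Rightarrow> real" where
  "ba_size k z = (k (Re z + \<bar>Im z\<bar>) - k (Re z - \<bar>Im z\<bar>)) / \<bar>Im z\<bar>"

lemma ba_pq_size: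
  assumes k: "continuous_on UNIV k" "mono k" and y: "Im z \<noteq> 0"
  shows "cmod (ba_p k z) \<le> 2 * ba_size k z" "cmod (ba_q k z) \<le> 2 * ba_size k z"
proof -
  have "k s - k t \<le> k (Re z + \<bar>Im z\<bar>) - k (Re z - \<bar>Im z\<bar>)"
    if "s \<in> {Re z - \<bar>Im z\<bar>..Re z + \<bar>Im z\<bar>}" "t \<in> {Re z - \<bar>Im z\<bar>..Re z + \<bar>Im z\<bar>}" for s t
    using that by (intro diff_mono monoD[OF k(2)]) auto
  from ba_pq_bound[OF k(1) y this] show "cmod (ba_p k z) \<le> 2 * ba_size k z" "cmod (ba_q k z) \<le> 2 * ba_size k z"
    by (auto simp: ba_size_def)
qed

lemma ba_size_pos: "strict_mono k \<Longrightarrow> Im z \<noteq> 0 \<Longrightarrow> ba_size k z > 0"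
  by (auto simp: ba_size_def strict_mono_def intro!: divide_pos_pos)

text \<open>In this form every factor is nonnegative for increasing \<open>k\<close>, so lower
  bounds of the factors can be multiplied; \<open>w\<close> in place of \<open>Im z\<close> covers
  both half-planes.\<close>

lemma ba_jacobian_eq:
  fixes k :: "real \<Rightarrow> real" and z :: complex
  assumes "Im z \<noteq> 0"
  defines "x \<equiv> Re z" and "w \<equiv> \<bar>Im z\<bar>"
  shows "(cmod (ba_p k z))\<^sup>2 - (cmod (ba_q k z))\<^sup>2 =
    ((k (x + w) - avg k x w) / w * ((k x - k (x - w)) / w) + (avg k x (- w) - k (x - w)) / w * ((k (x + w) - k x) / w)) / 2"
proof -
  have J: "(cmod (ba_p k z))\<^sup>2 - (cmod (ba_q k z))\<^sup>2 = Re (ba_x k z) * Im (ba_y k z) - Im (ba_x k z) * Re (ba_y k z)"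
    unfolding cmod_power2 ba_p_def ba_q_def by (simp add: power2_eq_square field_simps)
  show ?thesis
  proof (cases "Im z > 0")
    case True
    then show ?thesis unfolding J by (simp add: ba_x_def ba_y_def Let_def x_def w_def field_simps)
  next
    case False
    then have "Im z = - w" "w > 0" using assms by auto
    then show ?thesis unfolding J ba_x_def ba_y_def Let_def x_def[symmetric] by (simp add: field_simps)
  qed
qed

lemma divide_sandwich:
  assumes "S / c \<le> 2 * c * \<alpha>" "c > (0::real)"
  shows "S / (2 * c\<^sup>2) \<le> \<alpha>"
  using assms by (simp add: field_simps power2_eq_square)

text \<open>Quasisymmetry at scale \<open>w\<close> gives \<open>a\<close> and \<open>b\<close> at
  least \<open>S / (1 + M)\<close>. At scale \<open>w / 2\<close> it keeps the mean over each side
  away from the value at the outer end, so \<alpha> and \<beta> lose a further factor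
  \<open>2 * (1 + M)\<close>. The products account for the exponent 3.\<close>

lemma ba_jacobian_lower:
  assumes k: "continuous_on UNIV k" "strict_mono k" and M: "quasisymmetric M k" and y: "Im z \<noteq> 0"
  shows "(ba_size k z)\<^sup>2 / (2 * (1 + M) ^ 3) \<le> (cmod (ba_p k z))\<^sup>2 - (cmod (ba_q k z))\<^sup>2"
proof -
  define x w S where "x = Re z" and "w = \<bar>Im z\<bar>" and "S = ba_size k z"
  have w: "w > 0" using y by (simp add: w_def)
  have S: "S > 0" "S = (k (x + w) - k (x - w)) / w"
    using ba_size_pos[OF k(2) y] by (auto simp: S_def ba_size_def x_def w_def)
  have M1: "M \<ge> 1" using M by (simp add: quasisymmetric_def)
  define a b \<alpha> \<beta> where "a = (k (x + w) - k x) / w" and "b = (k x - k (x - w)) / w"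
    and "\<alpha> = (k (x + w) - avg k x w) / w" and "\<beta> = (avg k x (- w) - k (x - w)) / w"
  have le: "k s \<le> k t" if "s \<le> t" for s t using strict_mono_less_eq[OF k(2)] that by blast
  have "k (x + w) - k x \<le> M * (k x - k (x - w))" "k x - k (x - w) \<le> M * (k (x + w) - k x)"
    using M w unfolding quasisymmetric_def by blast+
  then have "k (x + w) - k (x - w) \<le> (1 + M) * (k x - k (x - w))"
     "k (x + w) - k (x - w) \<le> (1 + M) * (k (x + w) - k x)"
    by (auto simp: algebra_simps)
  then have "S * w \<le> (1 + M) * a * w" "S * w \<le> (1 + M) * b * w"
    using w unfolding S(2) a_def b_def by auto
  then have "S \<le> (1 + M) * a" "S \<le> (1 + M) * b" using w by auto
  then have ab: "S / (1 + M) \<le> a" "S / (1 + M) \<le> b" using M1 by (auto simp: field_simps)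
  have "avg k x w \<le> (k (x + w / 2) + k (x + w)) / 2"
  proof (rule avg_le_halves[OF k(1)]; rule le)
    fix t assume "t \<in> {0..1/2::real}"
    then show "x + t * w \<le> x + w / 2" using w by auto
  next
    fix t assume "t \<in> {1/2..1::real}"
    then show "x + t * w \<le> x + w" using w by auto
  qed
  moreover have "k (x + 2 * (w / 2)) - k x \<le> (1 + M) * (k (x + 2 * (w / 2)) - k (x + w / 2))"
    by (rule quasisymmetric_double_le(2)[OF M]) (use w in auto)
  moreover have e: "x + 2 * (w / 2) = x + w" by simp
  ultimately have "k (x + w) - k (x + w / 2) \<le> 2 * (k (x + w) - avg k x w) \<and>
    k (x + w) - k x \<le> (1 + M) * (k (x + w) - k (x + w / 2))" unfolding e by simp
  then have "k (x + w) - k x \<le> (1 + M) * (2 * (k (x + w) - avg k x w))"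
    using M1 by (meson add_nonneg_nonneg mult_left_mono order_trans zero_le_one)
  moreover have "a * w = k (x + w) - k x" "\<alpha> * w = k (x + w) - avg k x w"
    using w by (simp_all add: a_def \<alpha>_def)
  ultimately have "a * w \<le> (1 + M) * (2 * (\<alpha> * w))" by simp
  also have "\<dots> = (2 * (1 + M) * \<alpha>) * w" by simp
  finally have "a \<le> 2 * (1 + M) * \<alpha>" using w by simp
  then have "S / (1 + M) \<le> 2 * (1 + M) * \<alpha>" using ab by simp
  then have \<alpha>: "S / (2 * (1 + M)^2) \<le> \<alpha>" using divide_sandwich[of S "1 + M" \<alpha>] M1 by simp
  \<comment> \<open>On the left side a lower bound of the mean is needed, hence the upper estimate
    for \<open>- k\<close>.\<close>
  have "avg (\<lambda>t. - k t) x (- w) \<le> (- k (x - w / 2) + - k (x - w)) / 2"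
  proof (rule avg_le_halves)
    fix t assume "t \<in> {0..1/2::real}"
    then show "- k (x + t * - w) \<le> - k (x - w / 2)" using w by (auto intro!: le)
  next
    fix t assume "t \<in> {1/2..1::real}"
    then show "- k (x + t * - w) \<le> - k (x - w)" using w by (auto intro!: le)
  qed (intro continuous_intros k)
  moreover have "k (x - w + 2 * (w / 2)) - k (x - w) \<le> (1 + M) * (k (x - w + w / 2) - k (x - w))"
    by (rule quasisymmetric_double_le(1)[OF M]) (use w in auto)
  moreover have "x - w + w / 2 = x - w / 2" "x - w + 2 * (w / 2) = x" by (auto simp: field_simps)
  ultimately have "k (x - w / 2) - k (x - w) \<le> 2 * (avg k x (- w) - k (x - w)) \<and>
    k x - k (x - w) \<le> (1 + M) * (k (x - w / 2) - k (x - w))" unfolding avg_uminus by simp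
  then have "k x - k (x - w) \<le> (1 + M) * (2 * (avg k x (- w) - k (x - w)))"
    using M1 by (meson add_nonneg_nonneg mult_left_mono order_trans zero_le_one)
  moreover have "b * w = k x - k (x - w)" "\<beta> * w = avg k x (- w) - k (x - w)"
    using w by (simp_all add: b_def \<beta>_def)
  ultimately have "b * w \<le> (1 + M) * (2 * (\<beta> * w))" by simp
  also have "\<dots> = (2 * (1 + M) * \<beta>) * w" by simp
  finally have "b \<le> 2 * (1 + M) * \<beta>" using w by simp
  then have "S / (1 + M) \<le> 2 * (1 + M) * \<beta>" using ab by simp
  then have \<beta>: "S / (2 * (1 + M)^2) \<le> \<beta>" using divide_sandwich[of S "1 + M" \<beta>] M1 by simp
  have mid: "X \<le> u \<Longrightarrow> X \<le> v \<Longrightarrow> X \<le> (u + v) / 2" for X u v :: real by (simp add: field_simps)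
  have nn: "S / (1 + M) \<ge> 0" "S / (2 * (1 + M)^2) \<ge> 0" using S(1) M1 by auto
  have e: "S / (2 * (1 + M)^2) * (S / (1 + M)) = S\<^sup>2 / (2 * (1 + M) ^ 3)"
    by (simp add: power2_eq_square power3_eq_cube)
  have "S / (2 * (1 + M)^2) * (S / (1 + M)) \<le> \<alpha> * b" "S / (2 * (1 + M)^2) * (S / (1 + M)) \<le> \<beta> * a"
    using \<alpha> \<beta> ab nn by (auto intro!: mult_mono simp del: times_divide_eq_left times_divide_eq_right)
  then have "S\<^sup>2 / (2 * (1 + M) ^ 3) \<le> (\<alpha> * b + \<beta> * a) / 2"
    unfolding e by (rule mid)
  then show ?thesis unfolding ba_jacobian_eq[OF y] S_def a_def b_def \<alpha>_def \<beta>_def x_def w_def .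
qed

text \<open>If \<open>L1 v = p1 * v + q1 * cnj v\<close> and \<open>L v = p * v + q * cnj v\<close>, then \<open>L1 \<circ> inv L\<close> has coefficients
  \<open>(p1 * cnj p - q1 * cnj q) / J\<close> and \<open>(q1 * p - p1 * q) / J\<close> with \<open>J = \<bar>p\<bar>\<^sup>2 - \<bar>q\<bar>\<^sup>2\<close>.\<close>
lemma real_linear_inverse:
  fixes p q :: complex
  defines "J \<equiv> of_real ((cmod p)\<^sup>2 - (cmod q)\<^sup>2)"
  assumes "J \<noteq> (0::complex)"
  shows "p * ((cnj p * w - q * cnj w) / J) + q * cnj ((cnj p * w - q * cnj w) / J) = w"
    and "(cnj p * (p * v + q * cnj v) - q * cnj (p * v + q * cnj v)) / J = v"
proof -
  have J: "J = p * cnj p - q * cnj q" "cnj J = J"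
    unfolding J_def of_real_diff complex_norm_square by (auto simp: mult.commute)
  show "p * ((cnj p * w - q * cnj w) / J) + q * cnj ((cnj p * w - q * cnj w) / J) = w"
    using assms(2) by (simp add: J(2) divide_simps) (simp add: J(1) algebra_simps)
  show "(cnj p * (p * v + q * cnj v) - q * cnj (p * v + q * cnj v)) / J = v"
    using assms(2) by (simp add: J(2) divide_simps) (simp add: J(1) algebra_simps)
qed

lemma norm_cross_bound:
  assumes "cmod u1 \<le> a" "cmod v1 \<le> b" "cmod u2 \<le> a" "cmod v2 \<le> b"
  shows "cmod (u1 * v1 - u2 * v2) \<le> 2 * (a * b)"
proof -
  have ab: "a \<ge> 0" "b \<ge> 0" using assms norm_ge_zero order_trans by blast+
  have "cmod (u1 * v1 - u2 * v2) \<le> cmod u1 * cmod v1 + cmod u2 * cmod v2"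
    using norm_triangle_ineq4[of "u1 * v1" "u2 * v2"] by (simp add: norm_mult)
  also have "\<dots> \<le> a * b + a * b" using assms ab by (intro add_mono mult_mono) auto
  finally show ?thesis by simp
qed

text \<open>The Beltrami coefficients of \<open>L1\<close> and \<open>L\<close> being at most \<open>k\<close>, the one of \<open>L1 \<circ> inv L\<close> is at most
  \<open>2 * k / (1 + k\<^sup>2)\<close>.\<close>
lemma beltrami_quotient_bound:
  fixes p q p1 q1 :: complex
  assumes k: "0 \<le> k" "k < 1" and q: "cmod q \<le> k * cmod p" and q1: "cmod q1 \<le> k * cmod p1"
  shows "cmod (q1 * p - p1 * q) \<le> 2 * k / (1 + k\<^sup>2) * cmod (p1 * cnj p - q1 * cnj q)"
proof -
  define a where "a = cmod p * cmod p1"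
  define X Y where "X = cmod (q1 * p - p1 * q)" and "Y = cmod (p1 * cnj p - q1 * cnj q)"
  \<comment> \<open>Multiplicativity of the Jacobian, cleared of denominators. It turns lower bounds
    of the two Jacobians into a gap between \<open>Y\<close> and \<open>X\<close>.\<close>
  have id: "Y\<^sup>2 - X\<^sup>2 = ((cmod p)\<^sup>2 - (cmod q)\<^sup>2) * ((cmod p1)\<^sup>2 - (cmod q1)\<^sup>2)"
    unfolding X_def Y_def cmod_power2 by (simp add: power2_eq_square algebra_simps)
  have lo: "(1 - k\<^sup>2) * (cmod p)\<^sup>2 \<le> (cmod p)\<^sup>2 - (cmod q)\<^sup>2" "(1 - k\<^sup>2) * (cmod p1)\<^sup>2 \<le> (cmod p1)\<^sup>2 - (cmod q1)\<^sup>2"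
    using power_mono[OF q, of 2] power_mono[OF q1, of 2] by (auto simp: power_mult_distrib algebra_simps)
  have k2: "1 - k\<^sup>2 > 0" using k by (simp add: power_less_one_iff)
  have "(1 - k\<^sup>2) * (cmod p)\<^sup>2 * ((1 - k\<^sup>2) * (cmod p1)\<^sup>2) \<le> Y\<^sup>2 - X\<^sup>2"
    unfolding id
  proof (rule mult_mono[OF lo])
    show "0 \<le> (cmod p)\<^sup>2 - (cmod q)\<^sup>2" by (rule order_trans[OF _ lo(1)]) (use k2 in auto)
    show "0 \<le> (1 - k\<^sup>2) * (cmod p1)\<^sup>2" using k2 by auto
  qed
  then have 1: "((1 - k\<^sup>2) * a)\<^sup>2 \<le> Y\<^sup>2 - X\<^sup>2" by (simp add: a_def power2_eq_square mult_ac)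
  have "Y \<le> cmod (p1 * cnj p) + cmod (q1 * cnj q)" unfolding Y_def by (rule norm_triangle_ineq4)
  also have "\<dots> \<le> a + (k * cmod p) * (k * cmod p1)"
    unfolding a_def norm_mult complex_mod_cnj using mult_mono[OF q q1] k by (simp add: mult_ac)
  finally have "Y \<le> (1 + k\<^sup>2) * a" by (simp add: a_def power2_eq_square algebra_simps)
  then have "Y / (1 + k\<^sup>2) \<le> a" by (simp add: field_simps add_pos_nonneg)
  then have "(1 - k\<^sup>2) * (Y / (1 + k\<^sup>2)) \<le> (1 - k\<^sup>2) * a" using k2 by (intro mult_left_mono) auto
  then have "((1 - k\<^sup>2) * (Y / (1 + k\<^sup>2)))\<^sup>2 \<le> Y\<^sup>2 - X\<^sup>2"
    using 1 k2 by (intro order_trans[OF power_mono 1]) (auto simp: Y_def)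
  then have "X\<^sup>2 \<le> Y\<^sup>2 - ((1 - k\<^sup>2) * (Y / (1 + k\<^sup>2)))\<^sup>2" by simp
  also have "\<dots> = Y\<^sup>2 * ((1 + k\<^sup>2)\<^sup>2 - (1 - k\<^sup>2)\<^sup>2) / (1 + k\<^sup>2)\<^sup>2"
  proof -
    have "1 + k\<^sup>2 \<noteq> 0" by (metis add_pos_nonneg less_irrefl zero_le_power2 zero_less_one)
    moreover have "Y\<^sup>2 - (e * (Y / d))\<^sup>2 = Y\<^sup>2 * (d\<^sup>2 - e\<^sup>2) / d\<^sup>2" if "d \<noteq> 0" for d e :: real
      using that by (simp add: power_mult_distrib power_divide field_simps)
    ultimately show ?thesis by blast
  qed
  also have "(1 + k\<^sup>2)\<^sup>2 - (1 - k\<^sup>2)\<^sup>2 = (2 * k)\<^sup>2" by (simp add: power2_eq_square algebra_simps)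
  also have "Y\<^sup>2 * (2 * k)\<^sup>2 / (1 + k\<^sup>2)\<^sup>2 = (2 * k / (1 + k\<^sup>2) * Y)\<^sup>2"
    by (simp add: power_mult_distrib power_divide)
  finally show ?thesis unfolding X_def[symmetric] Y_def[symmetric]
    by (rule power2_le_imp_le) (use k in \<open>auto simp: Y_def\<close>)
qed

text \<open>\<open>ba_p\<close> is at most \<open>2 * ba_size\<close>, which contributes a factor 4
  to the constant 8; the other factor 2 is that of \<open>ba_jacobian_lower\<close>.\<close>

lemma ba_beltrami_bound:
  assumes k: "continuous_on UNIV k" "strict_mono k" and M: "quasisymmetric M k" and y: "Im z \<noteq> 0"
  shows "cmod (ba_q k z) \<le> sqrt (1 - 1 / (8 * (1 + M) ^ 3)) * cmod (ba_p k z)"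
proof -
  define S where "S = ba_size k z"
  have M1: "M \<ge> 1" using M by (simp add: quasisymmetric_def)
  have "(cmod (ba_p k z))\<^sup>2 \<le> (2 * S)\<^sup>2"
    unfolding S_def using ba_pq_size(1)[OF k(1) strict_mono_mono[OF k(2)] y] by (intro power_mono) auto
  then have "(cmod (ba_p k z))\<^sup>2 / 4 / (2 * (1 + M) ^ 3) \<le> S\<^sup>2 / (2 * (1 + M) ^ 3)"
    using M1 by (intro divide_right_mono) (auto simp: power_mult_distrib)
  also have "\<dots> \<le> (cmod (ba_p k z))\<^sup>2 - (cmod (ba_q k z))\<^sup>2"
    unfolding S_def by (rule ba_jacobian_lower[OF k M y])
  finally have "(cmod (ba_q k z))\<^sup>2 \<le> (1 - 1 / (8 * (1 + M) ^ 3)) * (cmod (ba_p k z))\<^sup>2"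
    by (simp add: algebra_simps)
  then have "sqrt ((cmod (ba_q k z))\<^sup>2) \<le> sqrt ((1 - 1 / (8 * (1 + M) ^ 3)) * (cmod (ba_p k z))\<^sup>2)"
    by (rule real_sqrt_le_mono)
  then show ?thesis by (simp add: real_sqrt_mult)
qed

section \<open>Logarithmic coordinates\<close>

definition cproj :: "complex \<Rightarrow> complex" where "cproj z = exp (2 * of_real pi * \<i> * z)"

lemma cproj_of_real: "cproj (of_real x) = circle_proj x"
  by (simp add: cproj_def circle_proj_def)

lemma cproj_nonzero [simp]: "cproj z \<noteq> 0" by (simp add: cproj_def)

lemma cproj_add: "cproj (a + b) = cproj a * cproj b"
  by (simp add: cproj_def distrib_left exp_add)

lemma cproj_int [simp]: "cproj (of_int j) = 1"
proof -
  have "2 * of_real pi * \<i> * of_int j = of_int (2 * j) * (of_real pi * \<i>)" by simp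
  then show ?thesis unfolding cproj_def exp_eq_1 by auto
qed

lemma cproj_eq_iff: "cproj a = cproj b \<longleftrightarrow> (\<exists>j::int. a = b + of_int j)"
proof
  assume "cproj a = cproj b"
  then obtain j :: int where "2 * of_real pi * \<i> * a = 2 * of_real pi * \<i> * b + (of_int (2 * j) * pi) * \<i>"
    unfolding cproj_def exp_eq by blast
  then have "2 * of_real pi * \<i> * a = 2 * of_real pi * \<i> * (b + of_int j)" by (simp add: algebra_simps)
  then show "\<exists>j::int. a = b + of_int j" by (intro exI[of _ j]) (simp add: mult_cancel_left)
qed (auto simp: cproj_add)

lemma cproj_eqD:
  assumes "cproj a = cproj b" "\<bar>Re a - Re b\<bar> < 1" shows "a = b"
proof -
  obtain j :: int where j: "a = b + of_int j" using assms(1) cproj_eq_iff by blast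
  then have "\<bar>real_of_int j\<bar> < 1" using assms(2) by simp
  then have "j = 0" by linarith
  then show ?thesis using j by simp
qed

lemma norm_cproj: "cmod (cproj z) = exp (- (2 * pi * Im z))"
  by (simp add: cproj_def norm_exp_eq_Re)

lemma cproj_cnj: "cproj (cnj z) = 1 / cnj (cproj z)"
  by (simp add: cproj_def exp_cnj flip: exp_minus' inverse_eq_divide) (simp add: exp_minus[symmetric])

lemma cproj_has_field_derivative:
  "(cproj has_field_derivative 2 * of_real pi * \<i> * cproj z) (at z)"
  unfolding cproj_def[abs_def] by (auto intro!: derivative_eq_intros)

lemma cproj_cont: "continuous_on S cproj"
  unfolding cproj_def[abs_def] by (intro continuous_intros)

text \<open>The branch of \<open>log w / (2 \<pi> \<i>)\<close> near \<open>cproj z0\<close> that takes the value \<open>z0\<close> there.\<close>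
definition clog :: "complex \<Rightarrow> complex \<Rightarrow> complex" where
  "clog z0 w = z0 + Ln (w / cproj z0) / (2 * of_real pi * \<i>)"

text \<open>A half-plane rather than a slit plane: the branch then moves the real part by less than
  1/4, which leaves the margin 3/4 in \<open>clog_unique\<close>.\<close>

definition clog_dom :: "complex \<Rightarrow> complex set" where
  "clog_dom z0 = {w. 0 < Re (w / cproj z0)}"

lemma cproj_clog: "w \<noteq> 0 \<Longrightarrow> cproj (clog z0 w) = w"
  unfolding clog_def cproj_add by (simp add: cproj_def)

lemma cproj_surj: assumes "w \<noteq> 0" obtains z where "w = cproj z"
  using cproj_clog[OF assms, of 0] by metis

lemma clog_cproj [simp]: "clog z0 (cproj z0) = z0" by (simp add: clog_def)

lemma open_clog_dom: "open (clog_dom z0)"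
  unfolding clog_dom_def by (intro open_Collect_less continuous_intros) simp

lemma cproj_in_clog_dom [simp]: "cproj z0 \<in> clog_dom z0" by (simp add: clog_dom_def)

lemma clog_dom_nonzero: "w \<in> clog_dom z0 \<Longrightarrow> w \<noteq> 0" by (auto simp: clog_dom_def)

lemma clog_dom_Ln: "w \<in> clog_dom z0 \<Longrightarrow> w / cproj z0 \<notin> \<real>\<^sub>\<le>\<^sub>0"
  by (auto simp: clog_dom_def complex_nonpos_Reals_iff)

lemma continuous_clog: "continuous_on (clog_dom z0) (clog z0)"
  unfolding clog_def[abs_def]
  by (intro continuous_intros) (auto dest: clog_dom_Ln)

lemma clog_has_field_derivative:
  "(clog z0 has_field_derivative 1 / (2 * of_real pi * \<i> * cproj z0)) (at (cproj z0))"
proof -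
  have "((\<lambda>w. w / cproj z0) has_field_derivative 1 / cproj z0) (at (cproj z0))"
    by (auto intro!: derivative_eq_intros)
  then have "((\<lambda>w. Ln (w / cproj z0)) has_field_derivative inverse (cproj z0 / cproj z0) * (1 / cproj z0)) (at (cproj z0))"
    by (rule DERIV_chain2[OF has_field_derivative_Ln, rotated]) simp
  then have "((\<lambda>w. z0 + Ln (w / cproj z0) / (2 * of_real pi * \<i>)) has_field_derivative
     0 + inverse (cproj z0 / cproj z0) * (1 / cproj z0) / (2 * of_real pi * \<i>)) (at (cproj z0))"
    by (intro DERIV_add DERIV_cdivide) auto
  then show ?thesis unfolding clog_def[abs_def] by (simp add: mult_ac)
qed

lemma Re_clog: assumes "w \<in> clog_dom z0" shows "\<bar>Re (clog z0 w) - Re z0\<bar> < 1 / 4"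
proof -
  have "\<bar>Im (Ln (w / cproj z0))\<bar> < pi / 2"
    using Re_Ln_pos_lt[of "w / cproj z0"] clog_dom_nonzero[OF assms] assms by (auto simp: clog_dom_def)
  moreover have "Re (clog z0 w) - Re z0 = Im (Ln (w / cproj z0)) / (2 * pi)"
    by (simp add: clog_def Re_divide power2_eq_square)
  moreover have "\<bar>t\<bar> / (2 * pi) < 1 / 4" if "\<bar>t\<bar> < pi / 2" for t
    using that by (simp add: field_simps)
  ultimately show ?thesis by simp
qed

lemma clog_unique:
  assumes "w \<in> clog_dom z0" "cproj a = w" "\<bar>Re a - Re z0\<bar> < 3 / 4"
  shows "clog z0 w = a"
proof (rule cproj_eqD)
  show "cproj (clog z0 w) = cproj a" using assms cproj_clog by auto
  show "\<bar>Re (clog z0 w) - Re a\<bar> < 1" using Re_clog[OF assms(1)] assms(3) by linarith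
qed

lemma annulus_cproj:
  assumes "0 < r"
  shows "cproj z \<in> annulus r \<longleftrightarrow> \<bar>Im z\<bar> < - ln r / (2 * pi)"
proof -
  have "r < exp (- (2 * pi * Im z)) \<longleftrightarrow> ln r < - (2 * pi * Im z)"
    using assms by (metis exp_ln exp_less_cancel_iff)
  moreover have "exp (- (2 * pi * Im z)) < 1 / r \<longleftrightarrow> - (2 * pi * Im z) < - ln r"
    using assms exp_less_cancel_iff[of "- (2 * pi * Im z)" "- ln r"] by (simp add: exp_minus inverse_eq_divide)
  ultimately show ?thesis
    unfolding annulus_def by (auto simp: norm_cproj abs_less_iff field_simps)
qed

lemma open_annulus: "open (annulus r)"
  unfolding annulus_def by (intro open_Collect_conj open_Collect_less continuous_intros)

lemma sphere_cproj: "cproj z \<in> sphere 0 1 \<longleftrightarrow> Im z = 0"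
  by (simp add: norm_cproj)

lemma circle_cprojE:
  assumes "w \<in> sphere 0 1" obtains x where "w = cproj (of_real x)"
proof -
  have "w \<noteq> 0" using assms by auto
  then obtain z where z: "w = cproj z" using cproj_surj by blast
  then have "Im z = 0" using assms sphere_cproj by blast
  then have "z = of_real (Re z)" by (simp add: complex_eq_iff)
  then show ?thesis using that z by metis
qed

lemma derivatives_of_real_linear:
  assumes "(g has_derivative (\<lambda>v. a * v + b * cnj v)) (at z)"
  shows "d_z g z = a" "d_zbar g z = b"
proof -
  have x: "((\<lambda>t. g (z + of_real t)) has_vector_derivative a + b) (at 0)"
  proof -
    have "((\<lambda>t::real. z + of_real t) has_derivative (\<lambda>t. of_real t)) (at 0)"
      by (auto intro!: derivative_eq_intros)
    moreover have "(g has_derivative (\<lambda>v. a * v + b * cnj v)) (at (z + of_real 0))" using assms by simp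
    ultimately have "((\<lambda>t. g (z + of_real t)) has_derivative (\<lambda>t. a * of_real t + b * cnj (of_real t))) (at 0)"
      by (rule has_derivative_compose)
    then show ?thesis unfolding has_vector_derivative_def
      by (rule has_derivative_eq_rhs) (auto simp: fun_eq_iff scaleR_conv_of_real algebra_simps)
  qed
  have y: "((\<lambda>t. g (z + \<i> * of_real t)) has_vector_derivative a * \<i> + b * (- \<i>)) (at 0)"
  proof -
    have "((\<lambda>t::real. z + \<i> * of_real t) has_derivative (\<lambda>t. \<i> * of_real t)) (at 0)"
      by (auto intro!: derivative_eq_intros)
    moreover have "(g has_derivative (\<lambda>v. a * v + b * cnj v)) (at (z + \<i> * of_real 0))" using assms by simp
    ultimately have "((\<lambda>t. g (z + \<i> * of_real t)) has_derivative (\<lambda>t. a * (\<i> * of_real t) + b * cnj (\<i> * of_real t))) (at 0)"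
      by (rule has_derivative_compose)
    then show ?thesis unfolding has_vector_derivative_def
      by (rule has_derivative_eq_rhs) (auto simp: fun_eq_iff scaleR_conv_of_real algebra_simps)
  qed
  have "partial_x g z = a + b" "partial_y g z = a * \<i> + b * (- \<i>)"
    unfolding partial_x_def partial_y_def using x y by (auto intro: vector_derivative_at)
  then show "d_z g z = a" "d_zbar g z = b"
    unfolding d_z_def d_zbar_def by (simp_all add: complex_eq_iff)
qed

text \<open>The coordinate changes are holomorphic, so they multiply \<open>a\<close> and
  \<open>b\<close> by factors of equal modulus. Hence Beltrami coefficients have the same modulus in
  logarithmic coordinates and in the plane.\<close>

lemma conjugated_has_derivative:
  assumes f: "(f has_derivative (\<lambda>v. a * v + b * cnj v)) (at z0)"
    and g: "\<forall>\<^sub>F w in nhds (cproj z0). g w = cproj (f (clog z0 w))"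
  defines "c \<equiv> 2 * of_real pi * \<i> * cproj (f z0)" and "d \<equiv> 1 / (2 * of_real pi * \<i> * cproj z0)"
  shows "(g has_derivative (\<lambda>v. (c * a * d) * v + (c * b * cnj d) * cnj v)) (at (cproj z0))"
proof -
  have l: "(clog z0 has_derivative (\<lambda>v. d * v)) (at (cproj z0))"
    using clog_has_field_derivative[of z0] unfolding has_field_derivative_def d_def[symmetric] .
  have f': "(f has_derivative (\<lambda>v. a * v + b * cnj v)) (at (clog z0 (cproj z0)))" using f by simp
  have e: "(cproj has_derivative (\<lambda>v. c * v)) (at (f (clog z0 (cproj z0))))"
    using cproj_has_field_derivative[of "f z0"] unfolding has_field_derivative_def c_def[symmetric] by simp
  have "((\<lambda>w. cproj (f (clog z0 w))) has_derivative (\<lambda>v. c * (a * (d * v) + b * cnj (d * v)))) (at (cproj z0))"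
    by (rule has_derivative_compose[OF has_derivative_compose[OF l f'] e])
  then have "((\<lambda>w. cproj (f (clog z0 w))) has_derivative (\<lambda>v. (c * a * d) * v + (c * b * cnj d) * cnj v)) (at (cproj z0))"
    by (rule has_derivative_eq_rhs) (auto simp: fun_eq_iff algebra_simps)
  moreover obtain U where "open U" "cproj z0 \<in> U" "\<And>w. w \<in> U \<Longrightarrow> cproj (f (clog z0 w)) = g w"
    using g unfolding eventually_nhds by metis
  ultimately show ?thesis
    by (rule has_derivative_transform_within_open)
qed

section \<open>Absolute continuity\<close>

text \<open>By dominated convergence the integral of the part of \<psi> above a height tends to 0 as
  the height grows.\<close>

lemma small_excess_integral:
  fixes \<psi> :: "real \<Rightarrow> real"
  assumes \<psi>: "set_integrable lebesgue {a..b} \<psi>" and nn: "\<And>x. \<psi> x \<ge> 0" and e: "e > 0"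
  obtains M where "M > 0" "(LINT x:{a..b}|lebesgue. max 0 (\<psi> x - M)) < e" "set_integrable lebesgue {a..b} (\<lambda>x. max 0 (\<psi> x - M))"
proof -
  let ?f = "\<lambda>n x. indicat_real {a..b} x *\<^sub>R max 0 (\<psi> x - real n)"
  let ?w = "\<lambda>x. indicat_real {a..b} x *\<^sub>R \<psi> x"
  have wi: "integrable lebesgue ?w" using \<psi> by (simp add: set_integrable_def)
  have meas: "?f n \<in> borel_measurable lebesgue" for n
  proof -
    have "(\<lambda>x. max 0 (?w x - real n)) \<in> borel_measurable lebesgue"
      using borel_measurable_integrable[OF wi] by measurable
    moreover have "(\<lambda>x. max 0 (?w x - real n)) = ?f n" by (auto simp: fun_eq_iff indicator_def)
    ultimately show ?thesis by simp
  qed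
  have bd: "norm (?f n x) \<le> ?w x" for n x using nn[of x] by (auto simp: indicator_def)
  have lim: "(\<lambda>n. ?f n x) \<longlonglongrightarrow> 0" for x
  proof -
    have "\<forall>\<^sub>F n in sequentially. real n \<ge> \<psi> x"
      using eventually_ge_at_top[of "nat \<lceil>\<psi> x\<rceil>"] by eventually_elim linarith
    then have "\<forall>\<^sub>F n in sequentially. ?f n x = 0" by eventually_elim simp
    then show ?thesis by (rule tendsto_eventually)
  qed
  have "(\<lambda>n. LINT x|lebesgue. ?f n x) \<longlonglongrightarrow> (LINT (x::real)|lebesgue. 0)"
    by (rule integral_dominated_convergence[where w="?w"]) (use meas wi bd lim in auto)
  then have "\<forall>\<^sub>F n in sequentially. (LINT x|lebesgue. ?f n x) < e"
    using e by (intro order_tendstoD) auto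
  then obtain N where N: "\<And>n. n \<ge> N \<Longrightarrow> (LINT x|lebesgue. ?f n x) < e"
    by (auto simp: eventually_sequentially)
  have "integrable lebesgue (?f n)" for n
    by (rule Bochner_Integration.integrable_bound[OF wi meas]) (use bd nn in \<open>auto intro: order_trans[OF bd]\<close>)
  then show ?thesis using N[of "Suc N"]
    by (intro that[of "real (Suc N)"]) (simp_all add: set_integrable_def set_lebesgue_integral_def del: of_nat_Suc)
qed

text \<open>The part of \<psi> below height \<open>M\<close> contributes at most \<open>M\<close>
  times the total length, which the choice \<open>d = e / (2 * M)\<close> makes less than
  \<open>e / 2\<close>; the excess contributes less than \<open>e / 2\<close> over any disjoint
  family.\<close>

lemma absolute_continuity_of_integral:
  fixes \<psi> :: "real \<Rightarrow> real"
  assumes \<psi>: "\<psi> absolutely_integrable_on {a..b}" and nn: "\<And>x. \<psi> x \<ge> 0" and e: "e > 0"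
  obtains d where "d > 0"
    "\<And>(n::nat) u v. (\<forall>i<n. a \<le> u i \<and> u i \<le> v i \<and> v i \<le> b) \<Longrightarrow>
      (\<forall>i<n. \<forall>j<n. i \<noteq> j \<longrightarrow> {u i<..<v i} \<inter> {u j<..<v j} = {}) \<Longrightarrow>
      (\<Sum>i<n. v i - u i) < d \<Longrightarrow> (\<Sum>i<n. integral {u i..v i} \<psi>) < e"
proof -
  obtain M where M: "M > 0" "(LINT x:{a..b}|lebesgue. max 0 (\<psi> x - M)) < e / 2"
    and Mi: "set_integrable lebesgue {a..b} (\<lambda>x. max 0 (\<psi> x - M))"
    using small_excess_integral[OF \<psi> nn, of "e / 2"] e by auto
  let ?p = "\<lambda>x. max 0 (\<psi> x - M)"
  show ?thesis
  proof (rule that[of "e / (2 * M)"])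
    show "e / (2 * M) > 0" using e M by simp
    fix n :: nat and u v :: "nat \<Rightarrow> real"
    assume uv: "\<forall>i<n. a \<le> u i \<and> u i \<le> v i \<and> v i \<le> b"
      and dis: "\<forall>i<n. \<forall>j<n. i \<noteq> j \<longrightarrow> {u i<..<v i} \<inter> {u j<..<v j} = {}"
      and sum: "(\<Sum>i<n. v i - u i) < e / (2 * M)"
    let ?I = "\<lambda>i. {u i<..<v i}"
    have sub: "?I i \<subseteq> {a..b}" if "i < n" for i using uv that by force
    have pint: "set_integrable lebesgue (?I i) ?p" if "i < n" for i
      by (rule set_integrable_subset[OF Mi _ sub[OF that]]) auto
    have one: "integral {u i..v i} \<psi> \<le> M * (v i - u i) + (LINT x:?I i|lebesgue. ?p x)" if i: "i < n" for i
    proof -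
      have s: "{u i..v i} \<subseteq> {a..b}" using uv i by auto
      have 1: "\<psi> integrable_on {u i..v i}"
        using integrable_on_subinterval[OF set_lebesgue_integral_eq_integral(1)[OF \<psi>] s] .
      have 2: "?p integrable_on {u i..v i}"
        using integrable_on_subinterval[OF set_lebesgue_integral_eq_integral(1)[OF Mi] s] .
      have "integral {u i..v i} \<psi> \<le> integral {u i..v i} (\<lambda>x. M + ?p x)"
        by (rule integral_le) (use 1 2 in \<open>auto intro!: integrable_add\<close>)
      also have "\<dots> = M * (v i - u i) + integral {u i..v i} ?p"
        using uv i 2 by (subst integral_add) auto
      \<comment> \<open>Only the open intervals are disjoint; the closed ones may share end
        points.\<close>
      also have "integral {u i..v i} ?p = integral (?I i) ?p"
        by (simp add: integral_open_interval_real)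
      also have "\<dots> = (LINT x:?I i|lebesgue. ?p x)"
        using set_lebesgue_integral_eq_integral(2)[OF pint[OF i]] by simp
      finally show ?thesis .
    qed
    have "(\<Sum>i<n. LINT x:?I i|lebesgue. ?p x) = (LINT x:(\<Union>i\<in>{..<n}. ?I i)|lebesgue. ?p x)"
      by (rule set_integral_finite_Union[symmetric]) (use dis pint in \<open>auto simp: disjoint_family_on_def\<close>)
    also have "\<dots> \<le> (LINT x:{a..b}|lebesgue. ?p x)"
      unfolding set_lebesgue_integral_def
    proof (rule integral_mono)
      have "(\<Union>i\<in>{..<n}. ?I i) \<subseteq> {a..b}" using sub by auto
      then show "integrable lebesgue (\<lambda>x. indicat_real (\<Union>i\<in>{..<n}. ?I i) x *\<^sub>R ?p x)"
        using set_integrable_subset[OF Mi] by (simp add: set_integrable_def)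
      show "integrable lebesgue (\<lambda>x. indicat_real {a..b} x *\<^sub>R ?p x)" using Mi by (simp add: set_integrable_def)
      show "indicat_real (\<Union>i\<in>{..<n}. ?I i) x *\<^sub>R ?p x \<le> indicat_real {a..b} x *\<^sub>R ?p x" for x
      proof (cases "x \<in> (\<Union>i\<in>{..<n}. ?I i)")
        case True
        then have "x \<in> {a..b}" using \<open>(\<Union>i\<in>{..<n}. ?I i) \<subseteq> {a..b}\<close> by blast
        with True show ?thesis by simp
      next
        case False
        then show ?thesis by (subst indicator_simps(2)[OF False]) (simp add: indicator_def)
      qed

    qed
    finally have "(\<Sum>i<n. LINT x:?I i|lebesgue. ?p x) < e / 2" using M by simp
    moreover have "(\<Sum>i<n. integral {u i..v i} \<psi>) \<le> (\<Sum>i<n. M * (v i - u i) + (LINT x:?I i|lebesgue. ?p x))"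
      using one by (intro sum_mono) auto
    moreover have "\<dots> = M * (\<Sum>i<n. v i - u i) + (\<Sum>i<n. LINT x:?I i|lebesgue. ?p x)"
      by (simp add: sum.distrib sum_distrib_left)
    moreover have "M * (\<Sum>i<n. v i - u i) < e / 2" using sum M by (simp add: field_simps)
    ultimately show "(\<Sum>i<n. integral {u i..v i} \<psi>) < e" by linarith
  qed
qed

text \<open>The fundamental theorem of calculus, valid despite finitely many exceptional points,
  bounds increments of \<open>k\<close> by integrals of \<psi>. The points of \<open>S\<close> will
  be those where a line crosses the circle.\<close>

lemma abs_continuous_on_derivative_bound:
  fixes k :: "real \<Rightarrow> complex"
  assumes c: "continuous_on {a..b} k" and S: "finite S"
    and k': "\<And>x. x \<in> {a<..<b} - S \<Longrightarrow> (k has_vector_derivative k' x) (at x)"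
    and bd: "\<And>x. x \<in> {a<..<b} - S \<Longrightarrow> norm (k' x) \<le> \<psi> x"
    and \<psi>: "\<psi> absolutely_integrable_on {a..b}" and nn: "\<And>x. \<psi> x \<ge> 0"
  shows "abs_continuous_on a b k"
  unfolding abs_continuous_on_def
proof (intro allI impI)
  fix e :: real assume "e > 0"
  then obtain d where d: "d > 0" "\<And>(n::nat) u v. (\<forall>i<n. a \<le> u i \<and> u i \<le> v i \<and> v i \<le> b) \<Longrightarrow>
      (\<forall>i<n. \<forall>j<n. i \<noteq> j \<longrightarrow> {u i<..<v i} \<inter> {u j<..<v j} = {}) \<Longrightarrow>
      (\<Sum>i<n. v i - u i) < d \<Longrightarrow> (\<Sum>i<n. integral {u i..v i} \<psi>) < e"
    using absolute_continuity_of_integral[OF \<psi> nn] by blast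
  have incr: "dist (k u) (k v) \<le> integral {u..v} \<psi>" if uv: "a \<le> u" "u \<le> v" "v \<le> b" for u v
  proof -
    \<comment> \<open>Nothing is known about \<open>k'\<close> outside the good points; with the
      value 0 there the bound by \<psi> holds everywhere.\<close>
    let ?k = "\<lambda>x. if x \<in> {a<..<b} - S then k' x else 0"
    have h: "(?k has_integral (k v - k u)) {u..v}"
    proof (rule fundamental_theorem_of_calculus_interior_strong[OF S uv(2)])
      show "continuous_on {u..v} k" using continuous_on_subset[OF c] uv by auto
      fix x assume "x \<in> {u<..<v} - S"
      then have "x \<in> {a<..<b} - S" using uv by auto
      then show "(k has_vector_derivative ?k x) (at x)" using k' by simp
    qed
    have "\<psi> integrable_on {u..v}"
      using integrable_on_subinterval[OF set_lebesgue_integral_eq_integral(1)[OF \<psi>]] uv by auto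
    then have "norm (integral {u..v} ?k) \<le> integral {u..v} \<psi>"
      by (intro integral_norm_bound_integral) (use h bd nn in auto)
    then show ?thesis using integral_unique[OF h] by (simp add: dist_norm norm_minus_commute)
  qed
  show "\<exists>d>0. \<forall>(n::nat) u v. (\<forall>i<n. a \<le> u i \<and> u i \<le> v i \<and> v i \<le> b) \<and>
        (\<forall>i<n. \<forall>j<n. i \<noteq> j \<longrightarrow> {u i<..<v i} \<inter> {u j<..<v j} = {}) \<and>
        (\<Sum>i<n. v i - u i) < d \<longrightarrow> (\<Sum>i<n. dist (k (u i)) (k (v i))) < e"
  proof (intro exI conjI allI impI)
    fix n :: nat and u v :: "nat \<Rightarrow> real"
    assume *: "(\<forall>i<n. a \<le> u i \<and> u i \<le> v i \<and> v i \<le> b) \<and>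
        (\<forall>i<n. \<forall>j<n. i \<noteq> j \<longrightarrow> {u i<..<v i} \<inter> {u j<..<v j} = {}) \<and> (\<Sum>i<n. v i - u i) < d"
    then have "(\<Sum>i<n. dist (k (u i)) (k (v i))) \<le> (\<Sum>i<n. integral {u i..v i} \<psi>)"
      by (intro sum_mono incr) auto
    also have "\<dots> < e" using d(2) * by blast
    finally show "(\<Sum>i<n. dist (k (u i)) (k (v i))) < e" .
  qed (rule d(1))
qed

text \<open>The function \<open>sqrt\<close> of HOL is odd, so \<open>2 * sqrt (t - p)\<close> is a
  primitive on both sides of \<open>p\<close> and is continuous at \<open>p\<close>.\<close>

lemma inverse_sqrt_absolutely_integrable:
  "(\<lambda>t. 1 / sqrt \<bar>t - p\<bar>) absolutely_integrable_on {a..b::real}"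
proof (cases "a \<le> b")
  case True
  have "((\<lambda>t. 1 / sqrt \<bar>t - p\<bar>) has_integral 2 * sqrt (b - p) - 2 * sqrt (a - p)) {a..b}"
  proof (rule fundamental_theorem_of_calculus_interior_strong[of "{p}"])
    show "continuous_on {a..b} (\<lambda>t. 2 * sqrt (t - p))" by (intro continuous_intros)
    fix t assume "t \<in> {a<..<b} - {p}"
    then have "t - p \<noteq> 0" by simp
    have "sqrt (p - t) = - sqrt (t - p)" by (metis minus_diff_eq real_sqrt_minus)
    then have "(sqrt has_real_derivative 1 / (2 * sqrt \<bar>t - p\<bar>)) (at (t - p))"
      by (intro DERIV_real_sqrt_generic[OF \<open>t - p \<noteq> 0\<close>]) (auto simp: field_simps abs_if)
    then have "((\<lambda>t. 2 * sqrt (t - p)) has_real_derivative 2 * (1 / (2 * sqrt \<bar>t - p\<bar>) * 1)) (at t)"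
      by (intro DERIV_cmult DERIV_chain2[where g="\<lambda>t. t - p"]) (auto intro!: derivative_eq_intros)
    then show "((\<lambda>t. 2 * sqrt (t - p)) has_vector_derivative 1 / sqrt \<bar>t - p\<bar>) (at t)"
      by (simp add: has_real_derivative_iff_has_vector_derivative)
  qed (use True in auto)
  then show ?thesis by (intro nonnegative_absolutely_integrable_1) auto
qed simp

section \<open>The extended lift\<close>

lemma avg_id: "avg (\<lambda>t. t) x y = x + y / 2"
proof -
  have "((\<lambda>t. x + t * y) has_integral (x * 1 + 1\<^sup>2 / 2 * y) - (x * 0 + 0\<^sup>2 / 2 * y)) {0..1}"
    by (rule fundamental_theorem_of_calculus)
      (auto intro!: derivative_eq_intros simp: has_real_derivative_iff_has_vector_derivative[symmetric])
  then show ?thesis unfolding avg_def by (subst integral_unique) auto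
qed

lemma avg_near:
  assumes k: "continuous_on UNIV k" and B: "\<And>t. \<bar>k t - t\<bar> \<le> B"
  shows "\<bar>avg k x y - (x + y / 2)\<bar> \<le> B"
proof -
  have c: "continuous_on UNIV (\<lambda>t. k t - t)" by (intro continuous_intros k)
  have "avg k x y = avg (\<lambda>t. 1 * t + 0 + (k t - t)) x y" by simp
  also have "\<dots> = x + y / 2 + avg (\<lambda>t. k t - t) x y"
    by (subst avg_linear) (auto intro: c continuous_on_id simp: avg_id)
  finally have "avg k x y - (x + y / 2) = avg (\<lambda>t. k t - t) x y" by simp
  moreover have "- B \<le> avg (\<lambda>t. k t - t) x y" "avg (\<lambda>t. k t - t) x y \<le> B"
    using B unfolding abs_le_iff by (intro avg_bounds[OF c, of _ _ _ B] avg_bounds[OF c, of "- B"]; force simp: algebra_simps)+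
  ultimately show ?thesis by (simp add: abs_le_iff)
qed

text \<open>\<open>ba k\<close> stays at bounded distance from the linear isomorphism x + iy
  \<mapsto> x + iy/2, so preimages of bounded sets are bounded and the range is closed. By
  invariance of domain it is also open.\<close>

lemma ba_surj:
  assumes k: "continuous_on UNIV k" "strict_mono k" and B: "\<And>t. \<bar>k t - t\<bar> \<le> B"
  shows "surj (ba k)"
proof -
  have near: "cmod z \<le> 3 * (cmod (ba k z) + B)" for z
  proof -
    have "\<bar>avg k (Re z) (Im z) - (Re z + Im z / 2)\<bar> \<le> B" "\<bar>avg k (Re z) (- Im z) - (Re z - Im z / 2)\<bar> \<le> B"
      using avg_near[OF k(1) B, of "Re z" "Im z"] avg_near[OF k(1) B, of "Re z" "- Im z"] by auto
    then have "\<bar>Re (ba k z) - Re z\<bar> \<le> B" "\<bar>Im (ba k z) - Im z / 2\<bar> \<le> B"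
      unfolding ba_def complex.sel abs_le_iff by (simp_all add: field_simps)
    moreover have "\<bar>Re (ba k z)\<bar> \<le> cmod (ba k z)" "\<bar>Im (ba k z)\<bar> \<le> cmod (ba k z)"
      by (auto simp: abs_Re_le_cmod abs_Im_le_cmod)
    ultimately have "\<bar>Re z\<bar> \<le> cmod (ba k z) + B \<and> \<bar>Im z\<bar> \<le> 2 * (cmod (ba k z) + B)"
      by (auto simp: abs_le_iff)
    then have "\<bar>Re z\<bar> + \<bar>Im z\<bar> \<le> 3 * (cmod (ba k z) + B)" by auto
    then show ?thesis using cmod_le[of z] by linarith
  qed
  have op: "open (range (ba k))"
    using invariance_of_domain[OF continuous_ba[OF k(1)] open_UNIV ba_inj[OF k]] .
  have "closed (range (ba k))"
    unfolding closed_sequential_limits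
  proof (intro allI impI)
    fix x l assume *: "(\<forall>n. x n \<in> range (ba k)) \<and> x \<longlonglongrightarrow> l"
    then have "Bseq x" using convergent_imp_Bseq convergentI by blast
    then obtain R where R: "\<And>n. cmod (x n) \<le> R" by (auto simp: Bseq_def)
    have "x n \<in> ba k ` cball 0 (3 * (R + B))" for n
    proof -
      obtain z where z: "x n = ba k z" using * by auto
      then have "cmod z \<le> 3 * (R + B)" using near[of z] R[of n] by auto
      then show ?thesis using z by auto
    qed
    moreover have "closed (ba k ` cball 0 (3 * (R + B)))"
      by (intro compact_imp_closed compact_continuous_image continuous_on_subset[OF continuous_ba[OF k(1)]]) auto
    ultimately show "l \<in> range (ba k)" using * unfolding closed_sequential_limits by blast
  qed
  with op show ?thesis using clopen[of "range (ba k)"] by auto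
qed

context uaa_lift begin

abbreviation H :: "complex \<Rightarrow> complex" where "H \<equiv> ba h"

definition G :: "complex \<Rightarrow> complex" where "G = inv H"

lemma h_near: "\<bar>h t - t\<bar> \<le> 1"
proof -
  have int: "h (real_of_int j) = real_of_int j" for j using h_shift_int[of 0 j] h_0 by simp
  have "h (of_int \<lfloor>t\<rfloor>) \<le> h t" "h t \<le> h (of_int (\<lfloor>t\<rfloor> + 1))"
    using strict_mono_less_eq[OF h_strict_mono] by (auto intro: less_imp_le)
  then show ?thesis unfolding int by linarith
qed

lemma H_G [simp]: "H (G z) = z" and G_H [simp]: "G (H z) = z"
  using ba_surj[OF h_cont h_strict_mono h_near] ba_inj[OF h_cont h_strict_mono]
  by (auto simp: G_def surj_f_inv_f)

text \<open>Since \<open>h\<close> commutes with integer translations, uniform continuity on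
  \<open>{-1..2}\<close> is enough.\<close>

lemma h_unif:
  assumes "e > 0"
  obtains \<eta> where "\<eta> > 0" "\<And>x y. \<bar>y\<bar> < \<eta> \<Longrightarrow> h (x + \<bar>y\<bar>) - h (x - \<bar>y\<bar>) \<le> e"
proof -
  have "uniformly_continuous_on {-1..2} h"
    by (intro compact_uniformly_continuous continuous_on_subset[OF h_cont]) auto
  then obtain d where d: "d > 0" "\<And>s t. s \<in> {-1..2} \<Longrightarrow> t \<in> {-1..2} \<Longrightarrow> dist s t < d \<Longrightarrow> dist (h s) (h t) < e"
    using assms unfolding uniformly_continuous_on_def by metis
  show ?thesis
  proof (rule that[of "min 1 (d / 2)"])
    fix x y :: real assume y: "\<bar>y\<bar> < min 1 (d / 2)"
    define x' where "x' = x - of_int \<lfloor>x\<rfloor>"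
    have x': "0 \<le> x'" "x' < 1" unfolding x'_def by linarith+
    have "dist (h (x' + \<bar>y\<bar>)) (h (x' - \<bar>y\<bar>)) < e"
      using x' y by (intro d(2)) (auto simp: dist_real_def)
    moreover have "h (x + \<bar>y\<bar>) = h (x' + \<bar>y\<bar>) + of_int \<lfloor>x\<rfloor>" "h (x - \<bar>y\<bar>) = h (x' - \<bar>y\<bar>) + of_int \<lfloor>x\<rfloor>"
      using h_shift_int[of "x' + \<bar>y\<bar>" "\<lfloor>x\<rfloor>"] h_shift_int[of "x' - \<bar>y\<bar>" "\<lfloor>x\<rfloor>"] by (auto simp: x'_def algebra_simps)
    ultimately show "h (x + \<bar>y\<bar>) - h (x - \<bar>y\<bar>) \<le> e" by (simp add: dist_real_def)
  qed (use d in auto)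
qed

lemma Im_H_le: "\<bar>Im (H w)\<bar> \<le> h (Re w + \<bar>Im w\<bar>) - h (Re w - \<bar>Im w\<bar>)"
proof -
  have hm: "h s \<le> h t" if "s \<le> t" for s t using strict_mono_less_eq[OF h_strict_mono] that by blast
  have av: "h (Re w - \<bar>Im w\<bar>) \<le> avg h (Re w) u \<and> avg h (Re w) u \<le> h (Re w + \<bar>Im w\<bar>)" if "\<bar>u\<bar> = \<bar>Im w\<bar>" for u
  proof -
    have "h (Re w - \<bar>Im w\<bar>) \<le> h (Re w + t * u) \<and> h (Re w + t * u) \<le> h (Re w + \<bar>Im w\<bar>)" if t: "t \<in> {0..1}" for t
    proof -
      have "\<bar>t * u\<bar> \<le> \<bar>Im w\<bar>" using t \<open>\<bar>u\<bar> = \<bar>Im w\<bar>\<close> by (simp add: abs_mult mult_left_le_one_le)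
      then show ?thesis by (auto intro!: hm)
    qed
    then show ?thesis using avg_bounds[OF h_cont] by blast
  qed
  have "Im (H w) = (avg h (Re w) (Im w) - avg h (Re w) (- Im w)) / 2" by (simp add: ba_def)
  with av[of "Im w"] av[of "- Im w"] show ?thesis by (simp add: abs_le_iff)
qed

lemma H_cont: "continuous_on UNIV H" by (rule continuous_ba[OF h_cont])

lemma G_cont: "continuous_on UNIV G"
proof -
  obtain g where g: "homeomorphism UNIV (H ` UNIV) H g"
    using invariance_of_domain_homeomorphism[of UNIV H] H_cont ba_inj[OF h_cont h_strict_mono] by auto
  have "H ` UNIV = UNIV" using H_G by (metis surjI)
  with g have g: "homeomorphism UNIV UNIV H g" by simp
  then have "g = G" by (intro ext) (metis UNIV_I H_G homeomorphism_apply1)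
  with g show ?thesis by (simp add: homeomorphism_def)
qed

lemma H_shift: "H (z + 1) = H z + 1" by (rule ba_shift[OF h_shift h_cont])

lemma H_shift_int: "H (z + of_int j) = H z + of_int j"
proof -
  have "H (w + of_nat k) = H w + of_nat k" for w k
  proof (induction k)
    case (Suc k)
    then show ?case using H_shift[of "w + of_nat k"] by (simp add: algebra_simps)
  qed simp
  from this[of z "nat j"] this[of "z + of_int j" "nat (- j)"] show ?thesis
    by (cases "j \<ge> 0") (auto simp: algebra_simps)
qed

lemma G_shift_int: "G (z + of_int j) = G z + of_int j"
  by (metis G_H H_G H_shift_int)

lemma G_cnj: "G (cnj z) = cnj (G z)" by (metis G_H H_G ba_cnj)

lemma G_of_real: "G (of_real x) = of_real (\<theta> x)" by (metis G_H \<theta>_h ba_of_real h_\<theta>)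

lemma Im_G: "Im (G z) > 0 \<longleftrightarrow> Im z > 0" "Im (G z) < 0 \<longleftrightarrow> Im z < 0" "Im (G z) = 0 \<longleftrightarrow> Im z = 0"
  using Im_ba_pos_iff[OF h_cont h_strict_mono, of "G z"] by auto

text \<open>\<open>E n\<close> is a lift of the \<open>n\<close>-fold iterate of the extension of \<open>f\<close>, and \<open>D n\<close> is its inverse.\<close>
definition E :: "nat \<Rightarrow> complex \<Rightarrow> complex" where "E n z = H (of_real (real m ^ n) * G z)"
definition D :: "nat \<Rightarrow> complex \<Rightarrow> complex" where "D n z = H (of_real (1 / real m ^ n) * G z)"

lemma E_D [simp]: "E n (D n z) = z" and D_E [simp]: "D n (E n z) = z"
  using m by (auto simp: E_def D_def)

lemma E_E: "E n (E k z) = E (n + k) z" by (simp add: E_def power_add mult_ac)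

lemma E_0 [simp]: "E 0 z = z" by (simp add: E_def)

lemma E_D_less: "k \<le> n \<Longrightarrow> E k (D n z) = D (n - k) z"
  using m by (simp add: E_def D_def power_diff)

lemma E_cont: "continuous_on UNIV (E n)" and D_cont: "continuous_on UNIV (D n)"
  unfolding E_def[abs_def] D_def[abs_def]
  by (intro continuous_on_compose2[OF H_cont] continuous_intros continuous_on_compose2[OF G_cont]; simp)+

lemma E_shift_int: "E n (z + of_int j) = E n z + of_int (int m ^ n * j)"
  using H_shift_int[of "of_real (real m ^ n) * G z" "int m ^ n * j"]
  by (simp add: E_def G_shift_int algebra_simps)

lemma E_cnj: "E n (cnj z) = cnj (E n z)" by (simp add: E_def G_cnj flip: ba_cnj)

lemma E_of_real: "E n (of_real x) = of_real ((F ^^ n) x)"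
proof -
  have "E n (of_real x) = H (of_real (real m ^ n * \<theta> x))" by (simp add: E_def G_of_real)
  then show ?thesis by (simp only: ba_of_real h_power h_\<theta>)
qed

lemma E_inj: "inj (E n)" by (metis D_E injI)

lemma Im_E: "Im (E n z) > 0 \<longleftrightarrow> Im z > 0" "Im (E n z) < 0 \<longleftrightarrow> Im z < 0" "Im (E n z) = 0 \<longleftrightarrow> Im z = 0"
  using Im_ba_pos_iff[OF h_cont h_strict_mono, of "of_real (real m ^ n) * G z"] Im_G[of z] m
  by (auto simp: E_def zero_less_mult_iff mult_less_0_iff)

lemma D_eq: "D n z = ba (\<Phi> n \<circ> h) (G z)"
  using ba_scale[of "1 / real m ^ n" h "G z"] h_div[of _ n] m by (simp add: D_def o_def)

lemma E1_eq: "E 1 z = ba (F \<circ> h) (G z)"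
  using ba_scale[of "real m" h "G z"] h_mult m by (simp add: E_def o_def)

text \<open>\<open>co_z k (G z)\<close> and \<open>co_zbar k (G z)\<close> are the complex derivatives of \<open>ba k \<circ> G\<close> at \<open>z\<close>.\<close>
definition jac :: "complex \<Rightarrow> complex" where
  "jac w = of_real ((cmod (ba_p h w))\<^sup>2 - (cmod (ba_q h w))\<^sup>2)"
definition co_z :: "(real \<Rightarrow> real) \<Rightarrow> complex \<Rightarrow> complex" where
  "co_z k w = (ba_p k w * cnj (ba_p h w) - ba_q k w * cnj (ba_q h w)) / jac w"
definition co_zbar :: "(real \<Rightarrow> real) \<Rightarrow> complex \<Rightarrow> complex" where
  "co_zbar k w = (ba_q k w * ba_p h w - ba_p k w * ba_q h w) / jac w"

abbreviation "E_z z \<equiv> co_z (F \<circ> h) (G z)"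
abbreviation "E_zbar z \<equiv> co_zbar (F \<circ> h) (G z)"
abbreviation "D_z n z \<equiv> co_z (\<Phi> n \<circ> h) (G z)"
abbreviation "D_zbar n z \<equiv> co_zbar (\<Phi> n \<circ> h) (G z)"

text \<open>The denominator in \<open>ba_jacobian_lower\<close> for \<open>h\<close>.\<close>

definition K\<^sub>h :: real where "K\<^sub>h = 2 * (1 + M\<^sub>h) ^ 3"

lemma K\<^sub>h_pos: "K\<^sub>h > 0" 
  using h_quasisymmetric by (simp add: K\<^sub>h_def quasisymmetric_def)

lemma jac_lower: assumes "Im w \<noteq> 0" shows "(ba_size h w)\<^sup>2 / K\<^sub>h \<le> cmod (jac w)" "jac w \<noteq> 0"
proof -
  have J: "(ba_size h w)\<^sup>2 / K\<^sub>h \<le> (cmod (ba_p h w))\<^sup>2 - (cmod (ba_q h w))\<^sup>2"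
    unfolding K\<^sub>h_def by (rule ba_jacobian_lower[OF h_cont h_strict_mono h_quasisymmetric assms])
  then show "(ba_size h w)\<^sup>2 / K\<^sub>h \<le> cmod (jac w)" unfolding jac_def norm_of_real by linarith
  have "(ba_size h w)\<^sup>2 / K\<^sub>h > 0" using ba_size_pos[OF h_strict_mono assms] K\<^sub>h_pos by simp
  with J show "jac w \<noteq> 0" unfolding jac_def by (metis less_le_not_le of_real_eq_0_iff)
qed

lemma G_has_derivative:
  assumes "Im z \<noteq> 0"
  shows "(G has_derivative (\<lambda>v. (cnj (ba_p h (G z)) * v - ba_q h (G z) * cnj v) / jac (G z))) (at z)"
proof (rule has_derivative_inverse_basic[where T=UNIV and f=H])
  have w: "Im (G z) \<noteq> 0" using Im_G assms by auto
  show "(H has_derivative (\<lambda>v. ba_p h (G z) * v + ba_q h (G z) * cnj v)) (at (G z))"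
    by (rule ba_has_derivative[OF h_cont w])
  show "bounded_linear (\<lambda>v. (cnj (ba_p h (G z)) * v - ba_q h (G z) * cnj v) / jac (G z))"
    by (intro bounded_linear_divide[THEN bounded_linear_compose] bounded_linear_sub bounded_linear_mult_right
        bounded_linear_compose[OF bounded_linear_mult_right bounded_linear_cnj])
  show "(\<lambda>v. (cnj (ba_p h (G z)) * v - ba_q h (G z) * cnj v) / jac (G z)) \<circ>
      (\<lambda>v. ba_p h (G z) * v + ba_q h (G z) * cnj v) = id"
    using real_linear_inverse(2)[of "ba_p h (G z)" "ba_q h (G z)"] jac_lower(2)[OF w]
    by (auto simp: fun_eq_iff jac_def)
  show "continuous (at z) G" using G_cont by (simp add: continuous_on_eq_continuous_at)
qed auto

lemma ba_G_has_derivative: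
  assumes k: "continuous_on UNIV k" and z: "Im z \<noteq> 0"
  shows "((\<lambda>z. ba k (G z)) has_derivative (\<lambda>v. co_z k (G z) * v + co_zbar k (G z) * cnj v)) (at z)"
proof -
  have w: "Im (G z) \<noteq> 0" using Im_G z by auto
  have cj: "cnj (jac w) = jac w" for w by (simp add: jac_def)
  show ?thesis
    by (rule has_derivative_eq_rhs[OF has_derivative_compose[OF G_has_derivative[OF z] ba_has_derivative[OF k w]]])
      (use jac_lower(2)[OF w] in \<open>auto simp: fun_eq_iff co_z_def co_zbar_def cj field_simps\<close>)
qed

lemma F_h_cont: "continuous_on UNIV (F \<circ> h)"
  by (intro continuous_on_compose h_cont continuous_on_subset[OF cont]) auto

lemma \<Phi>_cont: "continuous_on UNIV (\<Phi> n)"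
proof -
  have "\<Phi> n x = h (\<theta> x / real m ^ n)" for x by (simp add: h_div)
  then have "\<Phi> n = (\<lambda>x. h (\<theta> x / real m ^ n))" by (simp add: fun_eq_iff)
  moreover have "continuous_on UNIV (\<lambda>x. h (\<theta> x / real m ^ n))"
    using m by (intro continuous_on_compose2[OF h_cont] continuous_intros cont_\<theta>) auto
  ultimately show ?thesis by simp
qed

lemma \<Phi>_h_cont: "continuous_on UNIV (\<Phi> n \<circ> h)"
  by (intro continuous_on_compose h_cont continuous_on_subset[OF \<Phi>_cont]) auto

lemma E1_has_derivative:
  assumes "Im z \<noteq> 0"
  shows "(E 1 has_derivative (\<lambda>v. E_z z * v + E_zbar z * cnj v)) (at z)"
proof -
  have "E 1 = (\<lambda>z. ba (F \<circ> h) (G z))" using E1_eq by blast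
  then show ?thesis using ba_G_has_derivative[OF F_h_cont assms] by simp
qed

lemma D_has_derivative:
  assumes "Im z \<noteq> 0"
  shows "(D n has_derivative (\<lambda>v. D_z n z * v + D_zbar n z * cnj v)) (at z)"
proof -
  have "D n = (\<lambda>z. ba (\<Phi> n \<circ> h) (G z))" by (simp add: fun_eq_iff D_eq)
  then show ?thesis using ba_G_has_derivative[OF \<Phi>_h_cont assms] by simp
qed

lemma F_h_quasisymmetric: "quasisymmetric M\<^sub>h (F \<circ> h)"
  using quasisymmetric_scale[OF h_quasisymmetric, of m] m by (simp add: h_mult o_def)

lemma F_h_mono: "strict_mono (F \<circ> h)"
  using mono h_strict_mono by (auto simp: strict_mono_def)

text \<open>\<open>F \<circ> h\<close> is \<open>h\<close> after a scaling, so it has the same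
  quasisymmetry constant as \<open>h\<close>; \<open>beltrami_quotient_bound\<close> then applies to
  \<open>ba (F \<circ> h)\<close> and \<open>H\<close> with a common \<open>k\<close>.\<close>

lemma E1_beltrami: obtains k where "0 \<le> k" "k < 1"
  "\<And>z. Im z \<noteq> 0 \<Longrightarrow> cmod (E_zbar z) \<le> k * cmod (E_z z)"
proof -
  define k where "k = sqrt (1 - 1 / (8 * (1 + M\<^sub>h) ^ 3))"
  have M: "M\<^sub>h \<ge> 1" using h_quasisymmetric by (simp add: quasisymmetric_def)
  then have "(1 + M\<^sub>h) ^ 3 \<ge> 1" by simp
  moreover have "1 / (8 * r) \<le> 1" "1 / (8 * r) > 0" if "r \<ge> 1" for r :: real
    using that by (auto simp: divide_simps)
  ultimately have "1 / (8 * (1 + M\<^sub>h) ^ 3) \<le> 1" "1 / (8 * (1 + M\<^sub>h) ^ 3) > 0" by blast+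
  then have k: "0 \<le> k" "k < 1" unfolding k_def by (auto simp: real_sqrt_lt_1_iff)
  have k': "2 * k / (1 + k\<^sup>2) < 1"
  proof -
    have "0 < (1 - k)\<^sup>2" using k by simp
    then show ?thesis by (simp add: power2_eq_square algebra_simps add_pos_nonneg)
  qed
  show ?thesis
  proof (rule that[OF _ k'])
    fix z assume z: "Im z \<noteq> 0"
    have w: "Im (G z) \<noteq> 0" using Im_G z by auto
    note B = beltrami_quotient_bound[OF k, unfolded k_def, OF ba_beltrami_bound[OF h_cont h_strict_mono h_quasisymmetric w]
        ba_beltrami_bound[OF F_h_cont F_h_mono F_h_quasisymmetric w], folded k_def]
    then show "cmod (E_zbar z) \<le> 2 * k / (1 + k\<^sup>2) * cmod (E_z z)"
      using divide_right_mono[OF B norm_ge_zero[of "jac (G z)"]]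
      unfolding co_z_def co_zbar_def norm_divide by (simp only: times_divide_eq_right)
  qed (use k in auto)
qed

text \<open>The derivative is at most a constant times \<open>S1 / S\<close>, which is the mean
  slope of \<open>F\<close> on \<open>[a, b]\<close>. Hoelder continuity bounds this slope in terms
  of \<open>b - a\<close>, and \<open>b - a\<close> is at least \<open>\<bar>Im z\<bar>\<close> by
  \<open>Im_H_le\<close>.\<close>

lemma E1_derivative_bound: obtains C where "C > 0"
  "\<And>z. Im z \<noteq> 0 \<Longrightarrow> cmod (E_z z) + cmod (E_zbar z) \<le> C * (1 / sqrt \<bar>Im z\<bar> + 1)"
proof -
  obtain C where C: "C > 0" "\<And>x t. 0 < t \<Longrightarrow> F (x + t) - F x \<le> C * (sqrt t + t)" using F_holder by blast
  show ?thesis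
  proof (rule that[of "16 * K\<^sub>h * C"])
    show "16 * K\<^sub>h * C > 0" using K\<^sub>h_pos C by simp
    fix z assume z: "Im z \<noteq> 0"
    define w where "w = G z"
    have w: "Im w \<noteq> 0" using Im_G z by (auto simp: w_def)
    define a b y where "a = h (Re w - \<bar>Im w\<bar>)" and "b = h (Re w + \<bar>Im w\<bar>)" and "y = \<bar>Im w\<bar>"
    have y: "y > 0" using w by (simp add: y_def)
    have ab: "a < b" using y h_strict_mono by (auto simp: a_def b_def y_def strict_mono_def)
    define S S1 where "S = ba_size h w" and "S1 = ba_size (F \<circ> h) w"
    have S: "S = (b - a) / y" "S1 = (F b - F a) / y" "S > 0" "S1 > 0"
      using ba_size_pos[OF h_strict_mono w] ba_size_pos[OF F_h_mono w]
      by (auto simp: S_def S1_def ba_size_def a_def b_def y_def)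
    have pq: "cmod (ba_p h w) \<le> 2 * S" "cmod (ba_q h w) \<le> 2 * S"
      "cmod (ba_p (F \<circ> h) w) \<le> 2 * S1" "cmod (ba_q (F \<circ> h) w) \<le> 2 * S1"
      using ba_pq_size[OF h_cont strict_mono_mono[OF h_strict_mono] w]
        ba_pq_size[OF F_h_cont strict_mono_mono[OF F_h_mono] w] by (auto simp: S_def S1_def)
    have N: "cmod (u1 * v1 - u2 * v2) \<le> 8 * S * S1" if "cmod u1 \<le> 2 * S1" "cmod v1 \<le> 2 * S" "cmod u2 \<le> 2 * S1" "cmod v2 \<le> 2 * S" for u1 v1 u2 v2
      using norm_cross_bound[OF that] by (simp add: mult_ac)
    have J: "S\<^sup>2 / K\<^sub>h \<le> cmod (jac w)" using jac_lower(1)[OF w] by (simp add: S_def)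
    have Jp: "S\<^sup>2 / K\<^sub>h > 0" using S(3) K\<^sub>h_pos by simp
    have "cmod (co_z (F \<circ> h) w) \<le> (8 * S * S1) / (S\<^sup>2 / K\<^sub>h)" "cmod (co_zbar (F \<circ> h) w) \<le> (8 * S * S1) / (S\<^sup>2 / K\<^sub>h)"
      unfolding co_z_def co_zbar_def norm_divide using pq J Jp S(3,4)
      by (intro frac_le N; simp)+
    moreover have "(8 * S * S1) / (S\<^sup>2 / K\<^sub>h) = 8 * (K\<^sub>h * (S1 / S))"
      using S(3) K\<^sub>h_pos by (simp add: power2_eq_square)
    ultimately have "cmod (co_z (F \<circ> h) w) + cmod (co_zbar (F \<circ> h) w) \<le> 8 * (K\<^sub>h * (S1 / S)) + 8 * (K\<^sub>h * (S1 / S))"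
      by (intro add_mono) (simp_all only:)
    then have 1: "cmod (co_z (F \<circ> h) w) + cmod (co_zbar (F \<circ> h) w) \<le> 16 * K\<^sub>h * (S1 / S)" by (simp add: mult_ac)
    have "S1 / S = (F (a + (b - a)) - F a) / (b - a)" unfolding S using y by simp
    also have "\<dots> \<le> C * (sqrt (b - a) + (b - a)) / (b - a)" using C(2)[of "b - a" a] ab by (intro divide_right_mono) auto
    also have "\<dots> = C * (1 / sqrt (b - a) + 1)"
    proof -
      have "sqrt (b - a) * sqrt (b - a) = b - a" "sqrt (b - a) > 0" using ab by auto
      then show ?thesis using ab by (simp add: divide_simps) (simp add: algebra_simps)
    qed
    also have "\<dots> \<le> C * (1 / sqrt \<bar>Im z\<bar> + 1)"
    proof -
      have "\<bar>Im z\<bar> \<le> b - a" using Im_H_le[of w] by (simp add: w_def a_def b_def)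
      then have "sqrt \<bar>Im z\<bar> \<le> sqrt (b - a)" by simp
      then have "1 / sqrt (b - a) \<le> 1 / sqrt \<bar>Im z\<bar>" using z by (intro divide_left_mono) auto
      then show ?thesis using C by simp
    qed
    finally have "16 * K\<^sub>h * (S1 / S) \<le> 16 * K\<^sub>h * (C * (1 / sqrt \<bar>Im z\<bar> + 1))"
      using K\<^sub>h_pos by (intro mult_left_mono) auto
    with 1 show "cmod (E_z z) + cmod (E_zbar z) \<le> 16 * K\<^sub>h * C * (1 / sqrt \<bar>Im z\<bar> + 1)"
      by (simp add: w_def mult.assoc)
  qed
qed

text \<open>On a short interval \<open>\<Phi> n\<close> is affine up to a relative error \<open>\<delta>\<close>, so there \<open>ba (\<Phi> n \<circ> h)\<close> has,
  up to a similar error, the derivative of a real affine map composed with \<open>H = ba h\<close>.\<close>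
lemma D_beltrami:
  assumes \<kappa>: "\<kappa> > 0"
  obtains \<eta> where "\<eta> > 0" "\<And>n z. n > 0 \<Longrightarrow> Im z \<noteq> 0 \<Longrightarrow> \<bar>Im (G z)\<bar> < \<eta> \<Longrightarrow>
    D_z n z \<noteq> 0 \<and>
    cmod (D_zbar n z) \<le> \<kappa> * cmod (D_z n z)"
proof -
  \<comment> \<open>Up to the common factor \<open>s * S\<^sup>2\<close>, the numerator of the
    Beltrami coefficient will be at most \<open>16 * \<delta>\<close> and the denominator at least
    \<open>1 / K\<^sub>h - 16 * \<delta>\<close>; \<delta> is chosen so that the ratio of these two
    bounds is \<kappa>.\<close>
  define \<delta> where "\<delta> = \<kappa> / (16 * K\<^sub>h * (1 + \<kappa>))"
  have \<delta>: "\<delta> > 0" using \<kappa> K\<^sub>h_pos by (simp add: \<delta>_def)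
  have \<delta>eq: "16 * \<delta> = \<kappa> * (1 / K\<^sub>h - 16 * \<delta>)" "1 / K\<^sub>h - 16 * \<delta> > 0"
  proof -
    have e: "1 / K\<^sub>h - 16 * \<delta> = 1 / (K\<^sub>h * (1 + \<kappa>))"
      using \<kappa> K\<^sub>h_pos by (simp add: \<delta>_def divide_simps)
    show "1 / K\<^sub>h - 16 * \<delta> > 0" unfolding e using \<kappa> K\<^sub>h_pos by simp
    show "16 * \<delta> = \<kappa> * (1 / K\<^sub>h - 16 * \<delta>)" unfolding e by (simp add: \<delta>_def)
  qed
  obtain y0 where y0: "y0 > 0" and aff: "\<And>n a b t. n > 0 \<Longrightarrow> a < b \<Longrightarrow> b - a \<le> y0 \<Longrightarrow> t \<in> {a..b} \<Longrightarrow>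
    \<bar>\<Phi> n t - \<Phi> n a - (\<Phi> n b - \<Phi> n a) / (b - a) * (t - a)\<bar> \<le> \<delta> * (\<Phi> n b - \<Phi> n a)"
    using near_affine[OF \<delta>] by blast
  obtain \<eta> where \<eta>: "\<eta> > 0" "\<And>x y. \<bar>y\<bar> < \<eta> \<Longrightarrow> h (x + \<bar>y\<bar>) - h (x - \<bar>y\<bar>) \<le> y0"
    using h_unif[OF y0] by blast
  show ?thesis
  proof (rule that[OF \<eta>(1)])
    fix n z assume n: "(n::nat) > 0" and z: "Im z \<noteq> 0" and small: "\<bar>Im (G z)\<bar> < \<eta>"
    define w where "w = G z"
    have w: "Im w \<noteq> 0" using Im_G z by (auto simp: w_def)
    define a b y where "a = h (Re w - \<bar>Im w\<bar>)" and "b = h (Re w + \<bar>Im w\<bar>)" and "y = \<bar>Im w\<bar>"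
    have y: "y > 0" using w by (simp add: y_def)
    have ab: "a < b" using y h_strict_mono by (auto simp: a_def b_def y_def strict_mono_def)
    have bay: "b - a \<le> y0" using \<eta>(2)[of "Im w" "Re w"] small by (simp add: a_def b_def w_def)
    define s where "s = (\<Phi> n b - \<Phi> n a) / (b - a)"
    have s: "s > 0" using ab strict_monoD[OF mono_\<Phi> ab, of n] by (simp add: s_def)
    define S where "S = ba_size h w"
    have S: "S * y = b - a" "S > 0"
      using ba_size_pos[OF h_strict_mono w] y by (auto simp: S_def ba_size_def a_def b_def y_def)
    define e where "e t = \<Phi> n (h t) - (s * h t + (\<Phi> n a - s * a))" for t
    have e_cont: "continuous_on UNIV e"
      using \<Phi>_h_cont[of n] h_cont unfolding e_def[abs_def] o_def by (intro continuous_intros)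
    have eb: "\<bar>e t\<bar> \<le> \<delta> * s * (b - a)" if "t \<in> {Re w - \<bar>Im w\<bar>..Re w + \<bar>Im w\<bar>}" for t
    proof -
      have "h t \<in> {a..b}" using that strict_mono_less_eq[OF h_strict_mono] by (auto simp: a_def b_def)
      then have "\<bar>\<Phi> n (h t) - \<Phi> n a - s * (h t - a)\<bar> \<le> \<delta> * (\<Phi> n b - \<Phi> n a)"
        unfolding s_def by (rule aff[OF n ab bay])
      moreover have "\<Phi> n (h t) - \<Phi> n a - s * (h t - a) = e t" by (simp add: e_def algebra_simps)
      moreover have "\<Phi> n b - \<Phi> n a = s * (b - a)" using ab by (simp add: s_def)
      ultimately show ?thesis by (simp add: mult.assoc)
    qed
    have D: "e s' - e t \<le> 2 * \<delta> * s * (b - a)" if "s' \<in> {Re w - \<bar>Im w\<bar>..Re w + \<bar>Im w\<bar>}" "t \<in> {Re w - \<bar>Im w\<bar>..Re w + \<bar>Im w\<bar>}" for s' t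
      using eb[OF that(1)] eb[OF that(2)] by (simp add: abs_le_iff)
    have "2 * (2 * \<delta> * s * (b - a)) / \<bar>Im w\<bar> = 4 * \<delta> * s * S" using y unfolding y_def[symmetric] S(1)[symmetric] by simp
    then have pe: "cmod (ba_p e w) \<le> 4 * \<delta> * s * S" and qe: "cmod (ba_q e w) \<le> 4 * \<delta> * s * S"
      using ba_pq_bound[OF e_cont w D] by auto
    have split: "\<Phi> n \<circ> h = (\<lambda>t. s * h t + (\<Phi> n a - s * a) + e t)" by (auto simp: e_def)
    have pn: "ba_p (\<Phi> n \<circ> h) w = s * ba_p h w + ba_p e w" "ba_q (\<Phi> n \<circ> h) w = s * ba_q h w + ba_q e w"
      unfolding split by (rule ba_pq_linear[OF h_cont e_cont w])+
    have pq: "cmod (ba_p h w) \<le> 2 * S" "cmod (ba_q h w) \<le> 2 * S"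
      using ba_pq_size[OF h_cont strict_mono_mono[OF h_strict_mono] w] by (auto simp: S_def)
    have N: "cmod (u1 * v1 - u2 * v2) \<le> 16 * \<delta> * (s * S\<^sup>2)"
      if "cmod u1 \<le> 4 * \<delta> * s * S" "cmod v1 \<le> 2 * S" "cmod u2 \<le> 4 * \<delta> * s * S" "cmod v2 \<le> 2 * S" for u1 v1 u2 v2
      using norm_cross_bound[OF that] by (simp add: power2_eq_square mult_ac)
    let ?num = "ba_q (\<Phi> n \<circ> h) w * ba_p h w - ba_p (\<Phi> n \<circ> h) w * ba_q h w"
    let ?den = "ba_p (\<Phi> n \<circ> h) w * cnj (ba_p h w) - ba_q (\<Phi> n \<circ> h) w * cnj (ba_q h w)"
    \<comment> \<open>The contribution of \<open>s * h\<close> is proportional to that of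
      \<open>h\<close> and cancels; only the error \<open>e\<close> remains.\<close>
    have "?num = ba_q e w * ba_p h w - ba_p e w * ba_q h w" unfolding pn by (simp add: algebra_simps)
    then have num: "cmod ?num \<le> 16 * \<delta> * (s * S\<^sup>2)" using N[OF qe pq(1) pe pq(2)] by simp
    have J: "jac w = ba_p h w * cnj (ba_p h w) - ba_q h w * cnj (ba_q h w)"
      unfolding jac_def of_real_diff complex_norm_square by simp
    have "?den = s * jac w + (ba_p e w * cnj (ba_p h w) - ba_q e w * cnj (ba_q h w))"
      unfolding pn J by (simp add: algebra_simps)
    then have "cmod ?den \<ge> cmod (s * jac w) - cmod (ba_p e w * cnj (ba_p h w) - ba_q e w * cnj (ba_q h w))"
      by (metis norm_diff_ineq)
    moreover have "cmod (ba_p e w * cnj (ba_p h w) - ba_q e w * cnj (ba_q h w)) \<le> 16 * \<delta> * (s * S\<^sup>2)"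
      by (rule N) (use pe qe pq in auto)
    moreover have "cmod (s * jac w) \<ge> (1 / K\<^sub>h) * (s * S\<^sup>2)"
    proof -
      have "s * (S\<^sup>2 / K\<^sub>h) \<le> s * cmod (jac w)"
        using jac_lower(1)[OF w] s unfolding S_def by (intro mult_left_mono) auto
      then show ?thesis using s by (simp add: norm_mult)
    qed
    ultimately have den: "cmod ?den \<ge> (1 / K\<^sub>h - 16 * \<delta>) * (s * S\<^sup>2)" by (simp add: left_diff_distrib)
    have "(1 / K\<^sub>h - 16 * \<delta>) * (s * S\<^sup>2) > 0" using \<delta>eq(2) s S by simp
    then have d0: "?den \<noteq> 0" using den by auto
    have "16 * \<delta> * (s * S\<^sup>2) = \<kappa> * ((1 / K\<^sub>h - 16 * \<delta>) * (s * S\<^sup>2))" using \<delta>eq(1) by (metis mult.assoc)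
    also have "\<dots> \<le> \<kappa> * cmod ?den" using den \<kappa> by (intro mult_left_mono) auto
    finally have "cmod ?num \<le> \<kappa> * cmod ?den" using num by simp
    then have "cmod ?num / cmod (jac w) \<le> \<kappa> * cmod ?den / cmod (jac w)" by (intro divide_right_mono) auto
    then show "D_z n z \<noteq> 0 \<and>
        cmod (D_zbar n z) \<le> \<kappa> * cmod (D_z n z)"
      using d0 jac_lower(2)[OF w] unfolding w_def[symmetric] co_z_def co_zbar_def norm_divide
      by (simp only: times_divide_eq_right) simp
  qed
qed

end

section \<open>The extension of the circle map\<close>

lemma winding_number_homotopy:
  fixes K :: "real \<times> real \<Rightarrow> complex"
  assumes "continuous_on ({0..1} \<times> {0..1}) K"
    and "\<And>s t. s \<in> {0..1} \<Longrightarrow> t \<in> {0..1} \<Longrightarrow> K (s, t) \<noteq> 0"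
    and "\<And>s. s \<in> {0..1} \<Longrightarrow> K (s, 0) = K (s, 1)"
  shows "winding_number (\<lambda>t. K (0, t)) 0 = winding_number (\<lambda>t. K (1, t)) 0"
proof (rule winding_number_homotopic_loops)
  show "homotopic_loops (- {0}) (\<lambda>t. K (0, t)) (\<lambda>t. K (1, t))"
    unfolding homotopic_loops
    by (rule exI[of _ K]) (use assms in \<open>auto simp: pathfinish_def pathstart_def\<close>)
qed

text \<open>Near 0 the distance from \<open>f x\<close> to \<open>x\<close> is at most half of
  \<open>cmod x\<close>, so the segment between them misses 0. This permits linear homotopies of
  small loops.\<close>

lemma tangent_to_identity:
  fixes f :: "complex \<Rightarrow> complex"
  assumes "(f has_field_derivative 1) (at 0)" "f 0 = 0"
  obtains d where "d > 0" "\<And>x s. cmod x < d \<Longrightarrow> x \<noteq> 0 \<Longrightarrow> s \<in> {0..1} \<Longrightarrow> (1 - of_real s) * f x + of_real s * x \<noteq> 0"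
proof -
  have "\<forall>e>0. \<exists>d>0. \<forall>y. norm (y - 0) < d \<longrightarrow> norm (f y - f 0 - 1 * (y - 0)) \<le> e * norm (y - 0)"
    using assms(1) unfolding has_field_derivative_def has_derivative_at_alt by blast
  then obtain d where d: "d > 0" "\<And>y. cmod y < d \<Longrightarrow> cmod (f y - y) \<le> 1/2 * cmod y"
    using assms(2) by (metis diff_zero half_gt_zero zero_less_one mult_1)
  show ?thesis
  proof (rule that[OF d(1)])
    fix x :: complex and s :: real assume x: "cmod x < d" "x \<noteq> 0" "s \<in> {0..1}"
    show "(1 - of_real s) * f x + of_real s * x \<noteq> 0"
    proof
      assume "(1 - of_real s) * f x + of_real s * x = 0"
      then have "x = - ((1 - of_real s) * (f x - x))" by (simp add: algebra_simps add_eq_0_iff)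
      then have "cmod x = \<bar>1 - s\<bar> * cmod (f x - x)"
        by (metis norm_minus_cancel norm_mult norm_of_real of_real_1 of_real_diff)
      also have "\<dots> \<le> 1 * (1/2 * cmod x)" using d(2)[OF x(1)] x(3) by (intro mult_mono) auto
      finally show False using x(2) by simp
    qed
  qed
qed

context uaa_lift begin

text \<open>Another logarithm of \<open>w\<close> would give the same value, because
  \<open>E 1\<close> turns integer translations into integer translations. Thus \<open>g\<close> is
  continuous across the slit of \<open>Ln\<close>.\<close>

definition g :: "complex \<Rightarrow> complex" where "g w = cproj (E 1 (clog 0 w))"

lemma g_cproj: "g (cproj z) = cproj (E 1 z)"
proof -
  have "cproj (clog 0 (cproj z)) = cproj z" by (rule cproj_clog) simp
  then obtain j :: int where "clog 0 (cproj z) = z + of_int j" using cproj_eq_iff by blast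
  then show ?thesis unfolding g_def using E_shift_int[of 1 z j] by (simp add: cproj_add del: of_int_mult of_int_power)
qed

lemma g_funpow: "(g ^^ n) (cproj z) = cproj (E n z)"
proof (induction n)
  case (Suc n)
  then show ?case using g_cproj[of "E n z"] by (simp add: E_E)
qed simp

lemma g_local: "w \<noteq> 0 \<Longrightarrow> g w = cproj (E 1 (clog z0 w))"
  by (metis cproj_clog g_cproj)

lemma g_nonzero [simp]: "g w \<noteq> 0" by (simp add: g_def)

lemma E_clog_cont: "continuous_on (clog_dom z0) (\<lambda>w. E n (clog z0 w))"
  by (rule continuous_on_compose2[OF E_cont continuous_clog]) auto

lemma E_clog_isCont: "isCont (\<lambda>w. E n (clog z w)) (cproj z)"
  using E_clog_cont continuous_on_eq_continuous_at[OF open_clog_dom] cproj_in_clog_dom by blast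

lemma D_clog_cont: "continuous_on (clog_dom z0) (\<lambda>w. D n (clog z0 w))"
  by (rule continuous_on_compose2[OF D_cont continuous_clog]) auto

lemma g_isCont: assumes "w \<noteq> 0" shows "isCont g w"
proof -
  obtain z where z: "w = cproj z" using cproj_surj assms by blast
  have "continuous_on (clog_dom z) (\<lambda>w. cproj (E 1 (clog z w)))"
    by (rule continuous_on_compose2[OF cproj_cont E_clog_cont subset_UNIV])
  then have "continuous_on (clog_dom z) g"
    by (rule continuous_on_eq) (use g_local clog_dom_nonzero in auto)
  then show ?thesis using z continuous_on_eq_continuous_at[OF open_clog_dom] cproj_in_clog_dom by blast
qed

lemma g_locally_inj:
  assumes "w \<noteq> 0" obtains d where "d > 0" "inj_on g (ball w d)" "0 \<notin> ball w d"
proof -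
  obtain z where z: "w = cproj z" using cproj_surj assms by blast
  have "isCont (\<lambda>w. E 1 (clog z w)) w"
    unfolding z by (rule E_clog_isCont)
  then obtain d1 where d1: "d1 > 0" "\<And>v. dist v w < d1 \<Longrightarrow> dist (E 1 (clog z v)) (E 1 (clog z w)) < 1/2"
    unfolding continuous_at_eps_delta by (metis half_gt_zero zero_less_one)
  define d where "d = min d1 (cmod w)"
  have nz: "v \<noteq> 0" if "v \<in> ball w d" for v using that by (auto simp: d_def)
  have "inj_on g (ball w d)"
  proof (rule inj_onI)
    fix u v assume uv: "u \<in> ball w d" "v \<in> ball w d" "g u = g v"
    have "dist (E 1 (clog z u)) (E 1 (clog z v)) < 1"
      using d1(2)[of u] d1(2)[of v] uv
        dist_triangle_half_l[of "E 1 (clog z u)" "E 1 (clog z w)" 1 "E 1 (clog z v)"]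
      by (auto simp: d_def dist_commute)
    then have "\<bar>Re (E 1 (clog z u)) - Re (E 1 (clog z v))\<bar> < 1"
      using abs_Re_le_cmod[of "E 1 (clog z u) - E 1 (clog z v)"] by (simp add: dist_norm)
    moreover have "cproj (E 1 (clog z u)) = cproj (E 1 (clog z v))"
      using uv nz g_local by metis
    ultimately have "E 1 (clog z u) = E 1 (clog z v)" using cproj_eqD by blast
    then have "clog z u = clog z v" using E_inj by (meson injD)
    then show "u = v" using cproj_clog nz uv by metis
  qed
  then show ?thesis using that[of d] d1 assms nz by (auto simp: d_def)
qed

lemma g_reflection: assumes "w \<noteq> 0" shows "g (1 / cnj w) = 1 / cnj (g w)"
proof -
  obtain z where z: "w = cproj z" using cproj_surj assms by blast
  show ?thesis unfolding z cproj_cnj[symmetric] g_cproj E_cnj ..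
qed

lemma g_circle: "g (circle_proj x) = circle_proj (F x)"
  using g_cproj[of "of_real x"] E_of_real[of 1 x] by (simp add: cproj_of_real)

text \<open>A small loop around \<open>w\<close> is transported to the real line, where \<open>E 1\<close> preserves the sign of the
  imaginary part and hence is linearly homotopic to a rotation.\<close>
lemma g_orientation:
  assumes "w \<noteq> 0"
  shows "\<forall>\<^sub>F \<rho> in at_right 0. winding_number (g \<circ> circlepath w \<rho>) (g w) = 1"
proof -
  obtain z where z: "w = cproj z" using cproj_surj assms by blast
  obtain d1 where d1: "d1 > 0" "\<And>x s. cmod x < d1 \<Longrightarrow> x \<noteq> 0 \<Longrightarrow> s \<in> {0..1} \<Longrightarrow> (1 - of_real s) * (exp x - 1) + of_real s * x \<noteq> 0"
    by (rule tangent_to_identity[of "\<lambda>x. exp x - 1"]) (auto intro!: derivative_eq_intros)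
  obtain d2 where d2: "d2 > 0" "\<And>x s. cmod x < d2 \<Longrightarrow> x \<noteq> 0 \<Longrightarrow> s \<in> {0..1} \<Longrightarrow> (1 - of_real s) * Ln (1 + x) + of_real s * x \<noteq> 0"
    by (rule tangent_to_identity[of "\<lambda>x. Ln (1 + x)"]) (auto intro!: derivative_eq_intros)
  have "isCont (\<lambda>w. E 1 (clog z w)) w"
    unfolding z by (rule E_clog_isCont)
  moreover have "d1 / (2 * pi) > 0" using d1 by simp
  ultimately obtain d3 where d3: "d3 > 0" "\<And>v. dist v w < d3 \<Longrightarrow> dist (E 1 (clog z v)) (E 1 (clog z w)) < d1 / (2 * pi)"
    unfolding continuous_at_eps_delta by metis
  \<comment> \<open>In the coordinate \<open>x t\<close> below, the loop has radius
    \<open>\<rho> / cmod w\<close>: less than 1 keeps \<open>1 + x t\<close> off the slit of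
    \<open>Ln\<close>, less than \<open>d2\<close> allows \<open>Ln\<close> to be linearized.
    \<open>d3\<close> keeps the image small enough for linearizing \<open>exp\<close>.\<close>
  define d where "d = min d3 (cmod w * min 1 d2)"
  have d: "d > 0" using d3 d2 assms by (simp add: d_def)
  have "winding_number (g \<circ> circlepath w \<rho>) (g w) = 1" if \<rho>: "0 < \<rho>" "\<rho> < d" for \<rho>
  proof -
    define e :: "real \<Rightarrow> complex" where "e t = exp (2 * of_real pi * \<i> * of_real t)" for t
    have e: "cmod (e t) = 1" "e t \<noteq> 0" for t by (auto simp: e_def norm_exp_eq_Re)
    have e01: "e 0 = 1" "e 1 = 1" by (auto simp: e_def)
    have e_cont: "continuous_on S e" for S unfolding e_def[abs_def] by (intro continuous_intros)
    define x where "x t = of_real \<rho> * e t / w" for t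
    have x: "cmod (x t) < 1" "cmod (x t) < d2" "x t \<noteq> 0" for t
    proof -
      have "\<rho> < cmod w * 1" "\<rho> < cmod w * d2"
      proof -
        have "\<rho> < cmod w * min 1 d2" using \<rho> by (simp add: d_def)
        moreover have "cmod w * min 1 d2 \<le> cmod w * 1" "cmod w * min 1 d2 \<le> cmod w * d2"
          by (intro mult_left_mono; simp)+
        ultimately show "\<rho> < cmod w * 1" "\<rho> < cmod w * d2" by linarith+
      qed
      then show "cmod (x t) < 1" "cmod (x t) < d2" "x t \<noteq> 0"
        using e \<rho> assms by (auto simp: x_def norm_mult norm_divide field_simps)
    qed
    have x01: "x 0 = x 1" by (simp add: x_def e01)
    have x_cont: "continuous_on S x" for S
      unfolding x_def[abs_def] using assms by (intro continuous_intros e_cont) auto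
    have Ln_dom: "1 + x t \<notin> \<real>\<^sub>\<le>\<^sub>0" for t
    proof -
      have "\<bar>Re (x t)\<bar> < 1" using x(1)[of t] abs_Re_le_cmod[of "x t"] by linarith
      then show ?thesis by (auto simp: complex_nonpos_Reals_iff)
    qed
    define c where "c = 2 * of_real pi * \<i>"
    have c0: "c \<noteq> 0" by (simp add: c_def)
    define l where "l t = Ln (1 + x t) / c" for t
    have l_cont: "continuous_on S l" for S
      unfolding l_def[abs_def] using c0 Ln_dom by (intro continuous_intros x_cont) auto
    define w' where "w' t = w + of_real \<rho> * e t" for t
    have w': "w' t = w * (1 + x t)" for t using assms by (simp add: w'_def x_def distrib_left)
    have w'0: "w' t \<noteq> 0" for t using Ln_dom[of t] assms by (auto simp: w')
    have clog: "clog z (w' t) = z + l t" for t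
      using assms by (simp add: clog_def w' z[symmetric] l_def c_def)
    define \<delta> where "\<delta> t = c * (E 1 (z + l t) - E 1 z)" for t
    have E1_cont: "continuous_on S (E 1)" for S using continuous_on_subset[OF E_cont] by blast
    have \<delta>_cont: "continuous_on S \<delta>" for S unfolding \<delta>_def[abs_def]
      by (intro continuous_intros continuous_on_compose2[OF E_cont] l_cont) auto
    have \<delta>d: "cmod (\<delta> t) < d1" for t
    proof -
      have "dist (w' t) w < d3" using \<rho> e(1)[of t] by (simp add: w'_def dist_norm norm_mult d_def)
      then have "cmod (E 1 (z + l t) - E 1 z) < d1 / (2 * pi)"
        using d3(2)[of "w' t"] clog[of t] z by (simp add: dist_norm)
      moreover have "cmod (\<delta> t) = 2 * pi * cmod (E 1 (z + l t) - E 1 z)"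
        unfolding \<delta>_def c_def norm_mult by simp
      ultimately show ?thesis by (simp add: pos_less_divide_eq mult.commute)
    qed
    have l0: "(1 - of_real s) * l t + of_real s * (x t / c) \<noteq> 0" if "s \<in> {0..1}" for s t
    proof -
      have "(1 - of_real s) * Ln (1 + x t) + of_real s * x t \<noteq> 0" using d2(2) x that by blast
      moreover have "(1 - of_real s) * Ln (1 + x t) + of_real s * x t = c * ((1 - of_real s) * l t + of_real s * (x t / c))"
        using c0 by (simp add: l_def field_simps)
      ultimately show ?thesis by auto
    qed
    have \<delta>0: "\<delta> t \<noteq> 0" for t
      using l0[of 0 t] c0 injD[OF E_inj, of 1 "z + l t" z] by (auto simp: \<delta>_def)
    have gw: "g (w' t) - g w = cproj (E 1 z) * (exp (\<delta> t) - 1)" for t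
    proof -
      have "g (w' t) = cproj (E 1 (z + l t))" using g_local[OF w'0] clog by metis
      also have "\<dots> = cproj (E 1 z + (E 1 (z + l t) - E 1 z))" by simp
      also have "\<dots> = cproj (E 1 z) * exp (\<delta> t)" unfolding cproj_add by (simp add: cproj_def \<delta>_def c_def)
      finally show ?thesis unfolding z g_cproj by (simp add: algebra_simps)
    qed
    have "winding_number (g \<circ> circlepath w \<rho>) (g w) = winding_number (\<lambda>t. g (w' t) - g w) 0"
      by (subst winding_number_offset) (simp add: circlepath w'_def e_def)
    \<comment> \<open>Linearizes \<open>exp\<close> and contracts the constant factor
      \<open>cproj (E 1 z)\<close> to 1.\<close>
    also have "\<dots> = winding_number \<delta> 0"
    proof -
      let ?K = "\<lambda>p. exp ((1 - of_real (fst p)) * (c * E 1 z)) *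
          ((1 - of_real (fst p)) * (exp (\<delta> (snd p)) - 1) + of_real (fst p) * \<delta> (snd p))"
      have "winding_number (\<lambda>t. ?K (0, t)) 0 = winding_number (\<lambda>t. ?K (1, t)) 0"
      proof (rule winding_number_homotopy)
        show "continuous_on ({0..1} \<times> {0..1}) ?K"
          by (intro continuous_intros continuous_on_compose2[OF \<delta>_cont[of UNIV]]) auto
        show "?K (s, t) \<noteq> 0" if "s \<in> {0..1}" for s t using d1(2)[OF \<delta>d \<delta>0 that] by simp
        show "?K (s, 0) = ?K (s, 1)" for s by (simp add: \<delta>_def l_def x01)
      qed
      then show ?thesis by (simp add: gw cproj_def c_def)
    qed
    \<comment> \<open>Moves the base point vertically to the real axis while linearizing
      \<open>Ln\<close>; injectivity of \<open>E 1\<close> keeps the loop off 0 throughout.\<close>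
    also have "\<dots> = winding_number (\<lambda>t. c * (E 1 (of_real (Re z) + x t / c) - E 1 (of_real (Re z)))) 0"
    proof -
      let ?z = "\<lambda>s. z - of_real s * (\<i> * of_real (Im z))"
      let ?K = "\<lambda>p. c * (E 1 (?z (fst p) + ((1 - of_real (fst p)) * l (snd p) + of_real (fst p) * (x (snd p) / c))) - E 1 (?z (fst p)))"
      have "winding_number (\<lambda>t. ?K (0, t)) 0 = winding_number (\<lambda>t. ?K (1, t)) 0"
      proof (rule winding_number_homotopy)
        show "continuous_on ({0..1} \<times> {0..1}) ?K"
          by (intro continuous_intros continuous_on_compose2[OF E1_cont[of UNIV]]
              continuous_on_compose2[OF l_cont[of UNIV]] continuous_on_compose2[OF x_cont[of UNIV]]) (use c0 in auto)
        show "?K (s, t) \<noteq> 0" if "s \<in> {0..1}" for s t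
          using l0[OF that, of t] c0 injD[OF E_inj, of 1 "?z s + ((1 - of_real s) * l t + of_real s * (x t / c))" "?z s"] by auto
        show "?K (s, 0) = ?K (s, 1)" for s by (simp add: l_def x01)
      qed
      moreover have "z - \<i> * of_real (Im z) = of_real (Re z)" by (simp add: complex_eq_iff)
      ultimately show ?thesis by (simp add: \<delta>_def[abs_def])
    qed
    also have "\<dots> = winding_number (\<lambda>t. x t) 0"
    proof -
      let ?a = "Re z"
      let ?K = "\<lambda>p. (1 - of_real (fst p)) * (c * (E 1 (of_real ?a + x (snd p) / c) - E 1 (of_real ?a))) + of_real (fst p) * x (snd p)"
      have "winding_number (\<lambda>t. ?K (0, t)) 0 = winding_number (\<lambda>t. ?K (1, t)) 0"
      proof (rule winding_number_homotopy)
        show "continuous_on ({0..1} \<times> {0..1}) ?K"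
          by (intro continuous_intros continuous_on_compose2[OF E1_cont[of UNIV]]
              continuous_on_compose2[OF x_cont[of UNIV]]) (use c0 in auto)
        show "?K (s, 0) = ?K (s, 1)" for s by (simp add: x01)
        fix s t :: real assume s: "s \<in> {0..1}" 
        define y where "y = x t / c"
        have y: "y \<noteq> 0" "x t = c * y" using x(3) c0 by (auto simp: y_def)
        define q where "q = E 1 (of_real ?a + y) - E 1 (of_real ?a)"
        have Im: "Im (E 1 (of_real ?a)) = 0" using Im_E(3)[of 1 "of_real ?a"] by simp
        have "(1 - of_real s) * q + of_real s * y \<noteq> 0"
        proof
          assume "(1 - of_real s) * q + of_real s * y = 0"
          then have re: "(1 - s) * Re q + s * Re y = 0" and im: "(1 - s) * Im q + s * Im y = 0"
            by (auto simp: complex_eq_iff)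
          have pos: "(1 - s) * u + s * v > 0" if "u > 0" "v > 0" for u v :: real
            using s that by (cases "s = 0") (auto intro!: add_nonneg_pos)
          consider "Im y > 0" | "Im y < 0" | "Im y = 0" by linarith
          then show False
          proof cases
            case 1
            then have "Im q > 0" using Im_E(1)[of 1 "of_real ?a + y"] Im by (simp add: q_def)
            with pos[OF this 1] im show False by simp
          next
            case 2
            then have "Im q < 0" using Im_E(2)[of 1 "of_real ?a + y"] Im by (simp add: q_def)
            with pos[of "- Im q" "- Im y"] 2 im show False by simp
          next
            case 3
            then have yr: "y = of_real (Re y)" "Re y \<noteq> 0" using y by (auto simp: complex_eq_iff)
            have "of_real ?a + y = of_real (?a + Re y)" by (subst yr(1)) simp
            then have q: "Re q = F (?a + Re y) - F ?a"
              unfolding q_def by (simp only: E_of_real) simp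
            show False
            proof (cases "Re y > 0")
              case True
              then have "Re q > 0" using q mono by (auto simp: strict_mono_def)
              with pos[OF this True] re show False by simp
            next
              case False
              then have "Re q < 0" using q mono yr(2) by (auto simp: strict_mono_def)
              with pos[of "- Re q" "- Re y"] False yr(2) re show False by simp
            qed
          qed
        qed
        then have "c * ((1 - of_real s) * q + of_real s * y) \<noteq> 0" using c0 by simp
        then show "?K (s, t) \<noteq> 0" using y(2) c0 unfolding q_def by (simp add: algebra_simps)
      qed
      then show ?thesis by simp
    qed
    \<comment> \<open>The nonzero factor \<open>\<rho> / w\<close> is contracted to 1 through its
      logarithm.\<close>
    also have "\<dots> = winding_number (circlepath 0 1) 0"
    proof -
      define b where "b = Ln (of_real \<rho> / w)"
      have b: "exp b = of_real \<rho> / w" unfolding b_def using assms \<rho> by (intro exp_Ln) auto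
      let ?K = "\<lambda>p. exp ((1 - of_real (fst p)) * b) * e (snd p)"
      have "winding_number (\<lambda>t. ?K (0, t)) 0 = winding_number (\<lambda>t. ?K (1, t)) 0"
      proof (rule winding_number_homotopy)
        show "continuous_on ({0..1} \<times> {0..1}) ?K"
          by (intro continuous_intros continuous_on_compose2[OF e_cont[of UNIV]]) auto
      qed (use e e01 in auto)
      moreover have "(\<lambda>t. exp b * e t) = x" by (auto simp: b x_def)
      moreover have "(\<lambda>t. e t) = circlepath 0 1" by (auto simp: circlepath e_def)
      ultimately show ?thesis by simp
    qed
    finally show ?thesis by (simp add: winding_number_circlepath)
  qed
  then show ?thesis unfolding eventually_at_right_field using d by blast
qed

end

section \<open>Inverse branches: local form, dilatation and continuation\<close>

context uaa_lift begin

lemma G_strip: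
  assumes "\<eta> > 0"
  obtains \<tau> where "\<tau> > 0" "\<And>z. \<bar>Im z\<bar> < \<tau> \<Longrightarrow> \<bar>Im (G z)\<bar> < \<eta>"
proof -
  have "uniformly_continuous_on (cbox (Complex 0 (-1)) (Complex 1 1)) G"
    by (intro compact_uniformly_continuous continuous_on_subset[OF G_cont]) auto
  then obtain d where d: "d > 0" "\<And>s t. s \<in> cbox (Complex 0 (-1)) (Complex 1 1) \<Longrightarrow>
      t \<in> cbox (Complex 0 (-1)) (Complex 1 1) \<Longrightarrow> dist s t < d \<Longrightarrow> dist (G s) (G t) < \<eta>"
    using assms unfolding uniformly_continuous_on_def by metis
  show ?thesis
  proof (rule that[of "min 1 d"])
    fix z assume z: "\<bar>Im z\<bar> < min 1 d"
    define w where "w = z - of_int \<lfloor>Re z\<rfloor>"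
    have Re: "0 \<le> Re w" "Re w \<le> 1" unfolding w_def by (simp_all) linarith
    have Im: "Im w = Im z" by (simp add: w_def)
    have "w - of_real (Re w) = \<i> * of_real (Im w)" by (simp add: complex_eq_iff)
    then have "dist w (of_real (Re w)) < d" using z Im by (simp add: dist_norm norm_mult)
    then have "dist (G w) (G (of_real (Re w))) < \<eta>"
      using Re Im z by (intro d(2)) (auto simp: in_cbox_complex_iff)
    then have "\<bar>Im (G w)\<bar> < \<eta>"
      using abs_Im_le_cmod[of "G w - G (of_real (Re w))"] Im_G(3)[of "of_real (Re w)"] by (simp add: dist_norm)
    moreover have "G z = G w + of_int \<lfloor>Re z\<rfloor>" using G_shift_int[of w "\<lfloor>Re z\<rfloor>"] by (simp add: w_def)
    ultimately show "\<bar>Im (G z)\<bar> < \<eta>" by simp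
  qed (use d in auto)
qed

text \<open>Uniform in \<open>n\<close> because division by \<open>m ^ n\<close> only narrows
  strips. It keeps all intermediate preimages of a branch in the annulus where the system
  acts.\<close>

lemma D_strip:
  assumes "\<eta> > 0"
  obtains \<tau> where "\<tau> > 0" "\<And>n z. \<bar>Im z\<bar> < \<tau> \<Longrightarrow> \<bar>Im (D n z)\<bar> < \<eta>"
proof -
  obtain \<eta>' where \<eta>': "\<eta>' > 0" "\<And>x y. \<bar>y\<bar> < \<eta>' \<Longrightarrow> h (x + \<bar>y\<bar>) - h (x - \<bar>y\<bar>) \<le> \<eta> / 2"
    using h_unif[of "\<eta> / 2"] assms by auto
  obtain \<tau> where \<tau>: "\<tau> > 0" "\<And>z. \<bar>Im z\<bar> < \<tau> \<Longrightarrow> \<bar>Im (G z)\<bar> < \<eta>'" using G_strip[OF \<eta>'(1)] by blast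
  show ?thesis
  proof (rule that[OF \<tau>(1)])
    fix n z assume "\<bar>Im z\<bar> < \<tau>"
    then have z: "\<bar>Im (G z)\<bar> < \<eta>'" by (rule \<tau>(2))
    define w where "w = of_real (1 / real m ^ n) * G z"
    have "real m ^ n \<ge> 1" "m > 0" using m by auto
    then have "\<bar>Im (G z)\<bar> / real m ^ n \<le> \<bar>Im (G z)\<bar> / 1" by (intro divide_left_mono) auto
    moreover have "\<bar>Im w\<bar> = \<bar>Im (G z)\<bar> / real m ^ n" using m unfolding w_def by simp
    ultimately have "\<bar>Im w\<bar> < \<eta>'" using z by simp
    from \<eta>'(2)[OF this, of "Re w"] Im_H_le[of w] show "\<bar>Im (D n z)\<bar> < \<eta>"
      using assms unfolding D_def w_def[symmetric] by linarith
  qed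
qed

text \<open>A logarithm \<open>a0\<close> of \<open>b w0\<close> determines
  \<open>z0 = E n a0\<close>, and continuity together with \<open>clog_unique\<close> identifies the
  branch near \<open>w0\<close>. So the dilatation of a branch can be estimated without knowing the
  path along which it was continued.\<close>

lemma inverse_branch_local_form:
  assumes n: "n > 0" and h: "inverse_branch_at (annulus r) g n w0 b" and r: "r > 0"
  obtains z0 where "cproj z0 = w0" "\<forall>\<^sub>F w in nhds w0. b w = cproj (D n (clog z0 w))"
proof -
  obtain V where V: "open V" "w0 \<in> V" "continuous_on V b" "b ` V \<subseteq> iterate_domain (annulus r) g n"
    "\<And>w. w \<in> V \<Longrightarrow> (g ^^ n) (b w) = w"
    using h unfolding inverse_branch_at_def by auto
  \<comment> \<open>Here \<open>n > 0\<close> matters: membership in \<open>iterate_domain\<close>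
    places the point itself in the annulus only through \<open>k = 0 < n\<close>.\<close>
  have nz: "b w \<noteq> 0" if "w \<in> V" for w
  proof -
    have "(g ^^ 0) (b w) \<in> annulus r" using V(4) that n unfolding iterate_domain_def by blast
    then show ?thesis using r by (auto simp: annulus_def)
  qed
  obtain a0 where a0: "b w0 = cproj a0" using cproj_surj nz[OF V(2)] by blast
  define z0 where "z0 = E n a0"
  have z0: "cproj z0 = w0" using V(5)[OF V(2)] g_funpow[of n a0] by (simp add: z0_def a0)
  have cb: "isCont b w0" using V continuous_on_eq_continuous_at by blast
  have ev1: "\<forall>\<^sub>F w in nhds w0. b w \<in> clog_dom a0"
  proof (rule topological_tendstoD[OF _ open_clog_dom])
    show "(b \<longlongrightarrow> b w0) (nhds w0)" using cb unfolding isCont_def tendsto_at_iff_tendsto_nhds .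
  qed (simp add: a0)
  have "isCont (\<lambda>v. E n (clog a0 v)) (b w0)"
    unfolding a0 by (rule E_clog_isCont)
  then have "isCont (\<lambda>w. E n (clog a0 (b w))) w0" by (rule isCont_o2[OF cb])
  then have "isCont (\<lambda>w. Re (E n (clog a0 (b w)))) w0" by (rule continuous_Re)
  then have "((\<lambda>w. Re (E n (clog a0 (b w)))) \<longlongrightarrow> Re (E n (clog a0 (b w0)))) (nhds w0)"
    using tendsto_at_iff_tendsto_nhds[of "\<lambda>w. Re (E n (clog a0 (b w)))" w0]
    unfolding isCont_def by blast
  then have "((\<lambda>w. Re (E n (clog a0 (b w)))) \<longlongrightarrow> Re z0) (nhds w0)"
    by (simp only: a0 z0_def clog_cproj)
  then have ev2: "\<forall>\<^sub>F w in nhds w0. dist (Re (E n (clog a0 (b w)))) (Re z0) < 3/4"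
    by (rule tendstoD) simp
  have ev3: "\<forall>\<^sub>F w in nhds w0. w \<in> V" using V eventually_nhds_in_open by blast
  have ev4: "\<forall>\<^sub>F w in nhds w0. w \<in> clog_dom z0"
    using eventually_nhds_in_open[OF open_clog_dom, of w0 z0] z0 cproj_in_clog_dom by metis
  have "\<forall>\<^sub>F w in nhds w0. b w = cproj (D n (clog z0 w))"
    using ev1 ev2 ev3 ev4
  proof eventually_elim
    case (elim w)
    have bw: "cproj (clog a0 (b w)) = b w" using cproj_clog nz elim by blast
    then have "cproj (E n (clog a0 (b w))) = w" using g_funpow[of n "clog a0 (b w)"] V(5) elim by metis
    then have "clog z0 w = E n (clog a0 (b w))"
      using elim by (intro clog_unique) (auto simp: dist_real_def)
    then show ?case using bw by simp
  qed
  then show ?thesis using that z0 by blast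
qed

lemma branch_dilatation:
  assumes "\<epsilon>0 > 0"
  obtains \<tau> where "\<tau> > 0" "\<And>n r w b. n > 0 \<Longrightarrow> r > 0 \<Longrightarrow> inverse_branch_at (annulus r) g n w b \<Longrightarrow>
    (\<And>z. w = cproj z \<Longrightarrow> Im z \<noteq> 0 \<and> \<bar>Im z\<bar> < \<tau>) \<Longrightarrow> dilatation b w < 1 + \<epsilon>0"
proof -
  \<comment> \<open>This makes \<open>(1 + \<kappa>) / (1 - \<kappa>)\<close> equal to
    \<open>1 + \<epsilon>0 / 2\<close>.\<close>
  define \<kappa> where "\<kappa> = \<epsilon>0 / (\<epsilon>0 + 4)"
  have \<kappa>: "\<kappa> > 0" using assms by (simp add: \<kappa>_def)
  have \<kappa>1: "\<kappa> < 1" "(1 + \<kappa>) / (1 - \<kappa>) < 1 + \<epsilon>0" using assms by (auto simp: \<kappa>_def field_simps intro!: add_pos_pos)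
  obtain \<eta> where \<eta>: "\<eta> > 0" "\<And>n z. n > 0 \<Longrightarrow> Im z \<noteq> 0 \<Longrightarrow> \<bar>Im (G z)\<bar> < \<eta> \<Longrightarrow>
    D_z n z \<noteq> 0 \<and>
    cmod (D_zbar n z) \<le> \<kappa> * cmod (D_z n z)"
    using D_beltrami[OF \<kappa>] by blast
  obtain \<tau> where \<tau>: "\<tau> > 0" "\<And>z. \<bar>Im z\<bar> < \<tau> \<Longrightarrow> \<bar>Im (G z)\<bar> < \<eta>" using G_strip[OF \<eta>(1)] by blast
  show ?thesis
  proof (rule that[OF \<tau>(1)])
    fix n :: nat and r w b assume n: "n > 0" and r: "(r::real) > 0" and b: "inverse_branch_at (annulus r) g n w b"
      and w: "\<And>z. w = cproj z \<Longrightarrow> Im z \<noteq> 0 \<and> \<bar>Im z\<bar> < \<tau>"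
    obtain z0 where z0: "cproj z0 = w" "\<forall>\<^sub>F w in nhds w. b w = cproj (D n (clog z0 w))"
      using inverse_branch_local_form[OF n b r] by blast
    have Im: "Im z0 \<noteq> 0" "\<bar>Im (G z0)\<bar> < \<eta>" using w[of z0] z0(1) \<tau>(2)[of z0] by auto
    define \<alpha> \<beta> where "\<alpha> = D_z n z0" and "\<beta> = D_zbar n z0"
    have ab: "\<alpha> \<noteq> 0" "cmod \<beta> \<le> \<kappa> * cmod \<alpha>" using \<eta>(2)[OF n Im] by (auto simp: \<alpha>_def \<beta>_def)
    define c d where "c = 2 * of_real pi * \<i> * cproj (D n z0)" and "d = 1 / (2 * of_real pi * \<i> * cproj z0)"
    have cd: "c \<noteq> 0" "d \<noteq> 0" by (auto simp: c_def d_def)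
    have "(b has_derivative (\<lambda>v. (c * \<alpha> * d) * v + (c * \<beta> * cnj d) * cnj v)) (at w)"
      using conjugated_has_derivative[OF D_has_derivative[OF Im(1), of n], of b] z0
      by (simp add: c_def d_def \<alpha>_def \<beta>_def)
    from derivatives_of_real_linear[OF this]
    have "cmod (beltrami b w) = cmod \<beta> / cmod \<alpha>"
      using cd unfolding beltrami_def by (simp add: norm_mult norm_divide)
    also have "\<dots> \<le> \<kappa>" using ab by (simp add: field_simps)
    finally have "dilatation b w \<le> (1 + \<kappa>) / (1 - \<kappa>)"
      unfolding dilatation_def using \<kappa> \<kappa>1 by (intro frac_le) auto
    then show "dilatation b w < 1 + \<epsilon>0" using \<kappa>1 by simp
  qed
qed

text \<open>The path is lifted to logarithmic coordinates as \<open>c\<close>, and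
  \<open>D n\<close> is defined everywhere there. The branch at time \<open>t\<close> is
  \<open>D n\<close> read through the logarithm centred at \<open>c t\<close>; nearby times use
  logarithms that agree where both are defined.\<close>

lemma branch_continuation:
  assumes f: "\<And>x. f (circle_proj x) = circle_proj (F x)"
    and r: "0 < r" "0 < r'"
    and strip: "\<And>n z. \<bar>Im z\<bar> < - ln r' / (2 * pi) \<Longrightarrow> \<bar>Im (D n z)\<bar> < - ln r / (2 * pi)"
    and \<gamma>: "path \<gamma>" "path_image \<gamma> \<subseteq> annulus r'"
    and b: "circle_inverse_branch_at f n (pathstart \<gamma>) b"
  shows "\<exists>B. continues_branch_along (annulus r) g n b \<gamma> B"
proof -
  obtain I where I: "openin (top_of_set (sphere 0 1)) I" "\<gamma> 0 \<in> I" "continuous_on I b" "b ` I \<subseteq> sphere 0 1"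
    "\<And>w. w \<in> I \<Longrightarrow> (f ^^ n) (b w) = w"
    using b unfolding circle_inverse_branch_at_def pathstart_def by auto
  have f_funpow: "(f ^^ n) (cproj (of_real x)) = cproj (of_real ((F ^^ n) x))" for n x
  proof (induction n)
    case (Suc n) then show ?case using f[of "(F ^^ n) x"] by (simp add: cproj_of_real)
  qed simp
  have f_eq: "(f ^^ n) u = (g ^^ n) u" if "u \<in> sphere 0 1" for u
  proof -
    obtain x where "u = cproj (of_real x)" using circle_cprojE \<open>u \<in> sphere 0 1\<close> by blast
    then show ?thesis using f_funpow[of n x] g_funpow[of n "of_real x"] E_of_real[of n x] by metis
  qed
  have \<gamma>c: "continuous_on {0..1} \<gamma>" using \<gamma> by (simp add: path_def)
  have \<gamma>A: "\<gamma> t \<in> annulus r'" if "t \<in> {0..1}" for t using \<gamma>(2) that by (auto simp: path_image_def)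
  have \<gamma>0: "\<gamma> t \<noteq> 0" if "t \<in> {0..1}" for t using \<gamma>A[OF that] r by (auto simp: annulus_def)
  obtain q where q: "continuous_on {0..1} q" "\<And>t. t \<in> {0..1} \<Longrightarrow> \<gamma> t = exp (q t)"
    using continuous_logarithm_on_contractible[OF \<gamma>c _ \<gamma>0] convex_imp_contractible[of "{0..1::real}"] by auto
  have "b (\<gamma> 0) \<noteq> 0" using I by fastforce
  then obtain a where a: "b (\<gamma> 0) = cproj a" using cproj_surj by blast
  have "cproj (E n a) = \<gamma> 0"
  proof -
    have "b (\<gamma> 0) \<in> sphere 0 1" using I(2,4) by blast
    then show ?thesis using g_funpow[of n a] f_eq[of "b (\<gamma> 0)"] I(5)[OF I(2)] a by metis
  qed
  moreover have "cproj (q 0 / (2 * of_real pi * \<i>)) = \<gamma> 0" using q(2)[of 0] by (simp add: cproj_def)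
  \<comment> \<open>The integer \<open>j\<close> selects the lift of the path that starts at
    \<open>E n a\<close>, so that the continued branch takes the value \<open>b (\<gamma> 0)\<close>
    at the start.\<close>
  ultimately obtain j :: int where j: "E n a = q 0 / (2 * of_real pi * \<i>) + of_int j"
    using cproj_eq_iff by metis
  define c where "c t = q t / (2 * of_real pi * \<i>) + of_int j" for t
  have c_cont: "continuous_on {0..1} c" unfolding c_def[abs_def] by (intro continuous_intros q) auto
  have c: "cproj (c t) = \<gamma> t" if "t \<in> {0..1}" for t
    using q(2)[OF that] unfolding c_def cproj_add cproj_int by (simp add: cproj_def)
  have c0: "c 0 = E n a" using j by (simp add: c_def)
  define B where "B t w = cproj (D n (clog (c t) w))" for t w
  have "inverse_branch_at (annulus r) g n (\<gamma> t) (B t)" if t: "t \<in> {0..1}" for t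
    unfolding inverse_branch_at_def
  proof (intro exI conjI)
    let ?V = "clog_dom (c t) \<inter> annulus r'"
    show "open ?V" using open_clog_dom open_annulus by auto
    show "\<gamma> t \<in> ?V" using \<gamma>A[OF t] cproj_in_clog_dom[of "c t"] c[OF t] by simp
    show "continuous_on ?V (B t)" unfolding B_def[abs_def]
      by (rule continuous_on_compose2[OF cproj_cont[of UNIV] continuous_on_subset[OF D_clog_cont]]) auto
    have Bk: "(g ^^ k) (B t w) = cproj (D (n - k) (clog (c t) w))" if "k \<le> n" for k w
      unfolding B_def g_funpow E_D_less[OF that] ..
    show "\<forall>w\<in>?V. (g ^^ n) (B t w) = w"
    proof
      fix w assume "w \<in> ?V"
      then have "w \<noteq> 0" using clog_dom_nonzero by blast
      then show "(g ^^ n) (B t w) = w" unfolding B_def g_funpow by (simp add: cproj_clog)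
    qed
    show "B t ` ?V \<subseteq> iterate_domain (annulus r) g n"
    proof (clarsimp simp: iterate_domain_def)
      fix w k assume w: "w \<in> clog_dom (c t)" "w \<in> annulus r'" and k: "k < n"
      have "cproj (clog (c t) w) = w" using cproj_clog clog_dom_nonzero w by blast
      then have "\<bar>Im (clog (c t) w)\<bar> < - ln r' / (2 * pi)" using annulus_cproj[OF r(2)] w(2) by metis
      then have "\<bar>Im (D (n - k) (clog (c t) w))\<bar> < - ln r / (2 * pi)" by (rule strip)
      then show "(g ^^ k) (B t w) \<in> annulus r" using Bk[of k w] k annulus_cproj[OF r(1)] by simp
    qed
  qed
  moreover have "\<forall>\<^sub>F s in at t within {0..1}. \<forall>\<^sub>F w in nhds (\<gamma> s). B s w = B t w" if t: "t \<in> {0..1}" for t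
  proof -
    have "(\<gamma> \<longlongrightarrow> \<gamma> t) (at t within {0..1})" using \<gamma>c t by (simp add: continuous_on)
    then have "\<forall>\<^sub>F s in at t within {0..1}. \<gamma> s \<in> clog_dom (c t)"
      by (rule topological_tendstoD[OF _ open_clog_dom]) (use c[OF t] cproj_in_clog_dom[of "c t"] in simp)
    moreover have "(c \<longlongrightarrow> c t) (at t within {0..1})" using c_cont t by (simp add: continuous_on)
    then have "\<forall>\<^sub>F s in at t within {0..1}. dist (c s) (c t) < 1/4" by (rule tendstoD) simp
    moreover have "\<forall>\<^sub>F s in at t within {0..1}. s \<in> {0..1}" by (simp add: eventually_at_filter)
    ultimately show ?thesis
    proof eventually_elim
      case (elim s)
      have "\<gamma> s \<in> clog_dom (c s)" using c[OF elim(3)] cproj_in_clog_dom by metis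
      then have "\<forall>\<^sub>F w in nhds (\<gamma> s). w \<in> clog_dom (c s) \<inter> clog_dom (c t)"
        using elim(1) by (intro eventually_nhds_in_open open_Int open_clog_dom) auto
      then show ?case
      proof eventually_elim
        fix w assume w: "w \<in> clog_dom (c s) \<inter> clog_dom (c t)"
        have "\<bar>Re (c s) - Re (c t)\<bar> < 1/4"
          using elim(2) abs_Re_le_cmod[of "c s - c t"] by (simp add: dist_norm)
        moreover have "\<bar>Re (clog (c s) w) - Re (c s)\<bar> < 1/4" using Re_clog w by blast
        ultimately have "\<bar>Re (clog (c s) w) - Re (c t)\<bar> < 3/4" by linarith
        then have "clog (c t) w = clog (c s) w"
          using w cproj_clog[of w "c s"] clog_dom_nonzero by (intro clog_unique) auto
        then show "B s w = B t w" by (simp add: B_def)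
      qed
    qed
  qed
  moreover have "\<forall>\<^sub>F w in nhds (\<gamma> 0). w \<in> sphere 0 1 \<longrightarrow> B 0 w = b w"
  proof -
    have g0: "cproj (c 0) = \<gamma> 0" by (rule c) simp
    obtain T where T: "open T" "I = sphere 0 1 \<inter> T" using I(1) by (auto simp: openin_open)
    have bt: "(b \<longlongrightarrow> b (\<gamma> 0)) (at (\<gamma> 0) within I)" using I by (simp add: continuous_on)
    then have "\<forall>\<^sub>F w in at (\<gamma> 0) within I. b w \<in> clog_dom a"
      by (rule topological_tendstoD[OF _ open_clog_dom]) (simp add: a)
    moreover have "isCont (\<lambda>v. E n (clog a v)) (b (\<gamma> 0))"
      unfolding a by (rule E_clog_isCont)
    then have "((\<lambda>w. E n (clog a (b w))) \<longlongrightarrow> E n (clog a (b (\<gamma> 0)))) (at (\<gamma> 0) within I)"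
      by (rule isCont_tendsto_compose) (rule bt)
    then have "\<forall>\<^sub>F w in at (\<gamma> 0) within I. dist (E n (clog a (b w))) (c 0) < 3/4"
      by (intro tendstoD) (auto simp: a c0)
    ultimately have "\<forall>\<^sub>F w in at (\<gamma> 0) within I. b w \<in> clog_dom a \<and> dist (E n (clog a (b w))) (c 0) < 3/4"
      by (rule eventually_conj)
    then have "\<forall>\<^sub>F w in nhds (\<gamma> 0). w \<in> I \<longrightarrow> b w \<in> clog_dom a \<and> dist (E n (clog a (b w))) (c 0) < 3/4"
      unfolding eventually_at_filter by eventually_elim (use a c0 in auto)
    moreover have "\<forall>\<^sub>F w in nhds (\<gamma> 0). w \<in> T" using T I(2) by (intro eventually_nhds_in_open) auto
    moreover have "\<forall>\<^sub>F w in nhds (\<gamma> 0). w \<in> clog_dom (c 0)"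
      using g0 cproj_in_clog_dom[of "c 0"] by (intro eventually_nhds_in_open open_clog_dom) simp
    ultimately show ?thesis
    proof eventually_elim
      case (elim w)
      show ?case
      proof
        assume "w \<in> sphere 0 1"
        then have wI: "w \<in> I" using elim(2) T by auto
        have nz: "b w \<noteq> 0" and bs: "b w \<in> sphere 0 1" using I(4) wI by auto
        have "\<bar>Re (E n (clog a (b w))) - Re (c 0)\<bar> < 3/4"
          using elim(1) wI abs_Re_le_cmod[of "E n (clog a (b w)) - c 0"] by (simp add: dist_norm)
        moreover have "cproj (E n (clog a (b w))) = w"
          using g_funpow[of n "clog a (b w)"] cproj_clog[OF nz] f_eq[OF bs] I(5)[OF wI] by metis
        ultimately have "clog (c 0) w = E n (clog a (b w))" using elim(3) by (intro clog_unique) auto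
        then show "B 0 w = b w" using cproj_clog[OF nz] by (simp add: B_def)
      qed
    qed
  qed
  ultimately have "continues_branch_along (annulus r) g n b \<gamma> B"
    unfolding continues_branch_along_def by blast
  then show ?thesis by blast
qed

end

section \<open>Absolute continuity on lines and local quasiconformality\<close>

lemma abs_ln_lower:
  assumes "1 / 2 < t" "t < (2::real)"
  shows "\<bar>t\<^sup>2 - 1\<bar> / 6 \<le> \<bar>ln t\<bar>"
proof -
  have "\<bar>t - 1\<bar> / 2 \<le> \<bar>ln t\<bar>"
  proof (cases "t \<ge> 1")
    case True
    have "ln (1 / t) \<le> 1 / t - 1" using assms by (intro ln_le_minus_one) auto
    then have "1 - 1 / t \<le> ln t" using assms by (simp add: ln_div)
    moreover have "(t - 1) / 2 \<le> (t - 1) / t" using assms True by (intro divide_left_mono) auto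
    ultimately show ?thesis using assms True by (simp add: diff_divide_distrib)
  next
    case False
    have "ln t \<le> t - 1" using assms by (intro ln_le_minus_one) auto
    then show ?thesis using False by simp
  qed
  moreover have "\<bar>t\<^sup>2 - 1\<bar> \<le> 3 * \<bar>t - 1\<bar>"
  proof -
    have "t\<^sup>2 - 1 = (t + 1) * (t - 1)" by (simp add: power2_eq_square algebra_simps)
    then have "\<bar>t\<^sup>2 - 1\<bar> = (t + 1) * \<bar>t - 1\<bar>" using assms by (simp add: abs_mult)
    also have "\<dots> \<le> 3 * \<bar>t - 1\<bar>" using assms by (intro mult_right_mono) auto
    finally show ?thesis .
  qed
  ultimately show ?thesis by (simp add: field_simps)
qed

text \<open>The zeros of the quadratic are \<open>2 * \<sigma>\<close> apart, so at every
  \<open>t\<close> one of its two linear factors has modulus at least \<sigma> and can be replaced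
  by \<sigma>.\<close>

lemma inverse_sqrt_quadratic_bound:
  assumes \<sigma>: "\<sigma> > 0" and t: "t \<noteq> \<sigma>" "t \<noteq> - \<sigma>"
  shows "1 / sqrt \<bar>t\<^sup>2 - \<sigma>\<^sup>2\<bar> \<le> 1 / sqrt \<sigma> * (1 / sqrt \<bar>t - \<sigma>\<bar> + 1 / sqrt \<bar>t - (- \<sigma>)\<bar>)"
proof -
  have e: "sqrt \<bar>t\<^sup>2 - \<sigma>\<^sup>2\<bar> = sqrt \<bar>t - \<sigma>\<bar> * sqrt \<bar>t - (- \<sigma>)\<bar>"
    by (simp add: real_sqrt_mult[symmetric] abs_mult[symmetric] power2_eq_square algebra_simps)
  have pos: "sqrt \<bar>t - \<sigma>\<bar> > 0" "sqrt \<bar>t - (- \<sigma>)\<bar> > 0" "sqrt \<sigma> > 0" using \<sigma> t by auto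
  have "1 / (A * B) \<le> 1 / s * (1 / A + 1 / B)" if "A > 0" "B > 0" "s > 0" "s \<le> A \<or> s \<le> B" for A B s :: real
    using that by (auto simp: field_simps add_increasing add_increasing2)
  moreover have "sqrt \<sigma> \<le> sqrt \<bar>t - \<sigma>\<bar> \<or> sqrt \<sigma> \<le> sqrt \<bar>t - (- \<sigma>)\<bar>" using \<sigma> by (auto simp: abs_if)
  ultimately show ?thesis unfolding e using pos by blast
qed

context uaa_lift begin

lemma g_has_derivative:
  assumes "Im z \<noteq> 0"
  defines "c \<equiv> 2 * of_real pi * \<i> * g (cproj z)" and "d \<equiv> 1 / (2 * of_real pi * \<i> * cproj z)"
  shows "(g has_derivative (\<lambda>v. (c * E_z z * d) * v + (c * E_zbar z * cnj d) * cnj v)) (at (cproj z))"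
proof -
  have "\<forall>\<^sub>F w in nhds (cproj z). w \<in> - {0}" by (intro eventually_nhds_in_open) auto
  then have "\<forall>\<^sub>F w in nhds (cproj z). g w = cproj (E 1 (clog z w))"
    by eventually_elim (use g_local in auto)
  from conjugated_has_derivative[OF E1_has_derivative[OF assms(1)] this] show ?thesis
    unfolding c_def d_def g_cproj .
qed

text \<open>\<open>abs_ln_lower\<close> replaces the height \<open>\<bar>Im z\<bar>\<close> of the
  logarithmic coordinate by \<open>\<bar>(cmod w)\<^sup>2 - 1\<bar>\<close>, the modulus of a
  quadratic polynomial along every horizontal or vertical line. Its constant 6 times
  \<open>2 * pi\<close> gives the \<open>12 * pi\<close> in \<open>A\<close>.\<close>

lemma g_derivative_bound:
  obtains C where "C > 0" "\<And>w. w \<in> annulus (1/2) \<Longrightarrow> cmod w \<noteq> 1 \<Longrightarrow>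
     \<exists>L. (g has_derivative L) (at w) \<and> (\<forall>v. cmod (L v) \<le> C * (1 / sqrt \<bar>(cmod w)\<^sup>2 - 1\<bar> + 1) * cmod v)"
proof -
  obtain C where C: "C > 0" "\<And>z. Im z \<noteq> 0 \<Longrightarrow> cmod (E_z z) + cmod (E_zbar z) \<le> C * (1 / sqrt \<bar>Im z\<bar> + 1)"
    using E1_derivative_bound by blast
  have "compact {w. 1/2 \<le> cmod w \<and> cmod w \<le> 2}"
  proof -
    have "{w. 1/2 \<le> cmod w \<and> cmod w \<le> 2} = cball 0 2 - ball 0 (1/2)" by auto
    then show ?thesis by (simp add: compact_diff)
  qed
  moreover have "continuous_on {w. 1/2 \<le> cmod w \<and> cmod w \<le> 2} g"
    by (intro continuous_at_imp_continuous_on ballI g_isCont) auto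
  ultimately have "bounded (g ` {w. 1/2 \<le> cmod w \<and> cmod w \<le> 2})"
    using compact_continuous_image compact_imp_bounded by blast
  then obtain B where B: "B > 0" "\<And>w. 1/2 \<le> cmod w \<Longrightarrow> cmod w \<le> 2 \<Longrightarrow> cmod (g w) \<le> B"
    unfolding bounded_pos by auto
  define A where "A = sqrt (12 * pi)"
  have A: "A \<ge> 1" using pi_ge_two by (simp add: A_def)
  show ?thesis
  proof (rule that[of "2 * B * C * A"])
    show "2 * B * C * A > 0" using B C A by simp
    fix w assume w: "w \<in> annulus (1/2)" "cmod w \<noteq> 1"
    then have nw: "1/2 < cmod w" "cmod w < 2" by (auto simp: annulus_def)
    then have "w \<noteq> 0" by auto
    then obtain z where z: "w = cproj z" using cproj_surj by blast
    have Im: "Im z \<noteq> 0" using w(2) sphere_cproj[of z] z by auto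
    define c d where "c = 2 * of_real pi * \<i> * g (cproj z)" and "d = 1 / (2 * of_real pi * \<i> * cproj z)"
    define \<alpha> \<beta> where "\<alpha> = E_z z" and "\<beta> = E_zbar z"
    define L where "L v = (c * \<alpha> * d) * v + (c * \<beta> * cnj d) * cnj v" for v
    have L: "(g has_derivative L) (at w)"
      using g_has_derivative[OF Im] unfolding L_def[abs_def] c_def d_def \<alpha>_def \<beta>_def z .
    have "ln (cmod w) = - (2 * pi * Im z)" unfolding z norm_cproj by simp
    then have "\<bar>ln (cmod w)\<bar> = 2 * pi * \<bar>Im z\<bar>" by (simp add: abs_mult)
    then have "\<bar>(cmod w)\<^sup>2 - 1\<bar> / 6 \<le> 2 * pi * \<bar>Im z\<bar>" using abs_ln_lower[OF nw] by simp
    then have "\<bar>(cmod w)\<^sup>2 - 1\<bar> \<le> 12 * pi * \<bar>Im z\<bar>" by simp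
    then have "sqrt \<bar>(cmod w)\<^sup>2 - 1\<bar> \<le> A * sqrt \<bar>Im z\<bar>"
      unfolding A_def real_sqrt_mult[symmetric] by simp
    moreover have "sqrt \<bar>(cmod w)\<^sup>2 - 1\<bar> > 0"
    proof -
      have "cmod w \<noteq> - 1" using norm_ge_zero[of w] by linarith
      with w(2) show ?thesis by (simp add: power2_eq_1_iff)
    qed
    ultimately have "1 / sqrt \<bar>Im z\<bar> \<le> A * (1 / sqrt \<bar>(cmod w)\<^sup>2 - 1\<bar>)"
      using Im by (simp add: field_simps)
    then have 1: "1 / sqrt \<bar>Im z\<bar> + 1 \<le> A * (1 / sqrt \<bar>(cmod w)\<^sup>2 - 1\<bar> + 1)" using A unfolding distrib_left by linarith
    have cd: "cmod c * cmod d \<le> 2 * B"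
    proof -
      have "cmod c * cmod d = cmod (g w) / cmod w" by (simp add: c_def d_def norm_mult norm_divide z)
      also have "\<dots> \<le> B / (1/2)" using nw B by (intro frac_le) auto
      finally show ?thesis by simp
    qed
    have "cmod (L v) \<le> 2 * B * C * A * (1 / sqrt \<bar>(cmod w)\<^sup>2 - 1\<bar> + 1) * cmod v" for v
    proof -
      have "cmod (L v) \<le> cmod ((c * \<alpha> * d) * v) + cmod ((c * \<beta> * cnj d) * cnj v)"
        unfolding L_def by (rule norm_triangle_ineq)
      also have "\<dots> = cmod c * cmod d * (cmod \<alpha> + cmod \<beta>) * cmod v" by (simp add: norm_mult algebra_simps)
      also have "\<dots> \<le> (2 * B) * (C * (1 / sqrt \<bar>Im z\<bar> + 1)) * cmod v"
        using C(2)[OF Im] B unfolding \<alpha>_def \<beta>_def by (intro mult_right_mono[OF mult_mono[OF cd]]) auto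
      also have "\<dots> \<le> (2 * B) * (C * (A * (1 / sqrt \<bar>(cmod w)\<^sup>2 - 1\<bar> + 1))) * cmod v"
        using 1 B C by (intro mult_right_mono mult_left_mono) auto
      finally show ?thesis by (simp only: mult.assoc)
    qed
    with L show "\<exists>L. (g has_derivative L) (at w) \<and> (\<forall>v. cmod (L v) \<le> 2 * B * C * A * (1 / sqrt \<bar>(cmod w)\<^sup>2 - 1\<bar> + 1) * cmod v)"
      by blast
  qed
qed

text \<open>Treats horizontal and vertical lines together: \<open>\<bar>c\<bar>\<close> is the
  distance of the line from 0, and \<open>c\<^sup>2 \<noteq> 1\<close> excludes tangents to the unit
  circle.\<close>

lemma g_abs_continuous_line:
  assumes w: "\<And>t. (w has_vector_derivative u) (at t)" "cmod u = 1"
    and c: "c\<^sup>2 \<noteq> 1" "\<And>t. (cmod (w t))\<^sup>2 = t\<^sup>2 + c\<^sup>2"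
    and wA: "\<And>t. t \<in> {a..b} \<Longrightarrow> w t \<in> annulus (1/2)"
  shows "abs_continuous_on a b (\<lambda>t. g (w t))"
proof -
  obtain C where C: "C > 0" "\<And>w. w \<in> annulus (1/2) \<Longrightarrow> cmod w \<noteq> 1 \<Longrightarrow>
     \<exists>L. (g has_derivative L) (at w) \<and> (\<forall>v. cmod (L v) \<le> C * (1 / sqrt \<bar>(cmod w)\<^sup>2 - 1\<bar> + 1) * cmod v)"
    using g_derivative_bound by blast
  define \<sigma> where "\<sigma> = sqrt \<bar>1 - c\<^sup>2\<bar>"
  have \<sigma>: "\<sigma> > 0" "\<sigma>\<^sup>2 = \<bar>1 - c\<^sup>2\<bar>" using c by (auto simp: \<sigma>_def)
  \<comment> \<open>If \<open>c\<^sup>2 < 1\<close>, the line crosses the circle at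
    \<open>t = \<plusminus>\<sigma>\<close> and the inverse square root singularities dominate;
    otherwise \<open>(cmod (w t))\<^sup>2 - 1\<close> is at least \<open>\<sigma>\<^sup>2\<close>,
    which the constant \<open>1 / \<sigma>\<close> covers. The sum serves both cases.\<close>
  define \<psi> where "\<psi> t = C * (1 / sqrt \<sigma> * (1 / sqrt \<bar>t - \<sigma>\<bar> + 1 / sqrt \<bar>t - (- \<sigma>)\<bar>) + (1 / \<sigma> + 1))" for t
  have bound: "C * (1 / sqrt \<bar>(cmod (w t))\<^sup>2 - 1\<bar> + 1) \<le> \<psi> t" if t: "t \<noteq> \<sigma>" "t \<noteq> - \<sigma>" for t
  proof -
    have "1 / sqrt \<bar>t\<^sup>2 + c\<^sup>2 - 1\<bar> \<le> 1 / sqrt \<sigma> * (1 / sqrt \<bar>t - \<sigma>\<bar> + 1 / sqrt \<bar>t - (- \<sigma>)\<bar>) + 1 / \<sigma>"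
    proof (cases "c\<^sup>2 < 1")
      case True
      then have e: "t\<^sup>2 + c\<^sup>2 - 1 = t\<^sup>2 - \<sigma>\<^sup>2" using \<sigma> by simp
      have "0 \<le> 1 / \<sigma>" using \<sigma>(1) by simp
      then show ?thesis unfolding e by (rule add_increasing2[OF _ inverse_sqrt_quadratic_bound[OF \<sigma>(1) t]])
    next
      case False
      moreover have "t\<^sup>2 \<ge> 0" by simp
      ultimately have "\<sigma>\<^sup>2 \<le> \<bar>t\<^sup>2 + c\<^sup>2 - 1\<bar>" unfolding \<sigma>(2) by linarith
      then have "\<sigma> \<le> sqrt \<bar>t\<^sup>2 + c\<^sup>2 - 1\<bar>" by (rule real_le_rsqrt)
      then have "1 / sqrt \<bar>t\<^sup>2 + c\<^sup>2 - 1\<bar> \<le> 1 / \<sigma>" using \<sigma>(1) by (intro frac_le) auto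
      moreover have "0 \<le> 1 / sqrt \<sigma> * (1 / sqrt \<bar>t - \<sigma>\<bar> + 1 / sqrt \<bar>t - (- \<sigma>)\<bar>)" using \<sigma> by simp
      ultimately show ?thesis by linarith
    qed
    then show ?thesis unfolding \<psi>_def c(2) using C(1) by (intro mult_left_mono) auto
  qed
  have vd: "\<exists>D. ((\<lambda>t. g (w t)) has_vector_derivative D) (at t) \<and> cmod D \<le> \<psi> t"
    if t: "t \<in> {a<..<b} - {\<sigma>, - \<sigma>}" for t
  proof -
    have n1: "cmod (w t) \<noteq> 1"
    proof
      assume "cmod (w t) = 1"
      then have 1: "t\<^sup>2 = 1 - c\<^sup>2" using c(2)[of t] by simp
      then have "t\<^sup>2 = \<sigma>\<^sup>2" using \<sigma>(2) by (metis abs_of_nonneg zero_le_power2)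
      then show False using t by (auto simp: power2_eq_iff)
    qed
    obtain L where L: "(g has_derivative L) (at (w t))"
      "\<And>v. cmod (L v) \<le> C * (1 / sqrt \<bar>(cmod (w t))\<^sup>2 - 1\<bar> + 1) * cmod v"
      using C(2)[OF wA n1] t by auto
    have "((\<lambda>t. g (w t)) has_derivative (\<lambda>s. L (s *\<^sub>R u))) (at t)"
      using has_derivative_compose[OF w(1)[unfolded has_vector_derivative_def] L(1)] .
    moreover have "L (s *\<^sub>R u) = s *\<^sub>R L u" for s
      using has_derivative_linear[OF L(1)] by (rule linear_scale)
    ultimately have "((\<lambda>t. g (w t)) has_vector_derivative L u) (at t)"
      by (simp add: has_vector_derivative_def)
    moreover have "cmod (L u) \<le> \<psi> t" using L(2)[of u] w(2) bound[of t] t by simp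
    ultimately show ?thesis by blast
  qed
  then obtain k' where k': "\<And>t. t \<in> {a<..<b} - {\<sigma>, - \<sigma>} \<Longrightarrow> ((\<lambda>t. g (w t)) has_vector_derivative k' t) (at t) \<and> cmod (k' t) \<le> \<psi> t"
    by metis
  show ?thesis
  proof (rule abs_continuous_on_derivative_bound[of a b _ "{\<sigma>, - \<sigma>}" k' \<psi>])
    show "continuous_on {a..b} (\<lambda>t. g (w t))"
    proof (intro continuous_at_imp_continuous_on ballI isCont_o2[of _ w g] g_isCont)
      fix t assume "t \<in> {a..b}"
      then show "w t \<noteq> 0" using wA[of t] by (auto simp: annulus_def)
      show "isCont w t" using w(1) has_vector_derivative_continuous by blast
    qed
    show "\<psi> absolutely_integrable_on {a..b}"
      unfolding \<psi>_def[abs_def]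
      by (intro absolutely_integrable_scaleR_left[where c=C and f="\<lambda>t. t", simplified] set_integrable_mult_right set_integral_add inverse_sqrt_absolutely_integrable absolutely_integrable_on_const) auto
    show "\<psi> x \<ge> 0" for x using C \<sigma> by (simp add: \<psi>_def)
  qed (use k' in auto)
qed

lemma g_locally_quasiconformal: "locally_quasiconformal_on (annulus (1/2)) g"
  unfolding locally_quasiconformal_on_def
proof
  fix w assume w: "w \<in> annulus (1/2)"
  then have "w \<noteq> 0" by (auto simp: annulus_def)
  then obtain d1 where d1: "d1 > 0" "inj_on g (ball w d1)" "0 \<notin> ball w d1" using g_locally_inj by blast
  obtain d2 where d2: "d2 > 0" "ball w d2 \<subseteq> annulus (1/2)" using open_annulus w by (meson openE)
  define V where "V = ball w (min d1 d2)"
  have V: "w \<in> V" "V \<subseteq> annulus (1/2)" "open V" "inj_on g V"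
    using d1 d2 by (auto simp: V_def intro: inj_on_subset)
  have nz: "v \<noteq> 0" if "v \<in> annulus (1/2)" for v using that by (auto simp: annulus_def)
  have cV: "continuous_on V g"
    by (intro continuous_at_imp_continuous_on ballI g_isCont nz) (use V in auto)
  have "quasiconformal_on V g"
    unfolding quasiconformal_on_def
  proof (intro conjI)
    show "open V" by (rule V)
    show "open (g ` V)" by (rule invariance_of_domain[OF cV V(3,4)])
    show "\<exists>h. homeomorphism V (g ` V) g h"
      using invariance_of_domain_homeomorphism[OF V(3) cV _ V(4)] by auto
    show "ACL_on V g" unfolding ACL_on_def
    proof (intro allI impI conjI)
      fix a b c d assume box: "cbox (Complex a c) (Complex b d) \<subseteq> V"
      have mem: "Complex x y \<in> annulus (1/2)" if "x \<in> {a..b}" "y \<in> {c..d}" for x y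
      proof -
        have "Complex x y \<in> cbox (Complex a c) (Complex b d)" using that by (simp add: in_cbox_complex_iff)
        then show ?thesis using box V(2) by blast
      qed
      \<comment> \<open>The excluded values give the tangents to the circle, along which the
        derivative bound behaves like 1 / \<bar>t\<bar> and is not integrable.\<close>
      have ae: "AE y in lebesgue. y \<notin> {1, -1::real}"
        by (rule AE_not_in) (simp add: negligible_iff_null_sets[symmetric] negligible_finite)
      have sq: "y\<^sup>2 \<noteq> 1" if "y \<notin> {1, -1::real}" for y using that by (simp add: power2_eq_1_iff)
      have X: "abs_continuous_on a b (\<lambda>x. g (Complex x y))" if "y \<notin> {1, -1}" "y \<in> {c..d}" for y
      proof (rule g_abs_continuous_line[of "\<lambda>x. Complex x y" 1 y])
        show "((\<lambda>x. Complex x y) has_vector_derivative 1) (at t)" for t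
        proof -
          have "((\<lambda>x. of_real x + \<i> * of_real y) has_vector_derivative of_real 1 + 0) (at t)"
            by (intro has_vector_derivative_add has_vector_derivative_const has_vector_derivative_of_real DERIV_ident)
          then show ?thesis by (simp add: Complex_eq)
        qed
        show "(cmod (Complex t y))\<^sup>2 = t\<^sup>2 + y\<^sup>2" for t by (simp add: cmod_power2)
      qed (use sq that mem in auto)
      have Y: "abs_continuous_on c d (\<lambda>y. g (Complex x y))" if "x \<notin> {1, -1}" "x \<in> {a..b}" for x
      proof (rule g_abs_continuous_line[of "\<lambda>y. Complex x y" \<i> x])
        show "((\<lambda>y. Complex x y) has_vector_derivative \<i>) (at t)" for t
        proof -
          have "((\<lambda>y. of_real x + \<i> * of_real y) has_vector_derivative 0 + \<i> * of_real 1) (at t)"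
            by (intro has_vector_derivative_add has_vector_derivative_const has_vector_derivative_mult_right has_vector_derivative_of_real DERIV_ident)
          then show ?thesis by (simp add: Complex_eq)
        qed
        show "(cmod (Complex x t))\<^sup>2 = t\<^sup>2 + x\<^sup>2" for t by (simp add: cmod_power2)
      qed (use sq that mem in auto)
      show "AE y in lebesgue. y \<in> {c..d} \<longrightarrow> abs_continuous_on a b (\<lambda>x. g (Complex x y))"
        using ae by eventually_elim (use X in auto)
      show "AE x in lebesgue. x \<in> {a..b} \<longrightarrow> abs_continuous_on c d (\<lambda>y. g (Complex x y))"
        using ae by eventually_elim (use Y in auto)
    qed
    obtain k where k: "0 \<le> k" "k < 1"
      "\<And>z. Im z \<noteq> 0 \<Longrightarrow> cmod (E_zbar z) \<le> k * cmod (E_z z)"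
      using E1_beltrami by blast
    have ae: "AE z in lebesgue. z \<notin> sphere (0::complex) 1"
      by (rule AE_not_in) (simp add: negligible_iff_null_sets[symmetric] negligible_sphere)
    have q: "cmod (d_zbar g w) \<le> k * cmod (d_z g w)" if w: "w \<notin> sphere 0 1" "w \<in> V" for w
    proof -
      have "w \<noteq> 0" using nz V w by blast
      then obtain z where z: "w = cproj z" using cproj_surj by blast
      have Im: "Im z \<noteq> 0" using w(1) sphere_cproj z by blast
      define c d where "c = 2 * of_real pi * \<i> * g (cproj z)" and "d = 1 / (2 * of_real pi * \<i> * cproj z)"
      from derivatives_of_real_linear[OF g_has_derivative[OF Im]]
      have e: "d_z g w = c * E_z z * d" "d_zbar g w = c * E_zbar z * cnj d"
        by (simp_all add: z c_def d_def)
      have "cmod (d_zbar g w) = cmod c * cmod d * cmod (E_zbar z)" unfolding e by (simp add: norm_mult)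
      also have "\<dots> \<le> cmod c * cmod d * (k * cmod (E_z z))" using k(3)[OF Im] by (intro mult_left_mono) auto
      also have "\<dots> = k * cmod (d_z g w)" unfolding e by (simp add: norm_mult)
      finally show ?thesis .
    qed
    have "AE z in lebesgue. z \<in> V \<longrightarrow> cmod (d_zbar g z) \<le> k * cmod (d_z g z)"
      using ae by eventually_elim (use q in auto)
    then show "\<exists>k. 0 \<le> k \<and> k < 1 \<and> (AE z in lebesgue. z \<in> V \<longrightarrow> cmod (d_zbar g z) \<le> k * cmod (d_z g z))"
      using k by blast
  qed
  then show "\<exists>V. w \<in> V \<and> V \<subseteq> annulus (1/2) \<and> quasiconformal_on V g" using V by blast
qed

end

section \<open>The UAC conditions for \<open>g\<close>, and the passage from \<open>f\<close> to its
  lift\<close>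

context uaa_lift begin

lemma UAC_system_g:
  assumes f: "\<And>x. f (circle_proj x) = circle_proj (F x)"
  shows "UAC_system (1/2) f g"
  unfolding UAC_system_def
proof (intro conjI)
  show "orientation_preserving_on (annulus (1/2)) g"
    unfolding orientation_preserving_on_def by (intro ballI g_orientation) (auto simp: annulus_def)
  show "locally_quasiconformal_on (annulus (1/2)) g" by (rule g_locally_quasiconformal)
  show "\<forall>z\<in>sphere 0 1. g z = f z"
  proof
    fix w :: complex assume w: "w \<in> sphere 0 1"
    then obtain x where "w = cproj (of_real x)" using circle_cprojE by blast
    then show "g w = f w" using g_circle[of x] f[of x] cproj_of_real by metis
  qed
  show "reflection_invariant_on (annulus (1/2)) g"
    unfolding reflection_invariant_on_def by (auto simp: annulus_def intro!: g_reflection)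
  show "\<forall>\<epsilon>>0. \<exists>r'. 1/2 \<le> r' \<and> r' < 1 \<and>
        (\<forall>n>0.
           (\<forall>\<gamma> b. path \<gamma> \<and> path_image \<gamma> \<subseteq> annulus r' \<and> pathstart \<gamma> \<in> sphere 0 1 \<and>
                  circle_inverse_branch_at f n (pathstart \<gamma>) b \<longrightarrow>
              (\<exists>H. continues_branch_along (annulus (1/2)) g n b \<gamma> H)) \<and>
           (AE z in lebesgue. z \<in> annulus r' \<longrightarrow>
              (\<forall>\<gamma> b H. path \<gamma> \<and> path_image \<gamma> \<subseteq> annulus r' \<and> pathstart \<gamma> \<in> sphere 0 1 \<and>
                  circle_inverse_branch_at f n (pathstart \<gamma>) b \<and>
                  continues_branch_along (annulus (1/2)) g n b \<gamma> H \<and> pathfinish \<gamma> = z \<longrightarrow>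
                dilatation (H 1) z < 1 + \<epsilon>)))"
    (is "\<forall>\<epsilon>>0. \<exists>r'. ?P \<epsilon> r'")
  proof (intro allI impI)
    fix e :: real assume e: "e > 0"
    obtain \<tau>1 where \<tau>1: "\<tau>1 > 0" "\<And>n r w b. n > 0 \<Longrightarrow> r > 0 \<Longrightarrow> inverse_branch_at (annulus r) g n w b \<Longrightarrow>
      (\<And>z. w = cproj z \<Longrightarrow> Im z \<noteq> 0 \<and> \<bar>Im z\<bar> < \<tau>1) \<Longrightarrow> dilatation b w < 1 + e"
      using branch_dilatation[OF e] by blast
    have "- ln (1/2) / (2 * pi) > (0::real)" by (simp add: ln_div)
    then obtain \<tau>2 where \<tau>2: "\<tau>2 > 0" "\<And>n z. \<bar>Im z\<bar> < \<tau>2 \<Longrightarrow> \<bar>Im (D n z)\<bar> < - ln (1/2) / (2 * pi)"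
      using D_strip by blast
    \<comment> \<open>The annulus of radius \<open>exp (- (2 * pi * \<tau>))\<close> corresponds to
      the strip of half-width \<tau>. Here \<open>\<tau>1\<close> controls the dilatation and
      \<open>\<tau>2\<close> keeps the intermediate preimages in the fixed annulus; the maximum
      ensures \<open>1/2 \<le> r'\<close>.\<close>
    define r' where "r' = max (1/2) (exp (- (2 * pi * min \<tau>1 \<tau>2)))"
    have r': "1/2 \<le> r'" "r' < 1" "0 < r'" using \<tau>1 \<tau>2 by (auto simp: r'_def)
    have strip: "- ln r' / (2 * pi) \<le> min \<tau>1 \<tau>2"
    proof -
      have "- (2 * pi * min \<tau>1 \<tau>2) = ln (exp (- (2 * pi * min \<tau>1 \<tau>2)))" by simp
      also have "\<dots> \<le> ln r'" using r' by (subst ln_le_cancel_iff) (auto simp: r'_def)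
      finally have "- ln r' \<le> min \<tau>1 \<tau>2 * (2 * pi)" by (simp add: mult_ac)
      then show ?thesis by (subst pos_divide_le_eq) auto
    qed
    \<comment> \<open>The exceptional null set is the circle itself, the same for all
      \<open>n\<close>, paths and branches.\<close>
    have ae: "AE z in lebesgue. z \<notin> sphere (0::complex) 1"
      by (rule AE_not_in) (simp add: negligible_iff_null_sets[symmetric] negligible_sphere)
    have "(\<exists>H. continues_branch_along (annulus (1/2)) g n b \<gamma> H)"
      if "path \<gamma>" "path_image \<gamma> \<subseteq> annulus r'" "circle_inverse_branch_at f n (pathstart \<gamma>) b" for n \<gamma> b
      by (rule branch_continuation[where r'=r', OF f]) (use that r' \<tau>2(2) strip in \<open>auto intro: less_le_trans\<close>)
    moreover have "dilatation (B 1) z < 1 + e"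
      if n: "n > 0" and z: "z \<in> annulus r'" "z \<notin> sphere 0 1"
        and B: "continues_branch_along (annulus (1/2)) g n b \<gamma> B" "pathfinish \<gamma> = z" for n z \<gamma> b B
    proof (rule \<tau>1(2)[OF n])
      show "inverse_branch_at (annulus (1/2)) g n z (B 1)"
        using B unfolding continues_branch_along_def pathfinish_def by auto
      show "Im u \<noteq> 0 \<and> \<bar>Im u\<bar> < \<tau>1" if "z = cproj u" for u
        using z sphere_cproj[of u] annulus_cproj[OF r'(3), of u] strip unfolding that by linarith
    qed simp
    ultimately show "\<exists>r'. ?P e r'"
      by (intro exI[of _ r'] conjI r' allI impI eventually_mono[OF ae]) blast+
  qed
qed auto

end

text \<open>\<open>F (x + 1) - F x\<close> is continuous with integer values, hence a constant
  \<open>k\<close>. Deforming \<open>F\<close> linearly to \<open>k * t\<close> shows that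
  \<open>k\<close> is the winding number in the definition of the degree, so \<open>k = m\<close>.
  Then \<open>F 0 < F 1\<close>, which decides that the continuous injective \<open>F\<close> is
  increasing.\<close>

lemma lift_shift:
  assumes f: "circle_endomorphism m f" and F: "is_lift f F"
  shows "continuous_on UNIV F" "strict_mono F" "F (x + 1) = F x + m"
proof -
  obtain F' where hom: "homeomorphism UNIV UNIV F F'" using F by (auto simp: is_lift_def)
  show c: "continuous_on UNIV F" using hom by (simp add: homeomorphism_def)
  have inj: "inj F" using hom by (metis UNIV_I homeomorphism_apply1 injI)
  have F0: "F 0 = 0" using F by (simp add: is_lift_def)
  have m: "m > 1" using f by (simp add: circle_endomorphism_def)
  have FP: "cproj (of_real (F x)) = f (cproj (of_real x))" for x
    using F unfolding is_lift_def cproj_of_real by (metis comp_apply)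
  have per: "\<exists>j::int. F (x + 1) = F x + of_int j" for x
  proof -
    have "cproj (of_real (x + 1)) = cproj (of_real x)"
      using cproj_eq_iff[of "of_real (x + 1)" "of_real x"] by (metis of_int_1 of_real_1 of_real_add)
    then have "cproj (of_real (F (x + 1))) = cproj (of_real (F x))" unfolding FP by simp
    then obtain j :: int where "complex_of_real (F (x + 1)) = of_real (F x) + of_int j" using cproj_eq_iff by blast
    then have "F (x + 1) = F x + of_int j" by (metis of_real_add of_real_eq_iff of_real_of_int_eq)
    then show ?thesis by blast
  qed
  have "(\<lambda>x. F (x + 1) - F x) constant_on UNIV"
  proof (rule continuous_discrete_range_constant)
    show "continuous_on UNIV (\<lambda>x. F (x + 1) - F x)"
      by (intro continuous_intros continuous_on_compose2[OF c]) auto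
    fix x :: real
    show "\<exists>e>0. \<forall>y. y \<in> UNIV \<and> F (y + 1) - F y \<noteq> F (x + 1) - F x \<longrightarrow> e \<le> norm (F (y + 1) - F y - (F (x + 1) - F x))"
    proof (intro exI[of _ 1] conjI allI impI)
      fix y assume y: "y \<in> UNIV \<and> F (y + 1) - F y \<noteq> F (x + 1) - F x"
      obtain i j :: int where ij: "F (y + 1) = F y + of_int i" "F (x + 1) = F x + of_int j" using per by metis
      then have "i \<noteq> j" using y by auto
      then have "1 \<le> \<bar>i - j\<bar>" by linarith
      then have "1 \<le> real_of_int \<bar>i - j\<bar>" by linarith
      then show "1 \<le> norm (F (y + 1) - F y - (F (x + 1) - F x))" by (simp add: ij)
    qed auto
  qed auto
  then obtain k where k: "\<And>x. F (x + 1) = F x + k" unfolding constant_on_def by (metis UNIV_I add_diff_cancel_left' diff_add_cancel add.commute)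
  let ?p = "\<lambda>t. exp (2 * of_real pi * \<i> * of_real (F t))"
  have circ: "f \<circ> circlepath 0 1 = ?p"
  proof
    fix t :: real
    have "circlepath 0 1 t = cproj (of_real t)" by (simp add: circlepath cproj_def mult_ac)
    then show "(f \<circ> circlepath 0 1) t = ?p t" using FP[of t] by (simp add: cproj_def)
  qed
  have k1: "k = F 1" using k[of 0] F0 by simp
  have "winding_number ?p 0 = of_real k"
  proof -
    obtain j :: int where j: "k = of_int j" using per[of 0] k[of 0] by auto
    let ?q = "\<lambda>t. exp (2 * of_real pi * \<i> * of_real (k * t))"
    let ?K = "\<lambda>p. exp (2 * of_real pi * \<i> * of_real ((1 - fst p) * F (snd p) + fst p * (k * snd p)))"
    have "winding_number (\<lambda>t. ?K (0, t)) 0 = winding_number (\<lambda>t. ?K (1, t)) 0"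
    proof (rule winding_number_homotopy)
      show "continuous_on ({0..1} \<times> {0..1}) ?K"
        by (intro continuous_intros continuous_on_compose2[OF c]) auto
      show "?K (s, 0) = ?K (s, 1)" for s
      proof -
        have "(1 - s) * F 1 + s * (k * 1) = of_int j" using k1 j by (simp add: algebra_simps)
        then show ?thesis using cproj_int[of j] F0 by (simp add: cproj_def)
      qed
    qed auto
    then have "winding_number ?p 0 = winding_number ?q 0" by simp
    also have "\<dots> = of_real k"
    proof -
      \<comment> \<open>The loop is \<open>exp\<close> along the segment from 0 to \<open>c\<close>,
        and substitution turns the integral of 1/w into the integral of 1 over that segment, namely
        \<open>c\<close>.\<close>
      define c where "c = 2 * of_real pi * \<i> * of_real k"
      have q: "?q = exp \<circ> linepath 0 c"
        by (auto simp: fun_eq_iff c_def linepath_def scaleR_conv_of_real mult_ac)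
      have vp: "valid_path (exp \<circ> linepath 0 c)"
        by (rule valid_path_compose_holomorphic[where S=UNIV]) (auto intro: holomorphic_intros)
      have "contour_integral (exp \<circ> linepath 0 c) (\<lambda>w. 1 / (w - 0)) =
          contour_integral (linepath 0 c) (\<lambda>w. deriv exp w * (1 / (exp w - 0)))"
        by (rule contour_integral_comp_analyticW[where s=UNIV]) (auto intro: analytic_intros)
      also have "\<dots> = contour_integral (linepath 0 c) (\<lambda>w. 1)"
        by (simp add: DERIV_imp_deriv[OF DERIV_exp])
      finally show ?thesis unfolding q
        by (subst winding_number_valid_path[OF vp]) (auto simp: path_image_def c_def)
    qed
    finally show ?thesis .
  qed
  then have "complex_of_real k = of_nat m" using f circ by (simp add: circle_endomorphism_def)
  then have km: "k = m" by (metis of_real_eq_iff of_real_of_nat_eq)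
  then show "F (x + 1) = F x + m" using k by simp
  have F01: "F 1 > F 0" using k1 km m F0 by simp
  moreover have "strict_mono F \<or> strict_antimono_on UNIV F"
    using injective_eq_monotone_map[of UNIV F] c inj by auto
  ultimately show "strict_mono F" by (metis UNIV_I monotone_onD not_less_iff_gr_or_eq zero_less_one)
qed

theorem theorem4:
  fixes m :: nat and f :: "complex \<Rightarrow> complex"
  assumes "1 < m"
    and "circle_endomorphism m f"
    and "uniformly_asymptotically_affine f"
  shows "\<exists>r g. UAC_system r f g"
proof -
  obtain F \<epsilon> where F: "is_lift f F" and \<epsilon>: "vanishing \<epsilon>"
    and uaa: "\<And>n x y. n > 0 \<Longrightarrow> y > 0 \<Longrightarrow>
      1 / (1 + \<epsilon> y) \<le> (inv (F ^^ n) (x + y) - inv (F ^^ n) x) / (inv (F ^^ n) x - inv (F ^^ n) (x - y)) \<and>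
      (inv (F ^^ n) (x + y) - inv (F ^^ n) x) / (inv (F ^^ n) x - inv (F ^^ n) (x - y)) \<le> 1 + \<epsilon> y"
    using assms(3) unfolding uniformly_asymptotically_affine_def Let_def by blast
  interpret uaa_lift F m \<epsilon>
  proof
    show "F 0 = 0" using F by (simp add: is_lift_def)
  qed (use assms(1) lift_shift[OF assms(2) F] \<epsilon> uaa in auto)
  have "f (circle_proj x) = circle_proj (F x)" for x
    using F unfolding is_lift_def by (metis comp_apply)
  then show ?thesis using UAC_system_g by blast
qed

end
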